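(* Let $S$ be a ring, let $C$ be a multiplicatively closed subset of nonzerodivisors of $S$, let $R$ be a subring of $S$ that is twisted along $C$ by a $C$-torsion-free $S$-module $K$, and let $D$ be the derivation that twists $R$. Then the mapping $$f:R\to S\star K,\quad r\mapsto (r,D(r)),$$ is an analytic isomorphism along $C$. If also $S$ is a domain, $K$ is torsion-free and $R$ is strongly twisted by $K$ (with $D$ the derivation that strongly twists $R$ by $K$), then this map is faithfully flat.
   Context: All rings are commutative with identity. A derivation $D$ from a ring $B$ to a $B$-module $L$ is an additive map with $D(st)=sD(t)+tD(s)$; it is $C$-linear for a subset $C\subseteq B$ if $D(C)=0$. For a multiplicatively closed set $C$, $S_C$ and $K_C$ denote localizations at $C$. An $S$-module $L$ is $C$-torsion-free if $c\ell=0$ with $c\in C$, $\ell\in L$ implies $\ell=0$. Twisted: let $S$ be a ring, $K$ an $S$-module, and $C$ a multiplicatively closed subset of nonzerodivisors of $S$ that are also nonzerodivisors on $K$. A subring $R$ of $S$ is twisted by $K$ along $C$ if there is a $C$-linear derivation $D:S_C\to K_C$ such that (a) $R=S\cap D^{-1}(K)$; (b) $D(S_C)$ generates $K_C$ as an $S_C$-module; (c) $S\subseteq \operatorname{Ker} D+cS$ for all $c\in C$. Such a $D$ is said to twist $R$ by $K$ along $C$. Strongly twisted: let $S$ be a domain with quotient field $F$, $K$ a torsion-free $S$-module, and $FK=F\otimes_S K$. A subring $R$ of $S$ is strongly twisted by $K$ if there is a derivation $D:F\to FK$ such that (a) $R=S\cap D^{-1}(K)$; (b) $D(F)$ generates $FK$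 as an $F$-vector space; (c) $S\subseteq\operatorname{Ker} D+sS$ for all $0\neq s\in S$. Such a $D$ is said to strongly twist $R$ by $K$. (In this case $R$ is twisted by $K$ along $(S\cap\operatorname{Ker}D)\setminus\{0\}$.) Idealization: $S\star K$ is the abelian group $S\oplus K$ with multiplication $(s_1,k_1)(s_2,k_2)=(s_1s_2,s_1k_2+s_2k_1)$. Analytic isomorphism: a ring homomorphism $\alpha:A\to B$ is an analytic isomorphism along a multiplicatively closed subset $C$ of $A$, where the elements of $\alpha(C)$ are nonzerodivisors of $B$, if for each $c\in C$ the induced map $A/cA\to B/\alpha(c)B$ is an isomorphism. *)

theory Defs
  imports "HOL-Algebra.Algebra"
begin

text \<open>
  Rings and modules are those of HOL-Algebra; a subring is a subset \<open>R\<close> of the carrier, and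
  \<open>S\<lparr>carrier := R\<rparr>\<close> is \<open>R\<close> as a ring.  A module record extends a ring record, but the locale
  \<^locale>\<open>module\<close> does not look at the slots \<open>mult\<close> and \<open>one\<close>, so below they are left
  \<open>undefined\<close> in records that are only meant as modules.
\<close>

definition module_hom ::
    "('r, 'x) ring_scheme \<Rightarrow> ('r, 'a, 'y) module_scheme \<Rightarrow> ('r, 'b, 'z) module_scheme \<Rightarrow> ('a \<Rightarrow> 'b) set"
  where "module_hom R M N = {h \<in> carrier M \<rightarrow> carrier N.
     (\<forall>x\<in>carrier M. \<forall>y\<in>carrier M. h (x \<oplus>\<^bsub>M\<^esub> y) = h x \<oplus>\<^bsub>N\<^esub> h y) \<and>
     (\<forall>r\<in>carrier R. \<forall>x\<in>carrier M. h (r \<odot>\<^bsub>M\<^esub> x) = r \<odot>\<^bsub>N\<^esub> h x)}"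

text \<open>The ring \<open>B\<close> as a module along \<open>f : A \<rightarrow> B\<close>; \<open>restrict_scalars id S\<close> is \<open>S\<close> over itself.\<close>

definition restrict_scalars :: "('a \<Rightarrow> 'b) \<Rightarrow> ('b, 'y) ring_scheme \<Rightarrow> ('a, 'b) module"
  where "restrict_scalars f B =
    \<lparr>carrier = carrier B, monoid.mult = monoid.mult B, one = \<one>\<^bsub>B\<^esub>, ring.zero = \<zero>\<^bsub>B\<^esub>, add = ring.add B,
     smult = (\<lambda>a b. f a \<otimes>\<^bsub>B\<^esub> b)\<rparr>"


section \<open>Localization\<close>

definition nonzerodivisors :: "('s, 'x) ring_scheme \<Rightarrow> 's set"
  where "nonzerodivisors S = {c \<in> carrier S. \<forall>s\<in>carrier S. c \<otimes>\<^bsub>S\<^esub> s = \<zero>\<^bsub>S\<^esub> \<longrightarrow> s = \<zero>\<^bsub>S\<^esub>}"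

definition torsion_free_along :: "'s set \<Rightarrow> ('s, 'k, 'y) module_scheme \<Rightarrow> bool"
  where "torsion_free_along C K \<longleftrightarrow>
    (\<forall>c\<in>C. \<forall>k\<in>carrier K. c \<odot>\<^bsub>K\<^esub> k = \<zero>\<^bsub>K\<^esub> \<longrightarrow> k = \<zero>\<^bsub>K\<^esub>)"

definition fraction_rel :: "'s set \<Rightarrow> ('s, 'k, 'y) module_scheme \<Rightarrow> (('k \<times> 's) \<times> ('k \<times> 's)) set"
  where "fraction_rel C K =
    {((k, c), (l, d)). k \<in> carrier K \<and> l \<in> carrier K \<and> c \<in> C \<and> d \<in> C \<and>
       (\<exists>u\<in>C. u \<odot>\<^bsub>K\<^esub> (d \<odot>\<^bsub>K\<^esub> k) = u \<odot>\<^bsub>K\<^esub> (c \<odot>\<^bsub>K\<^esub> l))}"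

definition fraction :: "'s set \<Rightarrow> ('s, 'k, 'y) module_scheme \<Rightarrow> 'k \<Rightarrow> 's \<Rightarrow> ('k \<times> 's) set"
  where "fraction C K k c = fraction_rel C K `` {(k, c)}"

text \<open>The operations below are unions of equal classes, one for each choice of representatives.\<close>

definition loc_module ::
    "('s, 'x) ring_scheme \<Rightarrow> 's set \<Rightarrow> ('s, 'k, 'y) module_scheme \<Rightarrow> (('s \<times> 's) set, ('k \<times> 's) set) module"
  where "loc_module S C K =
    \<lparr>carrier = (carrier K \<times> C) // fraction_rel C K,
     monoid.mult = undefined, one = undefined,
     ring.zero = fraction C K \<zero>\<^bsub>K\<^esub> \<one>\<^bsub>S\<^esub>,
     add = (\<lambda>U V. \<Union>(k, c)\<in>U. \<Union>(l, d)\<in>V.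
              fraction C K ((d \<odot>\<^bsub>K\<^esub> k) \<oplus>\<^bsub>K\<^esub> (c \<odot>\<^bsub>K\<^esub> l)) (c \<otimes>\<^bsub>S\<^esub> d)),
     smult = (\<lambda>A U. \<Union>(a, c)\<in>A. \<Union>(k, d)\<in>U. fraction C K (a \<odot>\<^bsub>K\<^esub> k) (c \<otimes>\<^bsub>S\<^esub> d))\<rparr>"

definition loc_ring :: "('s, 'x) ring_scheme \<Rightarrow> 's set \<Rightarrow> ('s \<times> 's) set ring"
  where "loc_ring S C = (let L = loc_module S C (restrict_scalars id S) in
    \<lparr>carrier = carrier L, monoid.mult = smult L,
     one = fraction C (restrict_scalars id S) \<one>\<^bsub>S\<^esub> \<one>\<^bsub>S\<^esub>,
     ring.zero = ring.zero L, add = ring.add L\<rparr>)"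

definition loc_ring_map :: "('s, 'x) ring_scheme \<Rightarrow> 's set \<Rightarrow> 's \<Rightarrow> ('s \<times> 's) set"
  where "loc_ring_map S C s = fraction C (restrict_scalars id S) s \<one>\<^bsub>S\<^esub>"

definition loc_module_map ::
    "('s, 'x) ring_scheme \<Rightarrow> 's set \<Rightarrow> ('s, 'k, 'y) module_scheme \<Rightarrow> 'k \<Rightarrow> ('k \<times> 's) set"
  where "loc_module_map S C K k = fraction C K k \<one>\<^bsub>S\<^esub>"

definition quotient_field :: "('s, 'x) ring_scheme \<Rightarrow> ('s \<times> 's) set ring"
  where "quotient_field S = loc_ring S (carrier S - {\<zero>\<^bsub>S\<^esub>})"

definition quotient_field_map :: "('s, 'x) ring_scheme \<Rightarrow> 's \<Rightarrow> ('s \<times> 's) set"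
  where "quotient_field_map S = loc_ring_map S (carrier S - {\<zero>\<^bsub>S\<^esub>})"


section \<open>Tensor products\<close>

definition tensor_relations ::
    "('r, 'x) ring_scheme \<Rightarrow> ('r, 'm, 'y) module_scheme \<Rightarrow> ('r, 'n, 'z) module_scheme \<Rightarrow>
     ('m \<times> 'n \<Rightarrow>\<^sub>0 int) set"
  where "tensor_relations R M N =
    {frag_of (x \<oplus>\<^bsub>M\<^esub> x', y) - frag_of (x, y) - frag_of (x', y) | x x' y.
        x \<in> carrier M \<and> x' \<in> carrier M \<and> y \<in> carrier N} \<union>
    {frag_of (x, y \<oplus>\<^bsub>N\<^esub> y') - frag_of (x, y) - frag_of (x, y') | x y y'.
        x \<in> carrier M \<and> y \<in> carrier N \<and> y' \<in> carrier N} \<union>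
    {frag_of (r \<odot>\<^bsub>M\<^esub> x, y) - frag_of (x, r \<odot>\<^bsub>N\<^esub> y) | r x y.
        r \<in> carrier R \<and> x \<in> carrier M \<and> y \<in> carrier N}"

definition tensor_coset ::
    "('r, 'x) ring_scheme \<Rightarrow> ('r, 'm, 'y) module_scheme \<Rightarrow> ('r, 'n, 'z) module_scheme \<Rightarrow>
     ('m \<times> 'n \<Rightarrow>\<^sub>0 int) \<Rightarrow> ('m \<times> 'n \<Rightarrow>\<^sub>0 int) set"
  where "tensor_coset R M N p =
    (let G = free_Abelian_group (carrier M \<times> carrier N)
     in generate G (tensor_relations R M N) #>\<^bsub>G\<^esub> p)"

text \<open>
  \<open>tensor_map R M' N' g h\<close> is \<open>g \<otimes> h\<close> with values in \<open>M' \<otimes> N'\<close>, again as a union of equal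
  cosets.
\<close>

definition tensor_map ::
    "('r, 'x) ring_scheme \<Rightarrow> ('r, 'm2, 'y) module_scheme \<Rightarrow> ('r, 'n2, 'z) module_scheme \<Rightarrow>
     ('m \<Rightarrow> 'm2) \<Rightarrow> ('n \<Rightarrow> 'n2) \<Rightarrow> ('m \<times> 'n \<Rightarrow>\<^sub>0 int) set \<Rightarrow> ('m2 \<times> 'n2 \<Rightarrow>\<^sub>0 int) set"
  where "tensor_map R M' N' g h U =
    (\<Union>p\<in>U. tensor_coset R M' N' (frag_extend (\<lambda>(x, y). frag_of (g x, h y)) p))"

definition tensor_product ::
    "('r, 'x) ring_scheme \<Rightarrow> ('r, 'm, 'y) module_scheme \<Rightarrow> ('r, 'n, 'z) module_scheme \<Rightarrow>
     ('r, ('m \<times> 'n \<Rightarrow>\<^sub>0 int) set) module"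
  where "tensor_product R M N =
    (let G = free_Abelian_group (carrier M \<times> carrier N);
         Q = G Mod generate G (tensor_relations R M N)
     in \<lparr>carrier = carrier Q, monoid.mult = undefined, one = undefined,
         ring.zero = \<one>\<^bsub>Q\<^esub>, add = monoid.mult Q,
         smult = (\<lambda>r. tensor_map R M N (\<lambda>x. r \<odot>\<^bsub>M\<^esub> x) id)\<rparr>)"

text \<open>For \<open>f : A \<rightarrow> B\<close> and an \<open>A\<close>-module \<open>N\<close>, the \<open>B\<close>-module \<open>B \<otimes>\<^sub>A N\<close>.\<close>

definition extend_scalars ::
    "('a, 'x) ring_scheme \<Rightarrow> ('b, 'y) ring_scheme \<Rightarrow> ('a \<Rightarrow> 'b) \<Rightarrow> ('a, 'n, 'z) module_scheme \<Rightarrow>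
     ('b, ('b \<times> 'n \<Rightarrow>\<^sub>0 int) set) module"
  where "extend_scalars A B f N =
    (let M = restrict_scalars f B; T = tensor_product A M N
     in \<lparr>carrier = carrier T, monoid.mult = undefined, one = undefined, ring.zero = ring.zero T, add = ring.add T,
         smult = (\<lambda>b. tensor_map A M N (\<lambda>x. b \<otimes>\<^bsub>B\<^esub> x) id)\<rparr>)"

definition extend_scalars_map ::
    "('a, 'x) ring_scheme \<Rightarrow> ('b, 'y) ring_scheme \<Rightarrow> ('a \<Rightarrow> 'b) \<Rightarrow> ('a, 'n, 'z) module_scheme \<Rightarrow>
     'n \<Rightarrow> ('b \<times> 'n \<Rightarrow>\<^sub>0 int) set"
  where "extend_scalars_map A B f N n = tensor_coset A (restrict_scalars f B) N (frag_of (\<one>\<^bsub>B\<^esub>, n))"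


section \<open>Faithful flatness\<close>

definition exact_at ::
    "('r, 'n1, 'x) module_scheme \<Rightarrow> ('n1 \<Rightarrow> 'n2) \<Rightarrow> ('r, 'n2, 'y) module_scheme \<Rightarrow> ('n2 \<Rightarrow> 'n3) \<Rightarrow>
     ('r, 'n3, 'z) module_scheme \<Rightarrow> bool"
  where "exact_at N1 g N2 h N3 \<longleftrightarrow> g ` carrier N1 = a_kernel N2 N3 h"

text \<open>
  A definition cannot quantify over types, so the element types of the three modules of the test
  sequence are parameters.  In a theorem whose conclusion is faithful flatness at type variables
  that occur nowhere else, these are universally quantified, and the conclusion covers all modules.
\<close>

definition faithfully_flat ::
    "'n1 itself \<Rightarrow> 'n2 itself \<Rightarrow> 'n3 itself \<Rightarrow>
     ('r, 'x) ring_scheme \<Rightarrow> ('r, 'm, 'y) module_scheme \<Rightarrow> bool"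
  where "faithfully_flat _ _ _ R M \<longleftrightarrow> module R M \<and>
    (\<forall>(N1 :: ('r, 'n1) module) (N2 :: ('r, 'n2) module) (N3 :: ('r, 'n3) module).
     \<forall>g\<in>module_hom R N1 N2. \<forall>h\<in>module_hom R N2 N3.
       module R N1 \<longrightarrow> module R N2 \<longrightarrow> module R N3 \<longrightarrow>
       (exact_at N1 g N2 h N3 \<longleftrightarrow>
        exact_at (tensor_product R M N1) (tensor_map R M N2 id g)
                 (tensor_product R M N2) (tensor_map R M N3 id h)
                 (tensor_product R M N3)))"

definition faithfully_flat_hom ::
    "'n1 itself \<Rightarrow> 'n2 itself \<Rightarrow> 'n3 itself \<Rightarrow>
     ('a, 'x) ring_scheme \<Rightarrow> ('b, 'y) ring_scheme \<Rightarrow> ('a \<Rightarrow> 'b) \<Rightarrow> bool"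
  where "faithfully_flat_hom t1 t2 t3 A B f \<longleftrightarrow>
    ring_hom_cring A B f \<and> faithfully_flat t1 t2 t3 A (restrict_scalars f B)"


section \<open>Analytic isomorphisms\<close>

definition induced_quotient_map ::
    "('b, 'y) ring_scheme \<Rightarrow> 'b set \<Rightarrow> ('a \<Rightarrow> 'b) \<Rightarrow> 'a set \<Rightarrow> 'b set"
  where "induced_quotient_map B J f U = (\<Union>a\<in>U. J +>\<^bsub>B\<^esub> f a)"

definition analytic_iso_along ::
    "('a, 'x) ring_scheme \<Rightarrow> ('b, 'y) ring_scheme \<Rightarrow> 'a set \<Rightarrow> ('a \<Rightarrow> 'b) \<Rightarrow> bool"
  where "analytic_iso_along A B C f \<longleftrightarrow>
    ring_hom_cring A B f \<and> submonoid C A \<and> f ` C \<subseteq> nonzerodivisors B \<and>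
    (\<forall>c\<in>C. induced_quotient_map B (PIdl\<^bsub>B\<^esub> (f c)) f
             \<in> ring_iso (A Quot (PIdl\<^bsub>A\<^esub> c)) (B Quot (PIdl\<^bsub>B\<^esub> (f c))))"


section \<open>Idealization and twisted subrings\<close>

definition idealization ::
    "('s, 'x) ring_scheme \<Rightarrow> ('s, 'k, 'y) module_scheme \<Rightarrow> ('s \<times> 'k) ring"
  where "idealization S K =
    \<lparr>carrier = carrier S \<times> carrier K,
     monoid.mult = (\<lambda>(s1, k1) (s2, k2). (s1 \<otimes>\<^bsub>S\<^esub> s2, (s1 \<odot>\<^bsub>K\<^esub> k2) \<oplus>\<^bsub>K\<^esub> (s2 \<odot>\<^bsub>K\<^esub> k1))),
     one = (\<one>\<^bsub>S\<^esub>, \<zero>\<^bsub>K\<^esub>), ring.zero = (\<zero>\<^bsub>S\<^esub>, \<zero>\<^bsub>K\<^esub>),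
     add = (\<lambda>(s1, k1) (s2, k2). (s1 \<oplus>\<^bsub>S\<^esub> s2, k1 \<oplus>\<^bsub>K\<^esub> k2))\<rparr>"

definition derivation ::
    "('b, 'x) ring_scheme \<Rightarrow> ('b, 'l, 'y) module_scheme \<Rightarrow> ('b \<Rightarrow> 'l) \<Rightarrow> bool"
  where "derivation B L D \<longleftrightarrow> D \<in> carrier B \<rightarrow> carrier L \<and>
    (\<forall>s\<in>carrier B. \<forall>t\<in>carrier B. D (s \<oplus>\<^bsub>B\<^esub> t) = D s \<oplus>\<^bsub>L\<^esub> D t) \<and>
    (\<forall>s\<in>carrier B. \<forall>t\<in>carrier B. D (s \<otimes>\<^bsub>B\<^esub> t) = (s \<odot>\<^bsub>L\<^esub> D t) \<oplus>\<^bsub>L\<^esub> (t \<odot>\<^bsub>L\<^esub> D s))"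

definition module_span :: "('b, 'x) ring_scheme \<Rightarrow> ('b, 'l, 'y) module_scheme \<Rightarrow> 'l set \<Rightarrow> 'l set"
  where "module_span B L U = (\<lambda>N. submodule N B L) hull U"

text \<open>
  \<open>S\<close> and \<open>K\<close> are not literally contained in \<open>S\<^sub>C\<close> and \<open>K\<^sub>C\<close> (or in \<open>F\<close> and \<open>FK\<close>), hence the
  canonical maps \<open>i\<close> and \<open>j\<close>; they are injective in the situations considered.
\<close>

definition twists_along ::
    "('s, 'x) ring_scheme \<Rightarrow> 's set \<Rightarrow> ('s, 'k, 'y) module_scheme \<Rightarrow> 's set \<Rightarrow>
     (('s \<times> 's) set \<Rightarrow> ('k \<times> 's) set) \<Rightarrow> bool"
  where "twists_along S C K R D \<longleftrightarrow>
    (let B = loc_ring S C; L = loc_module S C K;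
         i = loc_ring_map S C; j = loc_module_map S C K in
      derivation B L D \<and> (\<forall>c\<in>C. D (i c) = \<zero>\<^bsub>L\<^esub>) \<and>
      R = {s \<in> carrier S. D (i s) \<in> j ` carrier K} \<and>
      module_span B L (D ` carrier B) = carrier L \<and>
      (\<forall>c\<in>C. i ` carrier S \<subseteq> a_kernel B L D <+>\<^bsub>B\<^esub> i ` (PIdl\<^bsub>S\<^esub> c)))"

definition strongly_twists ::
    "('s, 'x) ring_scheme \<Rightarrow> ('s, 'k, 'y) module_scheme \<Rightarrow> 's set \<Rightarrow>
     (('s \<times> 's) set \<Rightarrow> (('s \<times> 's) set \<times> 'k \<Rightarrow>\<^sub>0 int) set) \<Rightarrow> bool"
  where "strongly_twists S K R D \<longleftrightarrow>
    (let F = quotient_field S; i = quotient_field_map S;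
         FK = extend_scalars S F i K; j = extend_scalars_map S F i K in
      derivation F FK D \<and>
      R = {s \<in> carrier S. D (i s) \<in> j ` carrier K} \<and>
      module_span F FK (D ` carrier F) = carrier FK \<and>
      (\<forall>s\<in>carrier S - {\<zero>\<^bsub>S\<^esub>}. i ` carrier S \<subseteq> a_kernel F FK D <+>\<^bsub>F\<^esub> i ` (PIdl\<^bsub>S\<^esub> s)))"

text \<open>The map \<open>r \<mapsto> (r, D r)\<close>, where the second component is taken back to \<open>K\<close> along \<open>j\<close>.\<close>

definition graph_map ::
    "('s, 'k, 'y) module_scheme \<Rightarrow> ('s \<Rightarrow> 'b) \<Rightarrow> ('k \<Rightarrow> 'l) \<Rightarrow> ('b \<Rightarrow> 'l) \<Rightarrow> 's \<Rightarrow> 's \<times> 'k"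
  where "graph_map K i j D r = (r, THE k. k \<in> carrier K \<and> j k = D (i r))"

definition twist_map ::
    "('s, 'x) ring_scheme \<Rightarrow> 's set \<Rightarrow> ('s, 'k, 'y) module_scheme \<Rightarrow>
     (('s \<times> 's) set \<Rightarrow> ('k \<times> 's) set) \<Rightarrow> 's \<Rightarrow> 's \<times> 'k"
  where "twist_map S C K D = graph_map K (loc_ring_map S C) (loc_module_map S C K) D"

definition strong_twist_map ::
    "('s, 'x) ring_scheme \<Rightarrow> ('s, 'k, 'y) module_scheme \<Rightarrow>
     (('s \<times> 's) set \<Rightarrow> (('s \<times> 's) set \<times> 'k \<Rightarrow>\<^sub>0 int) set) \<Rightarrow> 's \<Rightarrow> 's \<times> 'k"
  where "strong_twist_map S K D =
    (let F = quotient_field S; i = quotient_field_map S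
     in graph_map K i (extend_scalars_map S F i K) D)"

end

theory Submission
  imports Defs
begin

text \<open>
  Approximating the coefficients of an element of \<open>K\<^sub>C\<close> by constants of \<open>D\<close> shows that
  \<open>K\<close> is \<open>D(R) + cK\<close> for every \<open>c \<in> C\<close>.  Hence the cokernel of \<open>R \<rightarrow> S \<star> K\<close> is divisible by
  the elements of \<open>C\<close>, and it is \<open>C\<close>-torsion-free because \<open>D(cs) = c D(s)\<close>; this is the analytic
  isomorphism.  In the strongly twisted case every nonzero element of \<open>S\<close> has a nonzero constant
  multiple, so the cokernel is a torsion-free divisible module over the domain \<open>R\<close>, that is, a vector
  space over its quotient field.  Therefore \<open>S \<star> K\<close> is a directed union of free \<open>R\<close>-modules
  having \<open>1\<close> as a basis element, and such a module is faithfully flat.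
\<close>

section \<open>Tensor products\<close>

text \<open>\<open>faithfully_flat\<close> speaks about three-term sequences and concrete cosets of
  formal sums, so the passage to a directed union has to be made by hand. A relation in M \<otimes>
  N involves only finitely many elements of M and can be checked over a submodule F with finitely
  many coordinate forms. Tensoring these forms with N turns an element of F \<otimes> N into a
  finite family in N, where exactness of the given sequence applies. The basis element 1 supplies a
  form with value 1 at 1; exactness is read back through it from the tensors 1 \<otimes> y.

  The approximation has to cope with two kinds of denominators: those of the coefficients, and those
  of the values of D, which lie in the localized module and not in K. Each is paid for by raising
  the precision beforehand, which is possible because approximations are available modulo every
  element of C.

  The two notions of twist use different modules, the localization of K and F \<otimes> K. The
  argument is therefore carried out for abstract \<open>B\<close>, \<open>L\<close> with maps
  \<open>i\<close>, \<open>j\<close>, and a strong twist is treated as a twist along the nonzero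
  constants of its derivation.\<close>

lemma (in abelian_group) minus_eq_zero_iff:
  assumes "x \<in> carrier G" "y \<in> carrier G"
  shows "x \<ominus> y = \<zero> \<longleftrightarrow> x = y"
  using assms by (metis a_minus_def minus_closed minus_equality minus_minus r_neg a_inv_closed)

lemma abelian_group_homI':
  assumes "abelian_group G" "abelian_group H" "\<And>x. x \<in> carrier G \<Longrightarrow> h x \<in> carrier H"
    and "\<And>x y. \<lbrakk>x \<in> carrier G; y \<in> carrier G\<rbrakk> \<Longrightarrow> h (x \<oplus>\<^bsub>G\<^esub> y) = h x \<oplus>\<^bsub>H\<^esub> h y"
  shows "abelian_group_hom G H h"
  using assms
  by (intro abelian_group_homI) (auto simp: group_hom_def group_hom_axioms_def hom_def abelian_group.a_group)

lemma keys_diff_subset: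
  assumes "Poly_Mapping.keys p \<subseteq> A" "Poly_Mapping.keys q \<subseteq> A"
  shows "Poly_Mapping.keys (p - q :: 'c \<Rightarrow>\<^sub>0 int) \<subseteq> A"
  using keys_diff[of p q] assms by blast

section \<open>Tensor products as quotients of free abelian groups, and their universal
  property\<close>

locale module_pair = M: module R M + N: module R N
  for R (structure) and M :: "('r, 'm, 'y) module_scheme" and N :: "('r, 'n, 'z) module_scheme"
begin

abbreviation frags :: "('m \<times> 'n \<Rightarrow>\<^sub>0 int) monoid"
  where "frags \<equiv> free_Abelian_group (carrier M \<times> carrier N)"

abbreviation relators :: "('m \<times> 'n \<Rightarrow>\<^sub>0 int) set"
  where "relators \<equiv> generate frags (tensor_relations R M N)"

abbreviation T :: "('r, ('m \<times> 'n \<Rightarrow>\<^sub>0 int) set) module"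
  where "T \<equiv> tensor_product R M N"

abbreviation coset :: "('m \<times> 'n \<Rightarrow>\<^sub>0 int) \<Rightarrow> ('m \<times> 'n \<Rightarrow>\<^sub>0 int) set"
  where "coset \<equiv> tensor_coset R M N"

abbreviation pure_tensor :: "'m \<Rightarrow> 'n \<Rightarrow> ('m \<times> 'n \<Rightarrow>\<^sub>0 int) set"
  where "pure_tensor x y \<equiv> tensor_coset R M N (frag_of (x, y))"

sublocale frags: comm_group frags
  by (rule abelian_free_Abelian_group)

lemma tensor_relations_closed: "tensor_relations R M N \<subseteq> carrier frags"
proof
  fix p assume "p \<in> tensor_relations R M N"
  then show "p \<in> carrier frags"
    unfolding tensor_relations_def
    by (elim UnE CollectE exE conjE; hypsubst)
      (simp_all add: keys_diff_subset)
qed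

lemma subgroup_relators: "subgroup relators frags"
  by (rule frags.generate_is_subgroup[OF tensor_relations_closed])

sublocale relators: normal relators frags
  by (rule frags.subgroup_imp_normal[OF subgroup_relators])

lemma coset_def': "coset p = relators #>\<^bsub>frags\<^esub> p"
  by (simp add: tensor_coset_def Let_def)

lemma tensor_product_simps:
  "carrier T = carrier (frags Mod relators)" "add T = monoid.mult (frags Mod relators)"
  "\<zero>\<^bsub>T\<^esub> = \<one>\<^bsub>frags Mod relators\<^esub>"
  by (simp_all add: tensor_product_def Let_def)

sublocale T: abelian_group T
proof -
  interpret Q: comm_group "frags Mod relators"
    by (rule frags.abelian_FactGroup[OF subgroup_relators])
  show "abelian_group T"
    by (rule abelian_groupI; simp only: tensor_product_simps)
      (auto simp del: one_FactGroup mult_FactGroup simp: Q.m_ac intro: Q.l_inv_ex)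
qed

lemma coset_hom: "coset \<in> hom frags (add_monoid T)"
proof -
  have "coset = (#>\<^bsub>frags\<^esub>) relators"
    by (simp add: fun_eq_iff coset_def')
  then show ?thesis
    using relators.r_coset_hom_Mod by (simp add: hom_def tensor_product_simps)
qed

lemma carrier_tensor_product: "carrier T = coset ` carrier frags"
  by (auto simp: tensor_product_def Let_def carrier_FactGroup coset_def')

lemma zero_tensor_product: "\<zero>\<^bsub>T\<^esub> = relators"
  by (simp add: tensor_product_def Let_def)

lemma coset_closed [simp]: "Poly_Mapping.keys p \<subseteq> carrier M \<times> carrier N \<Longrightarrow> coset p \<in> carrier T"
  by (auto simp: carrier_tensor_product)

lemma coset_eq_zero_iff:
  assumes "Poly_Mapping.keys p \<subseteq> carrier M \<times> carrier N"
  shows "coset p = \<zero>\<^bsub>T\<^esub> \<longleftrightarrow> p \<in> relators"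
  unfolding zero_tensor_product coset_def'
  using assms frags.coset_join1[OF _ _ subgroup_relators, of p]
    frags.coset_join2[OF _ subgroup_relators, of p] by auto

lemma coset_diff:
  assumes "Poly_Mapping.keys p \<subseteq> carrier M \<times> carrier N" "Poly_Mapping.keys q \<subseteq> carrier M \<times> carrier N"
  shows "coset (p - q) = coset p \<ominus>\<^bsub>T\<^esub> coset q"
proof -
  have "coset ((p - q) + q) = coset (p - q) \<oplus>\<^bsub>T\<^esub> coset q"
    using hom_mult[OF coset_hom, of "p - q" q] assms by (simp add: keys_diff_subset)
  then have "coset p = coset (p - q) \<oplus>\<^bsub>T\<^esub> coset q"
    by simp
  then show ?thesis
    using assms by (simp add: T.minus_eq T.add.m_assoc T.r_neg keys_diff_subset)
qed

lemma coset_add: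
  assumes "Poly_Mapping.keys p \<subseteq> carrier M \<times> carrier N" "Poly_Mapping.keys q \<subseteq> carrier M \<times> carrier N"
  shows "coset (p + q) = coset p \<oplus>\<^bsub>T\<^esub> coset q"
  using hom_mult[OF coset_hom, of p q] assms by simp

lemma coset_zero: "coset 0 = \<zero>\<^bsub>T\<^esub>"
  by (subst coset_eq_zero_iff) (auto intro: generate.one[of frags, simplified])

lemma coset_eqI:
  assumes "p - q \<in> relators"
    "Poly_Mapping.keys p \<subseteq> carrier M \<times> carrier N" "Poly_Mapping.keys q \<subseteq> carrier M \<times> carrier N"
  shows "coset p = coset q"
  using assms coset_eq_zero_iff[of "p - q"] coset_diff[of p q]
  by (metis T.minus_eq_zero_iff coset_closed keys_diff_subset)

lemma pure_tensor_closed [simp, intro]: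
  "x \<in> carrier M \<Longrightarrow> y \<in> carrier N \<Longrightarrow> pure_tensor x y \<in> carrier T"
  by simp

lemma pure_tensor_add_left:
  assumes "x \<in> carrier M" "x' \<in> carrier M" "y \<in> carrier N"
  shows "pure_tensor (x \<oplus>\<^bsub>M\<^esub> x') y = pure_tensor x y \<oplus>\<^bsub>T\<^esub> pure_tensor x' y"
proof -
  have "frag_of (x \<oplus>\<^bsub>M\<^esub> x', y) - frag_of (x, y) - frag_of (x', y) \<in> relators"
    using assms by (intro generate.incl) (auto simp: tensor_relations_def)
  then have "coset (frag_of (x \<oplus>\<^bsub>M\<^esub> x', y)) = coset (frag_of (x, y) + frag_of (x', y))"
    using assms by (intro coset_eqI) (auto simp: diff_diff_eq dest: subsetD[OF keys_add])
  then show ?thesis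
    using assms by (simp add: coset_add)
qed

lemma pure_tensor_add_right:
  assumes "x \<in> carrier M" "y \<in> carrier N" "y' \<in> carrier N"
  shows "pure_tensor x (y \<oplus>\<^bsub>N\<^esub> y') = pure_tensor x y \<oplus>\<^bsub>T\<^esub> pure_tensor x y'"
proof -
  have "frag_of (x, y \<oplus>\<^bsub>N\<^esub> y') - frag_of (x, y) - frag_of (x, y') \<in> relators"
    using assms by (intro generate.incl) (auto simp: tensor_relations_def)
  then have "coset (frag_of (x, y \<oplus>\<^bsub>N\<^esub> y')) = coset (frag_of (x, y) + frag_of (x, y'))"
    using assms by (intro coset_eqI) (auto simp: diff_diff_eq dest: subsetD[OF keys_add])
  then show ?thesis
    using assms by (simp add: coset_add)
qed

lemma pure_tensor_smult:
  assumes "r \<in> carrier R" "x \<in> carrier M" "y \<in> carrier N"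
  shows "pure_tensor (r \<odot>\<^bsub>M\<^esub> x) y = pure_tensor x (r \<odot>\<^bsub>N\<^esub> y)"
proof -
  have "frag_of (r \<odot>\<^bsub>M\<^esub> x, y) - frag_of (x, r \<odot>\<^bsub>N\<^esub> y) \<in> relators"
    using assms by (intro generate.incl) (auto simp: tensor_relations_def)
  then show ?thesis
    using assms by (intro coset_eqI) auto
qed

lemma pure_tensor_zero_right:
  assumes "x \<in> carrier M"
  shows "pure_tensor x \<zero>\<^bsub>N\<^esub> = \<zero>\<^bsub>T\<^esub>"
  using pure_tensor_add_right[OF assms, of "\<zero>\<^bsub>N\<^esub>" "\<zero>\<^bsub>N\<^esub>"] assms
  by (metis N.zero_closed N.l_zero T.add.l_cancel_one' pure_tensor_closed)

text \<open>Closure under differences, as in \<open>free_Abelian_group_induct\<close>, covers sums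
  and additive inverses in a single case.\<close>

lemma tensor_induct [consumes 1, case_names zero diff pure]:
  assumes "\<xi> \<in> carrier T"
    and "P \<zero>\<^bsub>T\<^esub>"
    and "\<And>\<xi> \<eta>. \<lbrakk>\<xi> \<in> carrier T; \<eta> \<in> carrier T; P \<xi>; P \<eta>\<rbrakk> \<Longrightarrow> P (\<xi> \<ominus>\<^bsub>T\<^esub> \<eta>)"
    and "\<And>x y. \<lbrakk>x \<in> carrier M; y \<in> carrier N\<rbrakk> \<Longrightarrow> P (pure_tensor x y)"
  shows "P \<xi>"
proof -
  obtain p where p: "\<xi> = coset p" "Poly_Mapping.keys p \<subseteq> carrier M \<times> carrier N"
    using assms(1) by (auto simp: carrier_tensor_product)
  have "P (coset p)"
  proof (rule free_Abelian_group_induct[where P = "\<lambda>p. P (coset p)", OF p(2)])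
    show "P (coset 0)" by (simp add: coset_zero assms(2))
    show "P (coset (x - y))" if "Poly_Mapping.keys x \<subseteq> carrier M \<times> carrier N"
      "Poly_Mapping.keys y \<subseteq> carrier M \<times> carrier N" "P (coset x)" "P (coset y)" for x y
      using that by (simp add: coset_diff assms(3))
    show "P (coset (frag_of a))" if "a \<in> carrier M \<times> carrier N" for a
      using that assms(4) by (cases a) auto
  qed
  then show ?thesis using p by simp
qed

lemma tensor_hom_eqI:
  assumes "abelian_group_hom T P h" "abelian_group_hom T P h'" "\<xi> \<in> carrier T"
    and eq: "\<And>x y. \<lbrakk>x \<in> carrier M; y \<in> carrier N\<rbrakk> \<Longrightarrow> h (pure_tensor x y) = h' (pure_tensor x y)"
  shows "h \<xi> = h' \<xi>"
proof -
  interpret h: abelian_group_hom T P h by fact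
  interpret h': abelian_group_hom T P h' by fact
  show ?thesis
    using assms(3)
    by (induction rule: tensor_induct) (simp_all add: eq T.minus_eq)
qed

text \<open>The extension of \<open>\<beta>\<close> to formal sums kills the three families of
  relations and so descends to the quotient. The target is a mere abelian group, so that other
  tensor products, \<open>N\<close> itself and localized modules can all serve as
  \<open>P\<close>.\<close>

lemma tensor_universal:
  assumes "abelian_group P"
    and "\<And>x y. \<lbrakk>x \<in> carrier M; y \<in> carrier N\<rbrakk> \<Longrightarrow> \<beta> x y \<in> carrier P"
    and "\<And>x x' y. \<lbrakk>x \<in> carrier M; x' \<in> carrier M; y \<in> carrier N\<rbrakk> \<Longrightarrow>
      \<beta> (x \<oplus>\<^bsub>M\<^esub> x') y = \<beta> x y \<oplus>\<^bsub>P\<^esub> \<beta> x' y"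
    and "\<And>x y y'. \<lbrakk>x \<in> carrier M; y \<in> carrier N; y' \<in> carrier N\<rbrakk> \<Longrightarrow>
      \<beta> x (y \<oplus>\<^bsub>N\<^esub> y') = \<beta> x y \<oplus>\<^bsub>P\<^esub> \<beta> x y'"
    and "\<And>r x y. \<lbrakk>r \<in> carrier R; x \<in> carrier M; y \<in> carrier N\<rbrakk> \<Longrightarrow>
      \<beta> (r \<odot>\<^bsub>M\<^esub> x) y = \<beta> x (r \<odot>\<^bsub>N\<^esub> y)"
  obtains h where "abelian_group_hom T P h"
    "\<And>x y. \<lbrakk>x \<in> carrier M; y \<in> carrier N\<rbrakk> \<Longrightarrow> h (pure_tensor x y) = \<beta> x y"
proof -
  interpret P: abelian_group P by fact
  obtain g where g: "g \<in> hom frags (add_monoid P)"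
    and g_of: "\<And>z. z \<in> carrier M \<times> carrier N \<Longrightarrow> g (frag_of z) = (\<lambda>(x, y). \<beta> x y) z"
    by (rule comm_group.free_Abelian_group_universal[OF P.a_comm_group,
          of "\<lambda>(x, y). \<beta> x y" "carrier M \<times> carrier N"]) (use assms(2) in auto)
  interpret g: group_hom frags "add_monoid P" g
    by (simp add: group_hom_def group_hom_axioms_def g P.a_group)
  have g_diff: "g (p - q) = g p \<ominus>\<^bsub>P\<^esub> g q"
    if "Poly_Mapping.keys p \<subseteq> carrier M \<times> carrier N" "Poly_Mapping.keys q \<subseteq> carrier M \<times> carrier N" for p q
    using that g.hom_mult[of p "- q"] g.hom_inv[of q]
    by (simp add: a_inv_def[symmetric] P.minus_eq)
  have "tensor_relations R M N \<subseteq> kernel frags (add_monoid P) g"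
  proof
    fix p assume p: "p \<in> tensor_relations R M N"
    \<comment> \<open>Both additivity relations, in the left and in the right argument, take this
      shape under \<open>g\<close>.\<close>
    have cancel: "(a \<oplus>\<^bsub>P\<^esub> b) \<ominus>\<^bsub>P\<^esub> a \<ominus>\<^bsub>P\<^esub> b = \<zero>\<^bsub>P\<^esub>" if "a \<in> carrier P" "b \<in> carrier P" for a b
      using that by (simp add: P.minus_eq P.a_comm[of a b] P.a_assoc P.r_neg P.r_neg2)
    from p have "g p = \<zero>\<^bsub>P\<^esub>"
      unfolding tensor_relations_def
      using assms(2-5)
      by (elim UnE) (auto simp: g_diff keys_diff_subset g_of cancel P.minus_eq_zero_iff)
    then show "p \<in> kernel frags (add_monoid P) g"
      using subsetD[OF tensor_relations_closed p] by (simp add: kernel_def)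
  qed
  then have ker: "relators \<subseteq> kernel frags (add_monoid P) g"
    by (rule frags.generate_subgroup_incl[OF _ g.subgroup_kernel])
  obtain h where h: "h \<in> hom (frags Mod relators) (add_monoid P)"
    "\<And>p. p \<in> carrier frags \<Longrightarrow> h (relators #>\<^bsub>frags\<^esub> p) = g p"
    using g.FactGroup_universal_kernel[OF relators.normal_axioms ker] by metis
  show ?thesis
  proof (rule that)
    show "abelian_group_hom T P h"
      using h(1) by (intro abelian_group_homI' T.abelian_group_axioms P.abelian_group_axioms)
        (auto simp: hom_def tensor_product_simps)
    fix x y assume "x \<in> carrier M" "y \<in> carrier N"
    then show "h (pure_tensor x y) = \<beta> x y"
      using h(2)[of "frag_of (x, y)"] g_of[of "(x, y)"] by (simp add: coset_def')
  qed
qed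

end

section \<open>Functoriality of the tensor product\<close>

lemma module_homD:
  assumes "h \<in> module_hom R M N"
  shows "x \<in> carrier M \<Longrightarrow> h x \<in> carrier N"
    and "\<lbrakk>x \<in> carrier M; y \<in> carrier M\<rbrakk> \<Longrightarrow> h (x \<oplus>\<^bsub>M\<^esub> y) = h x \<oplus>\<^bsub>N\<^esub> h y"
    and "\<lbrakk>r \<in> carrier R; x \<in> carrier M\<rbrakk> \<Longrightarrow> h (r \<odot>\<^bsub>M\<^esub> x) = r \<odot>\<^bsub>N\<^esub> h x"
  using assms by (auto simp: module_hom_def)

lemma module_hom_abelian_group_hom:
  assumes "module R M" "module R N" "h \<in> module_hom R M N"
  shows "abelian_group_hom M N h"
proof -
  interpret M: module R M by fact
  interpret N: module R N by fact
  show ?thesis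
    using assms(3)
    by (intro abelian_group_homI' M.abelian_group_axioms N.abelian_group_axioms)
      (auto simp: module_hom_def)
qed

locale tensor_hom = D: module_pair R M N + E: module_pair R M' N'
  for R (structure) and M :: "('r, 'm, 'y) module_scheme" and N :: "('r, 'n, 'z) module_scheme"
    and M' :: "('r, 'm2, 'y2) module_scheme" and N' :: "('r, 'n2, 'z2) module_scheme" +
  fixes g h
  assumes g: "g \<in> module_hom R M M'" and h: "h \<in> module_hom R N N'"
begin

abbreviation gh :: "('m \<times> 'n \<Rightarrow>\<^sub>0 int) set \<Rightarrow> ('m2 \<times> 'n2 \<Rightarrow>\<^sub>0 int) set"
  where "gh \<equiv> tensor_map R M' N' g h"

lemma frag_map_closed:
  assumes "Poly_Mapping.keys p \<subseteq> carrier M \<times> carrier N"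
  shows "Poly_Mapping.keys (frag_extend (\<lambda>(x, y). frag_of (g x, h y)) p) \<subseteq> carrier M' \<times> carrier N'"
  using assms g h
  by (intro order.trans[OF keys_frag_extend]) (auto dest!: subsetD split: prod.splits simp: module_homD)

text \<open>\<open>tensor_map\<close> is a union over all representatives of a coset. The map
  \<open>H\<close> from the universal property depends on the coset only, so all representatives
  contribute the same coset, and the union is nonempty because \<open>p\<close> represents its own
  coset. Additivity is then inherited from \<open>H\<close>.\<close>

lemma gh_facts:
  shows "abelian_group_hom D.T E.T gh"
    and gh_coset: "Poly_Mapping.keys p \<subseteq> carrier M \<times> carrier N \<Longrightarrow>
      gh (D.coset p) = E.coset (frag_extend (\<lambda>(x, y). frag_of (g x, h y)) p)"
proof -
  let ?fe = "frag_extend (\<lambda>(x, y). frag_of (g x, h y))"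
  obtain H where H: "abelian_group_hom D.T E.T H"
    and H_pure: "\<And>x y. \<lbrakk>x \<in> carrier M; y \<in> carrier N\<rbrakk> \<Longrightarrow> H (D.pure_tensor x y) = E.pure_tensor (g x) (h y)"
    by (rule D.tensor_universal[of E.T "\<lambda>x y. E.pure_tensor (g x) (h y)"])
      (simp_all add: E.T.abelian_group_axioms module_homD[OF g] module_homD[OF h]
        E.pure_tensor_add_left E.pure_tensor_add_right E.pure_tensor_smult)
  interpret H: abelian_group_hom D.T E.T H by fact
  have H_coset: "H (D.coset p) = E.coset (?fe p)"
    if "Poly_Mapping.keys p \<subseteq> carrier M \<times> carrier N" for p
    using that
  proof (rule free_Abelian_group_induct)
    show "H (D.coset 0) = E.coset (?fe 0)"
      by (simp add: D.coset_zero E.coset_zero)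
    show "H (D.coset (frag_of a)) = E.coset (?fe (frag_of a))" if "a \<in> carrier M \<times> carrier N" for a
      using that by (cases a) (simp add: H_pure)
    show "H (D.coset (p - q)) = E.coset (?fe (p - q))"
      if "Poly_Mapping.keys p \<subseteq> carrier M \<times> carrier N" "Poly_Mapping.keys q \<subseteq> carrier M \<times> carrier N"
        "H (D.coset p) = E.coset (?fe p)" "H (D.coset q) = E.coset (?fe q)" for p q
      using that
      by (simp add: frag_extend_diff D.coset_diff E.coset_diff frag_map_closed D.T.minus_eq E.T.minus_eq)
  qed
  have gh_eq: "gh (D.coset p) = H (D.coset p)" if p: "Poly_Mapping.keys p \<subseteq> carrier M \<times> carrier N" for p
  proof -
    have "E.coset (?fe q) = H (D.coset p)" if "q \<in> D.coset p" for q
    proof -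
      have "q \<in> carrier D.frags"
        using that p D.frags.r_coset_subset_G[OF D.relators.subset, of p]
        unfolding D.coset_def' by (meson carrier_free_Abelian_group_iff subsetD)
      moreover have "D.coset q = D.coset p"
        using that p D.frags.repr_independence[OF _ _ D.subgroup_relators, of q p]
        unfolding D.coset_def' by simp
      ultimately have "D.coset q = D.coset p" "Poly_Mapping.keys q \<subseteq> carrier M \<times> carrier N"
        by simp_all
      then show ?thesis using H_coset[of q] by simp
    qed
    moreover have "p \<in> D.coset p"
      using D.frags.rcos_self[OF _ D.subgroup_relators, of p] p by (simp add: D.coset_def')
    ultimately show ?thesis
      unfolding tensor_map_def by blast
  qed
  show "gh (D.coset p) = E.coset (?fe p)" if "Poly_Mapping.keys p \<subseteq> carrier M \<times> carrier N" for p
    using that by (simp add: gh_eq H_coset)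
  have "gh \<xi> = H \<xi>" if "\<xi> \<in> carrier D.T" for \<xi>
    using that gh_eq by (auto simp: D.carrier_tensor_product)
  then show "abelian_group_hom D.T E.T gh"
    by (intro abelian_group_homI' D.T.abelian_group_axioms E.T.abelian_group_axioms) auto
qed

sublocale gh: abelian_group_hom D.T E.T gh
  by (rule gh_facts)

lemma gh_pure:
  assumes "x \<in> carrier M" "y \<in> carrier N"
  shows "gh (D.pure_tensor x y) = E.pure_tensor (g x) (h y)"
  using assms by (simp add: gh_coset)

end

section \<open>Restriction and extension of scalars\<close>

lemma id_module_hom: "id \<in> module_hom R M M"
  by (auto simp: module_hom_def)

lemma restrict_scalars_simps [simp]:
  "carrier (restrict_scalars f B) = carrier B" "add (restrict_scalars f B) = add B"
  "\<zero>\<^bsub>restrict_scalars f B\<^esub> = \<zero>\<^bsub>B\<^esub>" "a \<odot>\<^bsub>restrict_scalars f B\<^esub> b = f a \<otimes>\<^bsub>B\<^esub> b"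
  by (simp_all add: restrict_scalars_def)

lemma module_restrict_scalars:
  assumes "ring_hom_cring A B f"
  shows "module A (restrict_scalars f B)"
proof -
  interpret ring_hom_cring A B f by fact
  have "abelian_group (restrict_scalars f B)"
    by (rule abelian_groupI) (auto simp: S.a_ac intro: S.l_neg)
  then show ?thesis
    by (intro moduleI R.is_cring) (simp_all add: S.l_distr S.r_distr S.m_assoc)
qed

locale scalar_extension = f: ring_hom_cring A B f + N: module A N
  for A :: "('a, 'x) ring_scheme" and B :: "('b, 'y) ring_scheme" and f
    and N :: "('a, 'n, 'z) module_scheme"
begin

abbreviation BN :: "('b, ('b \<times> 'n \<Rightarrow>\<^sub>0 int) set) module"
  where "BN \<equiv> extend_scalars A B f N"

sublocale module_pair A "restrict_scalars f B" N
  by (intro module_pair.intro N.module_axioms module_restrict_scalars f.ring_hom_cring_axioms)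

lemma extend_scalars_simps:
  "carrier BN = carrier T" "add BN = add T" "\<zero>\<^bsub>BN\<^esub> = \<zero>\<^bsub>T\<^esub>"
  "smult BN = (\<lambda>b. tensor_map A (restrict_scalars f B) N (\<lambda>x. b \<otimes>\<^bsub>B\<^esub> x) id)"
  by (simp_all add: extend_scalars_def Let_def)

lemma mult_module_hom:
  assumes "b \<in> carrier B"
  shows "(\<lambda>x. b \<otimes>\<^bsub>B\<^esub> x) \<in> module_hom A (restrict_scalars f B) (restrict_scalars f B)"
  using assms by (auto simp: module_hom_def f.S.r_distr f.S.m_lcomm)

lemma smult_tensor_hom:
  assumes "b \<in> carrier B"
  shows "tensor_hom A (restrict_scalars f B) N (restrict_scalars f B) N (\<lambda>x. b \<otimes>\<^bsub>B\<^esub> x) id"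
  by (intro tensor_hom.intro tensor_hom_axioms.intro module_pair_axioms mult_module_hom assms
      id_module_hom)

lemma smult_hom:
  assumes "b \<in> carrier B"
  shows "abelian_group_hom T T (\<lambda>\<xi>. b \<odot>\<^bsub>BN\<^esub> \<xi>)"
  unfolding extend_scalars_simps by (rule tensor_hom.gh_facts[OF smult_tensor_hom[OF assms]])

lemma smult_pure:
  assumes "b \<in> carrier B" "x \<in> carrier B" "y \<in> carrier N"
  shows "b \<odot>\<^bsub>BN\<^esub> pure_tensor x y = pure_tensor (b \<otimes>\<^bsub>B\<^esub> x) y"
  using tensor_hom.gh_pure[OF smult_tensor_hom[OF assms(1)], of x y] assms
  by (simp add: extend_scalars_simps)

text \<open>Multiplication by a fixed scalar is additive by functoriality, so the laws in which
  scalars are combined need checking on pure tensors only.\<close>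

lemma module_extend_scalars: "module B BN"
proof (rule moduleI)
  note smult_closed = abelian_group_hom.hom_closed[OF smult_hom]
  show "cring B" ..
  show "abelian_group BN"
    by (rule abelian_groupI; simp only: extend_scalars_simps) (auto simp: T.a_ac intro: T.l_neg)
  show "\<one>\<^bsub>B\<^esub> \<odot>\<^bsub>BN\<^esub> \<xi> = \<xi>" if "\<xi> \<in> carrier BN" for \<xi>
  proof -
    interpret o: abelian_group_hom T T "(\<odot>\<^bsub>BN\<^esub>) \<one>\<^bsub>B\<^esub>"
      by (rule smult_hom) simp
    show ?thesis
      using that unfolding extend_scalars_simps(1) by (induction rule: tensor_induct) (simp_all add: smult_pure T.minus_eq)
  qed
  fix a b \<xi> assume [simp]: "a \<in> carrier B" and "\<xi> \<in> carrier BN"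
  then have \<xi>: "\<xi> \<in> carrier T"
    by (simp add: extend_scalars_simps)
  interpret a: abelian_group_hom T T "(\<odot>\<^bsub>BN\<^esub>) a"
    by (rule smult_hom) simp
  show "a \<odot>\<^bsub>BN\<^esub> \<xi> \<in> carrier BN"
    using \<xi> by (simp add: extend_scalars_simps(1))
  show "a \<odot>\<^bsub>BN\<^esub> (\<xi> \<oplus>\<^bsub>BN\<^esub> \<eta>) = a \<odot>\<^bsub>BN\<^esub> \<xi> \<oplus>\<^bsub>BN\<^esub> a \<odot>\<^bsub>BN\<^esub> \<eta>" if "\<eta> \<in> carrier BN" for \<eta>
    using that \<xi> by (simp add: extend_scalars_simps(1-3))
  assume [simp]: "b \<in> carrier B"
  interpret b: abelian_group_hom T T "(\<odot>\<^bsub>BN\<^esub>) b"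
    by (rule smult_hom) simp
  interpret ab: abelian_group_hom T T "(\<odot>\<^bsub>BN\<^esub>) (a \<otimes>\<^bsub>B\<^esub> b)"
    by (rule smult_hom) simp
  interpret apb: abelian_group_hom T T "(\<odot>\<^bsub>BN\<^esub>) (a \<oplus>\<^bsub>B\<^esub> b)"
    by (rule smult_hom) simp
  show "(a \<otimes>\<^bsub>B\<^esub> b) \<odot>\<^bsub>BN\<^esub> \<xi> = a \<odot>\<^bsub>BN\<^esub> (b \<odot>\<^bsub>BN\<^esub> \<xi>)"
    using \<xi> by (induction rule: tensor_induct) (simp_all add: smult_pure T.minus_eq f.S.m_assoc)
  show "(a \<oplus>\<^bsub>B\<^esub> b) \<odot>\<^bsub>BN\<^esub> \<xi> = a \<odot>\<^bsub>BN\<^esub> \<xi> \<oplus>\<^bsub>BN\<^esub> b \<odot>\<^bsub>BN\<^esub> \<xi>"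
    using \<xi> unfolding extend_scalars_simps(2)
    by (induction rule: tensor_induct)
      (simp_all add: smult_pure pure_tensor_add_left[simplified] f.S.l_distr T.minus_eq T.a_ac T.minus_add)
qed

end

section \<open>Localization\<close>

locale localization = module S K + C: submonoid C S
  for S (structure) and C :: "'s set" and K :: "('s, 'k, 'y) module_scheme"
begin

abbreviation frac :: "'k \<Rightarrow> 's \<Rightarrow> ('k \<times> 's) set"
  where "frac \<equiv> fraction C K"

abbreviation L :: "(('s \<times> 's) set, ('k \<times> 's) set) module"
  where "L \<equiv> loc_module S C K"

lemma C_closed [simp]: "c \<in> C \<Longrightarrow> c \<in> carrier S"
  using C.subset by blast

lemmas smult_ac = smult_assoc1[symmetric] m_ac

lemma equiv_fraction_rel: "equiv (carrier K \<times> C) (fraction_rel C K)"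
proof (rule equivI)
  show "fraction_rel C K \<subseteq> (carrier K \<times> C) \<times> carrier K \<times> C"
    by (auto simp: fraction_rel_def)
  show "refl_on (carrier K \<times> C) (fraction_rel C K)"
    using C.one_closed by (auto simp: refl_on_def fraction_rel_def)
  show "sym (fraction_rel C K)"
    by (auto simp: sym_def fraction_rel_def) metis
  show "trans (fraction_rel C K)"
  proof (rule transI, clarsimp simp: fraction_rel_def)
    fix k c l d m e u v
    assume [simp]: "k \<in> carrier K" "c \<in> C" "l \<in> carrier K" "d \<in> C" "m \<in> carrier K" "e \<in> C" "u \<in> C" "v \<in> C"
      and u: "u \<odot>\<^bsub>K\<^esub> (d \<odot>\<^bsub>K\<^esub> k) = u \<odot>\<^bsub>K\<^esub> (c \<odot>\<^bsub>K\<^esub> l)"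
      and v: "v \<odot>\<^bsub>K\<^esub> (e \<odot>\<^bsub>K\<^esub> l) = v \<odot>\<^bsub>K\<^esub> (d \<odot>\<^bsub>K\<^esub> m)"
    \<comment> \<open>The witness has to contain the middle denominator \<open>d\<close>: the
      equation for \<open>u\<close> is multiplied by \<open>v e\<close>, the equation for
      \<open>v\<close> by \<open>u c\<close>.\<close>
    have "(u \<otimes> v \<otimes> d) \<odot>\<^bsub>K\<^esub> (e \<odot>\<^bsub>K\<^esub> k) = (v \<otimes> e) \<odot>\<^bsub>K\<^esub> (u \<odot>\<^bsub>K\<^esub> (d \<odot>\<^bsub>K\<^esub> k))"
      by (simp add: smult_ac)
    also have "\<dots> = (u \<otimes> c) \<odot>\<^bsub>K\<^esub> (v \<odot>\<^bsub>K\<^esub> (e \<odot>\<^bsub>K\<^esub> l))"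
      by (simp add: u) (simp add: smult_ac)
    also have "\<dots> = (u \<otimes> v \<otimes> d) \<odot>\<^bsub>K\<^esub> (c \<odot>\<^bsub>K\<^esub> m)"
      by (simp add: v) (simp add: smult_ac)
    finally show "\<exists>u\<in>C. u \<odot>\<^bsub>K\<^esub> (e \<odot>\<^bsub>K\<^esub> k) = u \<odot>\<^bsub>K\<^esub> (c \<odot>\<^bsub>K\<^esub> m)"
      by (intro bexI[of _ "u \<otimes> v \<otimes> d"]) (simp_all add: C.m_closed)
  qed
qed

lemma mem_fraction_iff:
  assumes "k \<in> carrier K" "c \<in> C"
  shows "(l, d) \<in> frac k c \<longleftrightarrow> l \<in> carrier K \<and> d \<in> C \<and>
    (\<exists>u\<in>C. u \<odot>\<^bsub>K\<^esub> (d \<odot>\<^bsub>K\<^esub> k) = u \<odot>\<^bsub>K\<^esub> (c \<odot>\<^bsub>K\<^esub> l))"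
  using assms by (auto simp: fraction_def fraction_rel_def)

lemma fraction_eq_iff:
  assumes "k \<in> carrier K" "c \<in> C" "l \<in> carrier K" "d \<in> C"
  shows "frac k c = frac l d \<longleftrightarrow> (\<exists>u\<in>C. u \<odot>\<^bsub>K\<^esub> (d \<odot>\<^bsub>K\<^esub> k) = u \<odot>\<^bsub>K\<^esub> (c \<odot>\<^bsub>K\<^esub> l))"
  using assms eq_equiv_class_iff[OF equiv_fraction_rel, of "(k, c)" "(l, d)"]
  by (auto simp: fraction_def fraction_rel_def)

lemma fraction_self: "k \<in> carrier K \<Longrightarrow> c \<in> C \<Longrightarrow> (k, c) \<in> frac k c"
  using C.one_closed by (auto simp: mem_fraction_iff)

lemma fraction_eqI:
  assumes "k \<in> carrier K" "c \<in> C" "l \<in> carrier K" "d \<in> C" "d \<odot>\<^bsub>K\<^esub> k = c \<odot>\<^bsub>K\<^esub> l"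
  shows "frac k c = frac l d"
  using assms C.one_closed by (auto simp: fraction_eq_iff)

lemma fraction_cancel:
  assumes "a \<in> C" "k \<in> carrier K" "c \<in> C"
  shows "frac (a \<odot>\<^bsub>K\<^esub> k) (a \<otimes> c) = frac k c"
  using assms by (intro fraction_eqI) (auto simp: smult_ac C.m_closed)

lemma carrier_loc_module: "carrier L = {frac k c | k c. k \<in> carrier K \<and> c \<in> C}"
  by (auto simp: loc_module_def fraction_def quotient_def)

lemma fraction_closed [simp, intro]: "k \<in> carrier K \<Longrightarrow> c \<in> C \<Longrightarrow> frac k c \<in> carrier L"
  by (auto simp: carrier_loc_module)

lemma zero_loc_module: "\<zero>\<^bsub>L\<^esub> = frac \<zero>\<^bsub>K\<^esub> \<one>"
  by (simp add: loc_module_def)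

lemma fraction_zero: "c \<in> C \<Longrightarrow> frac \<zero>\<^bsub>K\<^esub> c = \<zero>\<^bsub>L\<^esub>"
  unfolding zero_loc_module using C.one_closed by (intro fraction_eqI) auto

text \<open>All pairs of representatives yield the same class, and \<open>fraction_self\<close>
  shows that there is at least one pair, so the union in the definition of the sum collapses to this
  class. The proof for scalar multiplication below follows the same pattern.\<close>

lemma fraction_add:
  assumes [simp]: "k \<in> carrier K" "c \<in> C" "l \<in> carrier K" "d \<in> C"
  shows "frac k c \<oplus>\<^bsub>L\<^esub> frac l d = frac ((d \<odot>\<^bsub>K\<^esub> k) \<oplus>\<^bsub>K\<^esub> (c \<odot>\<^bsub>K\<^esub> l)) (c \<otimes> d)"
proof -
  have eq: "frac ((d' \<odot>\<^bsub>K\<^esub> k') \<oplus>\<^bsub>K\<^esub> (c' \<odot>\<^bsub>K\<^esub> l')) (c' \<otimes> d') =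
      frac ((d \<odot>\<^bsub>K\<^esub> k) \<oplus>\<^bsub>K\<^esub> (c \<odot>\<^bsub>K\<^esub> l)) (c \<otimes> d)"
    if "(k', c') \<in> frac k c" "(l', d') \<in> frac l d" for k' c' l' d'
  proof -
    from that obtain u v where [simp]: "u \<in> C" "v \<in> C" "k' \<in> carrier K" "c' \<in> C" "l' \<in> carrier K" "d' \<in> C"
      and u: "u \<odot>\<^bsub>K\<^esub> (c' \<odot>\<^bsub>K\<^esub> k) = u \<odot>\<^bsub>K\<^esub> (c \<odot>\<^bsub>K\<^esub> k')"
      and v: "v \<odot>\<^bsub>K\<^esub> (d' \<odot>\<^bsub>K\<^esub> l) = v \<odot>\<^bsub>K\<^esub> (d \<odot>\<^bsub>K\<^esub> l')"
      by (auto simp: mem_fraction_iff)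
    have "(u \<otimes> v) \<odot>\<^bsub>K\<^esub> ((c' \<otimes> d') \<odot>\<^bsub>K\<^esub> ((d \<odot>\<^bsub>K\<^esub> k) \<oplus>\<^bsub>K\<^esub> (c \<odot>\<^bsub>K\<^esub> l))) =
        (v \<otimes> d' \<otimes> d) \<odot>\<^bsub>K\<^esub> (u \<odot>\<^bsub>K\<^esub> (c' \<odot>\<^bsub>K\<^esub> k)) \<oplus>\<^bsub>K\<^esub> (u \<otimes> c' \<otimes> c) \<odot>\<^bsub>K\<^esub> (v \<odot>\<^bsub>K\<^esub> (d' \<odot>\<^bsub>K\<^esub> l))"
      by (simp add: smult_r_distr smult_ac)
    also have "\<dots> = (u \<otimes> v) \<odot>\<^bsub>K\<^esub> ((c \<otimes> d) \<odot>\<^bsub>K\<^esub> ((d' \<odot>\<^bsub>K\<^esub> k') \<oplus>\<^bsub>K\<^esub> (c' \<odot>\<^bsub>K\<^esub> l')))"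
      unfolding u v by (simp add: smult_r_distr smult_ac)
    finally show ?thesis
      by (intro fraction_eq_iff[THEN iffD2] bexI[of _ "u \<otimes> v"]) (simp_all add: C.m_closed)
  qed
  have "frac k c \<oplus>\<^bsub>L\<^esub> frac l d = (\<Union>(k', c')\<in>frac k c. \<Union>(l', d')\<in>frac l d.
      frac ((d' \<odot>\<^bsub>K\<^esub> k') \<oplus>\<^bsub>K\<^esub> (c' \<odot>\<^bsub>K\<^esub> l')) (c' \<otimes> d'))"
    by (simp add: loc_module_def)
  also have "\<dots> = (\<Union>(k', c')\<in>frac k c. \<Union>(l', d')\<in>frac l d.
      frac ((d \<odot>\<^bsub>K\<^esub> k) \<oplus>\<^bsub>K\<^esub> (c \<odot>\<^bsub>K\<^esub> l)) (c \<otimes> d))"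
    by (intro SUP_cong refl) (auto simp: eq split: prod.splits)
  also have "\<dots> = frac ((d \<odot>\<^bsub>K\<^esub> k) \<oplus>\<^bsub>K\<^esub> (c \<odot>\<^bsub>K\<^esub> l)) (c \<otimes> d)"
    using fraction_self[of k c] fraction_self[of l d] by auto
  finally show ?thesis .
qed

lemma fraction_add_same:
  assumes [simp]: "k \<in> carrier K" "l \<in> carrier K" "c \<in> C"
  shows "frac k c \<oplus>\<^bsub>L\<^esub> frac l c = frac (k \<oplus>\<^bsub>K\<^esub> l) c"
  by (simp add: fraction_add smult_r_distr[symmetric] fraction_cancel)

text \<open>Over one denominator, addition is addition of numerators
  (\<open>fraction_add_same\<close>); in this way the group laws of \<open>L\<close> reduce to those
  of \<open>K\<close>.\<close>

lemma common_denominator: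
  assumes "x \<in> carrier L" "y \<in> carrier L"
  obtains k l c where "k \<in> carrier K" "l \<in> carrier K" "c \<in> C" "x = frac k c" "y = frac l c"
proof -
  from assms obtain k c l d where kl: "k \<in> carrier K" "l \<in> carrier K" "c \<in> C" "d \<in> C" "x = frac k c" "y = frac l d"
    by (auto simp: carrier_loc_module)
  have "x = frac (d \<odot>\<^bsub>K\<^esub> k) (d \<otimes> c)" "y = frac (c \<odot>\<^bsub>K\<^esub> l) (d \<otimes> c)"
    using kl fraction_cancel[of d k c] fraction_cancel[of c l d] by (simp_all add: m_comm)
  then show ?thesis
    using kl by (intro that[of "d \<odot>\<^bsub>K\<^esub> k" "c \<odot>\<^bsub>K\<^esub> l" "d \<otimes> c"]) (simp_all add: C.m_closed)
qed

lemma common_denominator3: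
  assumes "x \<in> carrier L" "y \<in> carrier L" "z \<in> carrier L"
  obtains k l m c where "k \<in> carrier K" "l \<in> carrier K" "m \<in> carrier K" "c \<in> C"
    "x = frac k c" "y = frac l c" "z = frac m c"
proof -
  from assms obtain k l c where kl: "k \<in> carrier K" "l \<in> carrier K" "c \<in> C" "x = frac k c" "y = frac l c"
    by (elim common_denominator[of x y])
  from assms(3) obtain m d where m: "m \<in> carrier K" "d \<in> C" "z = frac m d"
    by (auto simp: carrier_loc_module)
  have "x = frac (d \<odot>\<^bsub>K\<^esub> k) (d \<otimes> c)" "y = frac (d \<odot>\<^bsub>K\<^esub> l) (d \<otimes> c)" "z = frac (c \<odot>\<^bsub>K\<^esub> m) (d \<otimes> c)"
    using kl m fraction_cancel[of d k c] fraction_cancel[of d l c] fraction_cancel[of c m d]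
    by (simp_all add: m_comm)
  then show ?thesis
    using kl m
    by (intro that[of "d \<odot>\<^bsub>K\<^esub> k" "d \<odot>\<^bsub>K\<^esub> l" "c \<odot>\<^bsub>K\<^esub> m" "d \<otimes> c"]) (simp_all add: C.m_closed)
qed

lemma abelian_group_loc_module: "abelian_group L"
proof (rule abelian_groupI)
  note [simp] = fraction_add_same fraction_zero[symmetric]
  show "\<zero>\<^bsub>L\<^esub> \<in> carrier L"
    using C.one_closed by (auto simp: zero_loc_module)
  fix x y assume x: "x \<in> carrier L" and y: "y \<in> carrier L"
  show "x \<oplus>\<^bsub>L\<^esub> y \<in> carrier L" "x \<oplus>\<^bsub>L\<^esub> y = y \<oplus>\<^bsub>L\<^esub> x"
    using x y by (auto elim!: common_denominator[of x y] simp: M.a_comm)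
  show "x \<oplus>\<^bsub>L\<^esub> y \<oplus>\<^bsub>L\<^esub> z = x \<oplus>\<^bsub>L\<^esub> (y \<oplus>\<^bsub>L\<^esub> z)" if "z \<in> carrier L" for z
    using x y that by (auto elim!: common_denominator3[of x y z] simp: M.a_assoc)
next
  fix x assume "x \<in> carrier L"
  then obtain k c where x: "x = frac k c" and [simp]: "k \<in> carrier K" "c \<in> C"
    by (auto simp: carrier_loc_module)
  show "\<zero>\<^bsub>L\<^esub> \<oplus>\<^bsub>L\<^esub> x = x"
    by (simp add: fraction_zero[of c, symmetric] x fraction_add_same)
  show "\<exists>y\<in>carrier L. y \<oplus>\<^bsub>L\<^esub> x = \<zero>\<^bsub>L\<^esub>"
    by (intro bexI[of _ "frac (\<ominus>\<^bsub>K\<^esub> k) c"]) (simp_all add: x fraction_add_same M.l_neg fraction_zero)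
qed

end

section \<open>The ring of fractions and its action on the module of fractions\<close>

lemma (in cring) module_self: "module R (restrict_scalars id R)"
  by (intro module_restrict_scalars ring_hom_cring.intro ring_hom_cring_axioms.intro)
    (auto simp: is_cring ring_hom_def)

text \<open>The carrier and addition of \<open>loc_ring\<close> are those of the module of fractions
  of \<open>S\<close> over itself, so facts about \<open>frac\<close> are reused for the ring under
  the prefix \<open>self\<close>.\<close>

sublocale localization \<subseteq> self: localization S C "restrict_scalars id S"
  by (intro localization.intro module_self C.submonoid_axioms)

context localization
begin

abbreviation B :: "('s \<times> 's) set ring"
  where "B \<equiv> loc_ring S C"

lemma loc_ring_simps:
  "carrier B = carrier self.L" "add B = add self.L" "\<zero>\<^bsub>B\<^esub> = \<zero>\<^bsub>self.L\<^esub>"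
  "\<one>\<^bsub>B\<^esub> = self.frac \<one> \<one>" "monoid.mult B = smult self.L"
  by (simp_all add: loc_ring_def Let_def)

lemma fraction_smult:
  assumes [simp]: "a \<in> carrier S" "c \<in> C" "k \<in> carrier K" "d \<in> C"
  shows "self.frac a c \<odot>\<^bsub>L\<^esub> frac k d = frac (a \<odot>\<^bsub>K\<^esub> k) (c \<otimes> d)"
proof -
  have eq: "frac (a' \<odot>\<^bsub>K\<^esub> k') (c' \<otimes> d') = frac (a \<odot>\<^bsub>K\<^esub> k) (c \<otimes> d)"
    if "(a', c') \<in> self.frac a c" "(k', d') \<in> frac k d" for a' c' k' d'
  proof -
    from that obtain u v where [simp]: "u \<in> C" "v \<in> C" "a' \<in> carrier S" "c' \<in> C" "k' \<in> carrier K" "d' \<in> C"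
      and u: "u \<otimes> (c' \<otimes> a) = u \<otimes> (c \<otimes> a')"
      and v: "v \<odot>\<^bsub>K\<^esub> (d' \<odot>\<^bsub>K\<^esub> k) = v \<odot>\<^bsub>K\<^esub> (d \<odot>\<^bsub>K\<^esub> k')"
      by (auto simp: mem_fraction_iff self.mem_fraction_iff)
    have "(u \<otimes> v) \<odot>\<^bsub>K\<^esub> ((c' \<otimes> d') \<odot>\<^bsub>K\<^esub> (a \<odot>\<^bsub>K\<^esub> k)) =
        (u \<otimes> (c' \<otimes> a)) \<odot>\<^bsub>K\<^esub> (v \<odot>\<^bsub>K\<^esub> (d' \<odot>\<^bsub>K\<^esub> k))"
      by (simp add: smult_ac)
    also have "\<dots> = (u \<otimes> v) \<odot>\<^bsub>K\<^esub> ((c \<otimes> d) \<odot>\<^bsub>K\<^esub> (a' \<odot>\<^bsub>K\<^esub> k'))"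
      unfolding u v by (simp add: smult_ac)
    finally show ?thesis
      by (intro fraction_eq_iff[THEN iffD2] bexI[of _ "u \<otimes> v"]) (simp_all add: C.m_closed)
  qed
  have "self.frac a c \<odot>\<^bsub>L\<^esub> frac k d =
      (\<Union>(a', c')\<in>self.frac a c. \<Union>(k', d')\<in>frac k d. frac (a' \<odot>\<^bsub>K\<^esub> k') (c' \<otimes> d'))"
    by (simp add: loc_module_def)
  also have "\<dots> = (\<Union>(a', c')\<in>self.frac a c. \<Union>(k', d')\<in>frac k d. frac (a \<odot>\<^bsub>K\<^esub> k) (c \<otimes> d))"
    by (intro SUP_cong refl) (auto simp: eq split: prod.splits)
  also have "\<dots> = frac (a \<odot>\<^bsub>K\<^esub> k) (c \<otimes> d)"
    using fraction_self[of k d] self.fraction_self[of a c] by auto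
  finally show ?thesis .
qed

end

context localization
begin

abbreviation i :: "'s \<Rightarrow> ('s \<times> 's) set"
  where "i \<equiv> loc_ring_map S C"

abbreviation j :: "'k \<Rightarrow> ('k \<times> 's) set"
  where "j \<equiv> loc_module_map S C K"

lemma fraction_mult:
  assumes [simp]: "a \<in> carrier S" "c \<in> C" "b \<in> carrier S" "d \<in> C"
  shows "self.frac a c \<otimes>\<^bsub>B\<^esub> self.frac b d = self.frac (a \<otimes> b) (c \<otimes> d)"
  using self.fraction_smult[of a c b d] by (simp add: loc_ring_simps)

lemma carrier_loc_ring: "carrier B = {self.frac a c | a c. a \<in> carrier S \<and> c \<in> C}"
  by (simp add: loc_ring_simps self.carrier_loc_module)

lemma frac_closed [simp, intro]: "a \<in> carrier S \<Longrightarrow> c \<in> C \<Longrightarrow> self.frac a c \<in> carrier B"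
  by (auto simp: carrier_loc_ring)

lemma cring_loc_ring: "cring B"
proof (rule cringI)
  show "abelian_group B"
  proof -
    interpret self_L: abelian_group self.L
      by (rule self.abelian_group_loc_module)
    show ?thesis
      by (rule abelian_groupI; simp only: loc_ring_simps) (auto simp: self_L.a_ac intro: self_L.l_neg)
  qed
  show "comm_monoid B"
  proof (rule comm_monoidI)
    show "\<one>\<^bsub>B\<^esub> \<in> carrier B"
      by (simp add: loc_ring_simps(4) C.one_closed)
    fix x y assume "x \<in> carrier B" "y \<in> carrier B"
    then obtain a c b d where x: "x = self.frac a c" and y: "y = self.frac b d"
      and [simp]: "a \<in> carrier S" "c \<in> C" "b \<in> carrier S" "d \<in> C"
      by (auto simp: carrier_loc_ring)
    show "x \<otimes>\<^bsub>B\<^esub> y \<in> carrier B" "x \<otimes>\<^bsub>B\<^esub> y = y \<otimes>\<^bsub>B\<^esub> x" "\<one>\<^bsub>B\<^esub> \<otimes>\<^bsub>B\<^esub> x = x"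
      by (simp_all add: x y fraction_mult C.m_closed m_comm loc_ring_simps(4))
    show "x \<otimes>\<^bsub>B\<^esub> y \<otimes>\<^bsub>B\<^esub> z = x \<otimes>\<^bsub>B\<^esub> (y \<otimes>\<^bsub>B\<^esub> z)" if "z \<in> carrier B" for z
      using that by (auto simp: carrier_loc_ring x y fraction_mult C.m_closed m_assoc)
  qed
  fix x y z assume "x \<in> carrier B" "y \<in> carrier B" "z \<in> carrier B"
  then obtain k l c m d where x: "x = self.frac k c" "y = self.frac l c" and z: "z = self.frac m d"
    and [simp]: "k \<in> carrier S" "l \<in> carrier S" "c \<in> C" "m \<in> carrier S" "d \<in> C"
    unfolding loc_ring_simps
    by (elim self.common_denominator[of x y]) (auto simp: self.carrier_loc_module)
  show "(x \<oplus>\<^bsub>B\<^esub> y) \<otimes>\<^bsub>B\<^esub> z = x \<otimes>\<^bsub>B\<^esub> z \<oplus>\<^bsub>B\<^esub> y \<otimes>\<^bsub>B\<^esub> z"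
    using self.fraction_add_same[of k l c] self.fraction_add_same[of "k \<otimes> m" "l \<otimes> m" "c \<otimes> d"]
    unfolding x z loc_ring_simps(2)[symmetric] by (simp add: fraction_mult C.m_closed l_distr)
qed

lemma module_loc_module: "module B L"
proof (rule moduleI)
  show "cring B" by (rule cring_loc_ring)
  show "abelian_group L" by (rule abelian_group_loc_module)
  show "\<one>\<^bsub>B\<^esub> \<odot>\<^bsub>L\<^esub> x = x" if "x \<in> carrier L" for x
    using that by (auto simp: carrier_loc_module loc_ring_simps fraction_smult)
  fix a x assume "a \<in> carrier B" "x \<in> carrier L"
  then obtain k c m d where a: "a = self.frac k c" and x: "x = frac m d"
    and [simp]: "k \<in> carrier S" "c \<in> C" "m \<in> carrier K" "d \<in> C"
    by (auto simp: carrier_loc_module carrier_loc_ring)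
  show "a \<odot>\<^bsub>L\<^esub> x \<in> carrier L"
    by (simp add: a x fraction_smult C.m_closed)
  show "(a \<otimes>\<^bsub>B\<^esub> b) \<odot>\<^bsub>L\<^esub> x = a \<odot>\<^bsub>L\<^esub> (b \<odot>\<^bsub>L\<^esub> x)" if "b \<in> carrier B" for b
    using that
    by (auto simp: carrier_loc_ring a x fraction_smult fraction_mult C.m_closed smult_assoc1 m_assoc)
next
  fix a b x assume "a \<in> carrier B" "b \<in> carrier B" "x \<in> carrier L"
  then obtain k l c m d where a: "a = self.frac k c" "b = self.frac l c" and x: "x = frac m d"
    and [simp]: "k \<in> carrier S" "l \<in> carrier S" "c \<in> C" "m \<in> carrier K" "d \<in> C"
    unfolding loc_ring_simps
    by (elim self.common_denominator[of a b]) (auto simp: carrier_loc_module)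
  show "(a \<oplus>\<^bsub>B\<^esub> b) \<odot>\<^bsub>L\<^esub> x = a \<odot>\<^bsub>L\<^esub> x \<oplus>\<^bsub>L\<^esub> b \<odot>\<^bsub>L\<^esub> x"
    using self.fraction_add_same[of k l c]
    unfolding a x loc_ring_simps
    by (simp add: fraction_smult C.m_closed fraction_add_same smult_l_distr)
next
  fix a x y assume "a \<in> carrier B" "x \<in> carrier L" "y \<in> carrier L"
  then obtain k l c m d where a: "a = self.frac m d" and x: "x = frac k c" "y = frac l c"
    and [simp]: "k \<in> carrier K" "l \<in> carrier K" "c \<in> C" "m \<in> carrier S" "d \<in> C"
    by (elim common_denominator[of x y]) (auto simp: carrier_loc_ring)
  show "a \<odot>\<^bsub>L\<^esub> (x \<oplus>\<^bsub>L\<^esub> y) = a \<odot>\<^bsub>L\<^esub> x \<oplus>\<^bsub>L\<^esub> a \<odot>\<^bsub>L\<^esub> y"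
    unfolding a x
    by (simp add: fraction_smult C.m_closed fraction_add_same smult_r_distr)
qed

sublocale L: module B L
  by (rule module_loc_module)

lemma ring_hom_cring_loc_ring_map: "ring_hom_cring S B i"
proof (intro ring_hom_cring.intro ring_hom_cring_axioms.intro is_cring cring_loc_ring)
  show "i \<in> ring_hom S B"
    using self.fraction_add_same[of _ _ "\<one>"] C.one_closed fraction_mult[of _ \<one> _ \<one>]
    by (intro ring_hom_memI) (auto simp: loc_ring_map_def loc_ring_simps(2,4))
qed

lemma loc_ring_map_inj:
  assumes "C \<subseteq> nonzerodivisors S"
  shows "inj_on i (carrier S)"
proof (rule inj_onI)
  fix x y assume xy: "x \<in> carrier S" "y \<in> carrier S" "i x = i y"
  then obtain u where u: "u \<in> C" "u \<otimes> x = u \<otimes> y"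
    using C.one_closed by (auto simp: loc_ring_map_def self.fraction_eq_iff)
  have "u \<otimes> (x \<ominus> y) = u \<otimes> x \<ominus> u \<otimes> y"
    using xy(1,2) u(1) by (simp add: R.minus_eq R.r_distr R.r_minus)
  also have "\<dots> = \<zero>"
    unfolding u(2) using xy(2) u(1) by (simp add: R.minus_eq R.r_neg)
  finally have "x \<ominus> y = \<zero>"
    using subsetD[OF assms u(1)] xy(1,2) unfolding nonzerodivisors_def by blast
  then show "x = y"
    using R.minus_eq_zero_iff xy(1,2) by blast
qed

lemma loc_module_map_inj:
  assumes "torsion_free_along C K"
  shows "inj_on j (carrier K)"
proof (rule inj_onI)
  fix x y assume xy: "x \<in> carrier K" "y \<in> carrier K" "j x = j y"
  then obtain u where u: "u \<in> C" "u \<odot>\<^bsub>K\<^esub> x = u \<odot>\<^bsub>K\<^esub> y"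
    using C.one_closed by (auto simp: loc_module_map_def fraction_eq_iff)
  have "u \<odot>\<^bsub>K\<^esub> (x \<ominus>\<^bsub>K\<^esub> y) = u \<odot>\<^bsub>K\<^esub> x \<ominus>\<^bsub>K\<^esub> u \<odot>\<^bsub>K\<^esub> y"
    using xy(1,2) u(1) by (simp add: M.minus_eq smult_r_distr smult_r_minus)
  also have "\<dots> = \<zero>\<^bsub>K\<^esub>"
    unfolding u(2) using xy(2) u(1) by (simp add: M.minus_eq M.r_neg)
  finally have "x \<ominus>\<^bsub>K\<^esub> y = \<zero>\<^bsub>K\<^esub>"
    using assms u(1) xy(1,2) unfolding torsion_free_along_def by blast
  then show "x = y"
    using M.minus_eq_zero_iff xy(1,2) by blast
qed

lemma loc_module_map_closed: "k \<in> carrier K \<Longrightarrow> j k \<in> carrier L"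
  using C.one_closed by (auto simp: loc_module_map_def)

lemma loc_module_map_add:
  "k \<in> carrier K \<Longrightarrow> l \<in> carrier K \<Longrightarrow> j (k \<oplus>\<^bsub>K\<^esub> l) = j k \<oplus>\<^bsub>L\<^esub> j l"
  using C.one_closed by (auto simp: loc_module_map_def fraction_add_same)

lemma loc_module_map_smult:
  "a \<in> carrier S \<Longrightarrow> k \<in> carrier K \<Longrightarrow> j (a \<odot>\<^bsub>K\<^esub> k) = i a \<odot>\<^bsub>L\<^esub> j k"
  using C.one_closed by (auto simp: loc_module_map_def loc_ring_map_def fraction_smult)

text \<open>Together with the next two lemmas this describes denominators abstractly: they become
  units, and every element is carried into the image of \<open>S\<close> or \<open>K\<close> by one
  of them. The locale \<open>twisting\<close> will assume denominators in exactly this form.\<close>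

lemma loc_ring_unit:
  assumes c: "c \<in> C"
  shows "\<exists>b\<in>carrier B. i c \<otimes>\<^bsub>B\<^esub> b = \<one>\<^bsub>B\<^esub>"
proof
  have "self.frac c c = self.frac \<one> \<one>"
    using c C.one_closed by (intro self.fraction_eqI) simp_all
  then show "i c \<otimes>\<^bsub>B\<^esub> self.frac \<one> c = \<one>\<^bsub>B\<^esub>"
    using c C.one_closed by (simp add: loc_ring_map_def fraction_mult loc_ring_simps(4))
  show "self.frac \<one> c \<in> carrier B"
    using c by simp
qed

lemma loc_ring_fraction:
  assumes "b \<in> carrier B"
  shows "\<exists>c\<in>C. \<exists>a\<in>carrier S. i c \<otimes>\<^bsub>B\<^esub> b = i a"
proof -
  obtain a c where b: "b = self.frac a c" and ac: "a \<in> carrier S" "c \<in> C"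
    using assms unfolding carrier_loc_ring by blast
  have "self.frac (c \<otimes> a) c = self.frac a \<one>"
    using ac C.one_closed by (intro self.fraction_eqI) simp_all
  then have "i c \<otimes>\<^bsub>B\<^esub> b = i a"
    using ac C.one_closed by (simp add: b loc_ring_map_def fraction_mult)
  then show ?thesis
    using ac by blast
qed

lemma loc_module_fraction:
  assumes "x \<in> carrier L"
  shows "\<exists>c\<in>C. \<exists>k\<in>carrier K. i c \<odot>\<^bsub>L\<^esub> x = j k"
proof -
  obtain k c where x: "x = frac k c" and kc: "k \<in> carrier K" "c \<in> C"
    using assms unfolding carrier_loc_module by blast
  have "frac (c \<odot>\<^bsub>K\<^esub> k) c = frac k \<one>"
    using kc C.one_closed by (intro fraction_eqI) simp_all
  then have "i c \<odot>\<^bsub>L\<^esub> x = j k"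
    using kc C.one_closed by (simp add: x loc_module_map_def loc_ring_map_def fraction_smult)
  then show ?thesis
    using kc by blast
qed

end

section \<open>A criterion for faithful flatness\<close>

lemma (in abelian_group_hom) hom_finsum:
  assumes "finite I" "f \<in> I \<rightarrow> carrier G"
  shows "h (\<Oplus>\<^bsub>G\<^esub>i\<in>I. f i) = (\<Oplus>\<^bsub>H\<^esub>i\<in>I. h (f i))"
  using assms
proof (induction I)
  case (insert i I)
  then show ?case
    using hom_closed by (simp add: Pi_iff)
qed simp

section \<open>Finite coordinate systems relative to a distinguished vector\<close>

definition linear_form :: "('r, 'x) ring_scheme \<Rightarrow> ('r, 'm, 'y) module_scheme \<Rightarrow> 'm set \<Rightarrow> ('m \<Rightarrow> 'r) \<Rightarrow> bool"
  where "linear_form A M F \<phi> \<longleftrightarrow> \<phi> \<in> F \<rightarrow> carrier A \<and>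
    (\<forall>x\<in>F. \<forall>y\<in>F. \<phi> (x \<oplus>\<^bsub>M\<^esub> y) = \<phi> x \<oplus>\<^bsub>A\<^esub> \<phi> y) \<and>
    (\<forall>a\<in>carrier A. \<forall>x\<in>F. \<phi> (a \<odot>\<^bsub>M\<^esub> x) = a \<otimes>\<^bsub>A\<^esub> \<phi> x)"

lemma linear_formD:
  assumes "linear_form A M F \<phi>"
  shows "x \<in> F \<Longrightarrow> \<phi> x \<in> carrier A"
    "x \<in> F \<Longrightarrow> y \<in> F \<Longrightarrow> \<phi> (x \<oplus>\<^bsub>M\<^esub> y) = \<phi> x \<oplus>\<^bsub>A\<^esub> \<phi> y"
    "a \<in> carrier A \<Longrightarrow> x \<in> F \<Longrightarrow> \<phi> (a \<odot>\<^bsub>M\<^esub> x) = a \<otimes>\<^bsub>A\<^esub> \<phi> x"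
  using assms by (auto simp: linear_form_def)

text \<open>A factorization F \<rightarrow> A^(n+1) \<rightarrow> M of the inclusion of
  \<open>F\<close>: the forms \<open>\<phi> k\<close> are the components of the first map, and the
  vectors \<open>e k\<close> are the images of the unit vectors under the second. The last component
  is normalized to be 1 at \<open>u\<close>. This is the trace, on the level of maps, of a free
  module with \<open>u\<close> in its basis.\<close>

definition has_coordinates ::
    "('r, 'x) ring_scheme \<Rightarrow> ('r, 'm, 'y) module_scheme \<Rightarrow> 'm \<Rightarrow> 'm set \<Rightarrow> nat \<Rightarrow>
     (nat \<Rightarrow> 'm \<Rightarrow> 'r) \<Rightarrow> (nat \<Rightarrow> 'm) \<Rightarrow> bool"
  where "has_coordinates A M u F n \<phi> e \<longleftrightarrow> submodule F A M \<and> u \<in> F \<and>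
    (\<forall>k\<le>n. linear_form A M F (\<phi> k) \<and> e k \<in> carrier M) \<and> \<phi> n u = \<one>\<^bsub>A\<^esub> \<and>
    (\<forall>m\<in>F. m = (\<Oplus>\<^bsub>M\<^esub>k\<in>{..n}. \<phi> k m \<odot>\<^bsub>M\<^esub> e k))"

text \<open>\<open>divisible\<close> and \<open>torsion_free\<close> say that M modulo the line A u
  is divisible and torsion-free, but phrased with elements of \<open>M\<close>, so that no quotient
  module has to be formed. \<open>u_free\<close> makes coefficients along the line unique.\<close>

locale divisible_cokernel = A: domain A + module A M
  for A :: "('r, 'x) ring_scheme" (structure) and M :: "('r, 'm, 'y) module_scheme" +
  fixes u
  assumes u_closed [simp]: "u \<in> carrier M"
    and u_free: "\<lbrakk>a \<in> carrier A; a \<odot>\<^bsub>M\<^esub> u = \<zero>\<^bsub>M\<^esub>\<rbrakk> \<Longrightarrow> a = \<zero>"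
    and divisible: "\<lbrakk>a \<in> carrier A; a \<noteq> \<zero>; m \<in> carrier M\<rbrakk> \<Longrightarrow>
      \<exists>r\<in>carrier A. \<exists>m'\<in>carrier M. m = r \<odot>\<^bsub>M\<^esub> u \<oplus>\<^bsub>M\<^esub> a \<odot>\<^bsub>M\<^esub> m'"
    and torsion_free: "\<lbrakk>a \<in> carrier A; a \<noteq> \<zero>; m \<in> carrier M; r \<in> carrier A; a \<odot>\<^bsub>M\<^esub> m = r \<odot>\<^bsub>M\<^esub> u\<rbrakk> \<Longrightarrow>
      \<exists>r'\<in>carrier A. m = r' \<odot>\<^bsub>M\<^esub> u"
begin

definition line :: "'m set"
  where "line = {r \<odot>\<^bsub>M\<^esub> u | r. r \<in> carrier A}"

lemma submodule_line: "submodule line A M"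
proof (rule submoduleI)
  show "\<zero>\<^bsub>M\<^esub> \<in> line"
    using smult_l_null[OF u_closed] unfolding line_def by (auto intro!: exI[of _ \<zero>])
  show "\<ominus>\<^bsub>M\<^esub> x \<in> line" if "x \<in> line" for x
    using that unfolding line_def by (auto simp: smult_l_minus[symmetric])
  show "x \<oplus>\<^bsub>M\<^esub> y \<in> line" if "x \<in> line" "y \<in> line" for x y
    using that unfolding line_def by (auto simp: smult_l_distr[symmetric])
  show "a \<odot>\<^bsub>M\<^esub> x \<in> line" if "a \<in> carrier A" "x \<in> line" for a x
    using that unfolding line_def by (auto simp: smult_assoc1[symmetric])
qed (auto simp: line_def)

lemmas line_closed = submoduleE[OF submodule_line]

lemma line_subset: "x \<in> line \<Longrightarrow> x \<in> carrier M"
  using line_closed(1) by blast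

lemma finsum_line:
  assumes "finite I" "\<And>i. i \<in> I \<Longrightarrow> f i \<in> line"
  shows "(\<Oplus>\<^bsub>M\<^esub>i\<in>I. f i) \<in> line"
  using assms
proof (induction I)
  case empty
  show ?case using submodule_line by (simp add: submodule_def subgroup.one_closed[of _ "add_monoid M", simplified])
next
  case (insert i I)
  then show ?case
    by (simp add: Pi_iff line_subset line_closed(5))
qed

lemma line_of_smult:
  assumes "a \<in> carrier A" "a \<noteq> \<zero>" "m \<in> carrier M" "a \<odot>\<^bsub>M\<^esub> m \<in> line"
  shows "m \<in> line"
  using assms torsion_free[of a m] unfolding line_def by blast

text \<open>Coordinates modulo the line through \<open>u\<close>.  To enlarge \<open>F\<close> by a vector \<open>x\<close>: if no nonzero multiple
  of \<open>x\<close> lies in \<open>F\<close>, then \<open>x\<close> is a new free direction; if \<open>c x \<in> F\<close>, then \<open>F\<close> is replaced by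
  \<open>{m. c m \<in> F}\<close>, and divisibility of the cokernel divides each \<open>e_k\<close> by \<open>c\<close> modulo the line.\<close>

definition adapted :: "'m set \<Rightarrow> nat \<Rightarrow> (nat \<Rightarrow> 'm \<Rightarrow> 'r) \<Rightarrow> (nat \<Rightarrow> 'm) \<Rightarrow> bool"
  where "adapted F n \<phi> e \<longleftrightarrow> submodule F A M \<and> u \<in> F \<and>
    (\<forall>k<n. linear_form A M F (\<phi> k) \<and> e k \<in> carrier M \<and> \<phi> k u = \<zero>) \<and>
    (\<forall>m\<in>F. m \<ominus>\<^bsub>M\<^esub> (\<Oplus>\<^bsub>M\<^esub>k\<in>{..<n}. \<phi> k m \<odot>\<^bsub>M\<^esub> e k) \<in> line)"

lemma adapted_line: "adapted line 0 \<phi> e"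
proof -
  have "u \<in> line"
    using smult_one[OF u_closed] unfolding line_def by (metis (mono_tags, lifting) A.one_closed mem_Collect_eq)
  moreover have "m \<ominus>\<^bsub>M\<^esub> \<zero>\<^bsub>M\<^esub> = m" if "m \<in> line" for m
    using line_subset[OF that] by (simp add: M.minus_eq)
  ultimately show ?thesis
    using submodule_line by (simp add: adapted_def)
qed

text \<open>No form is divided by \<open>c\<close>: the new coordinates of \<open>m\<close> are the
  old ones of \<open>c m\<close>. The factor \<open>c\<close> is absorbed by the vectors, since
  \<open>e k\<close> is congruent to \<open>c e' k\<close> modulo the line.\<close>

lemma adapted_divide:
  assumes F: "adapted F n \<phi> e" and c: "c \<in> carrier A" "c \<noteq> \<zero>"
  shows "\<exists>e'. adapted {m \<in> carrier M. c \<odot>\<^bsub>M\<^esub> m \<in> F} n (\<lambda>k m. \<phi> k (c \<odot>\<^bsub>M\<^esub> m)) e'"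
proof -
  have sub: "submodule F A M" and lin: "\<And>k. k < n \<Longrightarrow> linear_form A M F (\<phi> k)"
    and e: "\<And>k. k < n \<Longrightarrow> e k \<in> carrier M" and uF: "u \<in> F"
    and \<phi>u: "\<And>k. k < n \<Longrightarrow> \<phi> k u = \<zero>"
    and rep: "\<And>m. m \<in> F \<Longrightarrow> m \<ominus>\<^bsub>M\<^esub> (\<Oplus>\<^bsub>M\<^esub>k\<in>{..<n}. \<phi> k m \<odot>\<^bsub>M\<^esub> e k) \<in> line"
    using F by (auto simp: adapted_def)
  note F_closed = submoduleE[OF sub]
  note \<phi> = linear_formD[OF lin]
  have "\<exists>m'\<in>carrier M. e k \<ominus>\<^bsub>M\<^esub> c \<odot>\<^bsub>M\<^esub> m' \<in> line" if "k < n" for k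
  proof -
    from divisible[OF c e[OF that]] obtain r m' where rm: "r \<in> carrier A" "m' \<in> carrier M"
      "e k = r \<odot>\<^bsub>M\<^esub> u \<oplus>\<^bsub>M\<^esub> c \<odot>\<^bsub>M\<^esub> m'" by blast
    then have "e k \<ominus>\<^bsub>M\<^esub> c \<odot>\<^bsub>M\<^esub> m' = r \<odot>\<^bsub>M\<^esub> u"
      using c by (simp add: M.minus_eq M.a_assoc M.r_neg)
    then show ?thesis using rm unfolding line_def by blast
  qed
  then obtain e' where e': "\<And>k. k < n \<Longrightarrow> e' k \<in> carrier M"
    and e'_line: "\<And>k. k < n \<Longrightarrow> e k \<ominus>\<^bsub>M\<^esub> c \<odot>\<^bsub>M\<^esub> e' k \<in> line"
    by metis
  let ?F = "{m \<in> carrier M. c \<odot>\<^bsub>M\<^esub> m \<in> F}"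
  have comm: "c \<odot>\<^bsub>M\<^esub> (a \<odot>\<^bsub>M\<^esub> m) = a \<odot>\<^bsub>M\<^esub> (c \<odot>\<^bsub>M\<^esub> m)" if "a \<in> carrier A" "m \<in> carrier M" for a m
    using that c by (simp add: smult_assoc1[symmetric] A.m_comm)
  have "submodule ?F A M"
    using c F_closed sub
    by (intro submoduleI)
      (auto simp: smult_r_minus smult_r_distr comm submodule_def
        subgroup.one_closed[of _ "add_monoid M", simplified])
  moreover have "u \<in> ?F"
    using c uF F_closed by simp
  moreover have "linear_form A M ?F (\<lambda>m. \<phi> k (c \<odot>\<^bsub>M\<^esub> m))" "\<phi> k (c \<odot>\<^bsub>M\<^esub> u) = \<zero>" if "k < n" for k
    using that c uF by (auto simp: linear_form_def \<phi> smult_r_distr comm \<phi>u)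
  moreover have "m \<ominus>\<^bsub>M\<^esub> (\<Oplus>\<^bsub>M\<^esub>k\<in>{..<n}. \<phi> k (c \<odot>\<^bsub>M\<^esub> m) \<odot>\<^bsub>M\<^esub> e' k) \<in> line" if m: "m \<in> ?F" for m
  \<comment> \<open>By torsion-freeness modulo the line it suffices to place
    \<open>c (m - s)\<close> there, and \<open>c m\<close> lies in \<open>F\<close>, where the old
    coordinates apply.\<close>
  proof (rule line_of_smult[OF c])
    define a where "a k = \<phi> k (c \<odot>\<^bsub>M\<^esub> m)" for k
    have a: "a k \<in> carrier A" if "k < n" for k
      using that m by (simp add: a_def \<phi>)
    define s where "s = (\<Oplus>\<^bsub>M\<^esub>k\<in>{..<n}. a k \<odot>\<^bsub>M\<^esub> e' k)"
    have s: "s \<in> carrier M"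
      unfolding s_def using a e' by (auto intro!: M.finsum_closed)
    then show "m \<ominus>\<^bsub>M\<^esub> (\<Oplus>\<^bsub>M\<^esub>k\<in>{..<n}. \<phi> k (c \<odot>\<^bsub>M\<^esub> m) \<odot>\<^bsub>M\<^esub> e' k) \<in> carrier M"
      using m by (simp add: s_def a_def)
    let ?t = "\<Oplus>\<^bsub>M\<^esub>k\<in>{..<n}. a k \<odot>\<^bsub>M\<^esub> e k"
    have t: "?t \<in> carrier M"
      using a e by (auto intro!: M.finsum_closed)
    \<comment> \<open>Exchanging \<open>e k\<close> for \<open>c e' k\<close> costs an element of
      the line in each term; the errors are collected in \<open>?r\<close>.\<close>
    have "?t = (\<Oplus>\<^bsub>M\<^esub>k\<in>{..<n}. c \<odot>\<^bsub>M\<^esub> (a k \<odot>\<^bsub>M\<^esub> e' k) \<oplus>\<^bsub>M\<^esub> a k \<odot>\<^bsub>M\<^esub> (e k \<ominus>\<^bsub>M\<^esub> c \<odot>\<^bsub>M\<^esub> e' k))"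
    proof (rule M.finsum_cong')
      fix k assume "k \<in> {..<n}"
      then have "a k \<in> carrier A" "e k \<in> carrier M" "e' k \<in> carrier M"
        by (simp_all add: a e e')
      then show "a k \<odot>\<^bsub>M\<^esub> e k = c \<odot>\<^bsub>M\<^esub> (a k \<odot>\<^bsub>M\<^esub> e' k) \<oplus>\<^bsub>M\<^esub> a k \<odot>\<^bsub>M\<^esub> (e k \<ominus>\<^bsub>M\<^esub> c \<odot>\<^bsub>M\<^esub> e' k)"
        using c by (simp add: comm smult_r_distr[symmetric] M.minus_eq M.a_lcomm[of _ "e k"] M.r_neg)
    qed (use a e e' c in auto)
    also have "\<dots> = c \<odot>\<^bsub>M\<^esub> s \<oplus>\<^bsub>M\<^esub> (\<Oplus>\<^bsub>M\<^esub>k\<in>{..<n}. a k \<odot>\<^bsub>M\<^esub> (e k \<ominus>\<^bsub>M\<^esub> c \<odot>\<^bsub>M\<^esub> e' k))"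
      (is "_ = _ \<oplus>\<^bsub>M\<^esub> ?r")
      unfolding s_def using a e e' c
      by (subst M.finsum_addf) (auto simp: finsum_smult_ldistr)
    finally have t_eq: "?t = c \<odot>\<^bsub>M\<^esub> s \<oplus>\<^bsub>M\<^esub> ?r" .
    have r: "?r \<in> line"
      using a e'_line line_closed(4) by (intro finsum_line) auto
    have "c \<odot>\<^bsub>M\<^esub> (m \<ominus>\<^bsub>M\<^esub> s) = (c \<odot>\<^bsub>M\<^esub> m \<ominus>\<^bsub>M\<^esub> ?t) \<oplus>\<^bsub>M\<^esub> ?r"
      unfolding t_eq using c m s line_subset[OF r]
      by (simp add: M.minus_eq smult_r_distr smult_r_minus M.minus_add M.a_assoc M.l_neg)
    also have "\<dots> \<in> line"
      using rep[of "c \<odot>\<^bsub>M\<^esub> m"] m r line_closed(5) by (simp add: a_def)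
    finally show "c \<odot>\<^bsub>M\<^esub> (m \<ominus>\<^bsub>M\<^esub> (\<Oplus>\<^bsub>M\<^esub>k\<in>{..<n}. \<phi> k (c \<odot>\<^bsub>M\<^esub> m) \<odot>\<^bsub>M\<^esub> e' k)) \<in> line"
      by (simp add: s_def a_def)
  qed
  ultimately show ?thesis
    using e' unfolding adapted_def by blast
qed

lemma adapted_extend:
  assumes F: "adapted F n \<phi> e" and x: "x \<in> carrier M"
    and indep: "\<And>a. \<lbrakk>a \<in> carrier A; a \<noteq> \<zero>\<rbrakk> \<Longrightarrow> a \<odot>\<^bsub>M\<^esub> x \<notin> F"
  shows "\<exists>F' \<phi>' e'. adapted F' (Suc n) \<phi>' e' \<and> F \<subseteq> F' \<and> x \<in> F'"
proof -
  have sub: "submodule F A M" and lin: "\<And>k. k < n \<Longrightarrow> linear_form A M F (\<phi> k)"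
    and e: "\<And>k. k < n \<Longrightarrow> e k \<in> carrier M" and uF: "u \<in> F"
    and \<phi>u: "\<And>k. k < n \<Longrightarrow> \<phi> k u = \<zero>"
    and rep: "\<And>m. m \<in> F \<Longrightarrow> m \<ominus>\<^bsub>M\<^esub> (\<Oplus>\<^bsub>M\<^esub>k\<in>{..<n}. \<phi> k m \<odot>\<^bsub>M\<^esub> e k) \<in> line"
    using F by (auto simp: adapted_def)
  note F_closed = submoduleE[OF sub]
  note \<phi> = linear_formD[OF lin]
  have F_sub: "y \<in> F \<Longrightarrow> y \<in> carrier M" for y
    using F_closed(1) by blast
  have zero_F: "\<zero>\<^bsub>M\<^esub> \<in> F"
    using sub by (simp add: submodule_def subgroup.one_closed[of _ "add_monoid M", simplified])
  define F' where "F' = {y \<oplus>\<^bsub>M\<^esub> a \<odot>\<^bsub>M\<^esub> x | y a. y \<in> F \<and> a \<in> carrier A}"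
  have F'I: "y \<oplus>\<^bsub>M\<^esub> a \<odot>\<^bsub>M\<^esub> x \<in> F'" if "y \<in> F" "a \<in> carrier A" for y a
    using that by (auto simp: F'_def)
  have unique: "y = y' \<and> a = a'"
    if eq: "y \<oplus>\<^bsub>M\<^esub> a \<odot>\<^bsub>M\<^esub> x = y' \<oplus>\<^bsub>M\<^esub> a' \<odot>\<^bsub>M\<^esub> x" and y: "y \<in> F" "y' \<in> F" and a: "a \<in> carrier A" "a' \<in> carrier A"
    for y y' a a'
  proof -
    \<comment> \<open>Two decompositions of one vector put \<open>(a - a') x\<close> into
      \<open>F\<close>, which \<open>indep\<close> excludes unless \<open>a = a'\<close>.\<close>
    have "(a \<ominus> a') \<odot>\<^bsub>M\<^esub> x = a \<odot>\<^bsub>M\<^esub> x \<oplus>\<^bsub>M\<^esub> \<ominus>\<^bsub>M\<^esub> (a' \<odot>\<^bsub>M\<^esub> x)"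
      using a x by (simp add: A.minus_eq smult_l_distr smult_l_minus)
    also have "\<dots> = \<ominus>\<^bsub>M\<^esub> y \<oplus>\<^bsub>M\<^esub> (y \<oplus>\<^bsub>M\<^esub> a \<odot>\<^bsub>M\<^esub> x) \<oplus>\<^bsub>M\<^esub> \<ominus>\<^bsub>M\<^esub> (a' \<odot>\<^bsub>M\<^esub> x)"
      using y a x F_sub by (simp add: M.r_neg1)
    also have "\<dots> = \<ominus>\<^bsub>M\<^esub> y \<oplus>\<^bsub>M\<^esub> y'"
      unfolding eq using y a x F_sub by (simp add: M.a_assoc M.r_neg)
    also have "\<dots> \<in> F"
      using y F_closed(3,5) by blast
    finally have "a \<ominus> a' = \<zero>"
      using indep[of "a \<ominus> a'"] a by auto
    then have "a = a'"
      using a A.minus_eq_zero_iff by blast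
    then show ?thesis
      using eq y a x F_sub M.add.r_cancel[of "a \<odot>\<^bsub>M\<^esub> x" y y'] by simp
  qed
  \<comment> \<open>By \<open>unique\<close> the choice is forced on \<open>F'\<close>, so
    \<open>p\<close> is the pair of projections onto \<open>F\<close> and onto the coefficient of
    \<open>x\<close>.\<close>
  define p where "p m = (SOME (y, a). y \<in> F \<and> a \<in> carrier A \<and> m = y \<oplus>\<^bsub>M\<^esub> a \<odot>\<^bsub>M\<^esub> x)" for m
  have p: "p (y \<oplus>\<^bsub>M\<^esub> a \<odot>\<^bsub>M\<^esub> x) = (y, a)" if "y \<in> F" "a \<in> carrier A" for y a
    unfolding p_def using that
    by (intro some_equality) (auto dest: unique)
  have F'E: "\<exists>y a. y \<in> F \<and> a \<in> carrier A \<and> m = y \<oplus>\<^bsub>M\<^esub> a \<odot>\<^bsub>M\<^esub> x" if "m \<in> F'" for m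
    using that by (auto simp: F'_def)
  have add: "(y \<oplus>\<^bsub>M\<^esub> a \<odot>\<^bsub>M\<^esub> x) \<oplus>\<^bsub>M\<^esub> (y' \<oplus>\<^bsub>M\<^esub> a' \<odot>\<^bsub>M\<^esub> x) = (y \<oplus>\<^bsub>M\<^esub> y') \<oplus>\<^bsub>M\<^esub> (a \<oplus> a') \<odot>\<^bsub>M\<^esub> x"
    if "y \<in> F" "y' \<in> F" "a \<in> carrier A" "a' \<in> carrier A" for y y' a a'
    using that x F_sub by (simp add: smult_l_distr M.a_ac)
  have smult: "b \<odot>\<^bsub>M\<^esub> (y \<oplus>\<^bsub>M\<^esub> a \<odot>\<^bsub>M\<^esub> x) = b \<odot>\<^bsub>M\<^esub> y \<oplus>\<^bsub>M\<^esub> (b \<otimes> a) \<odot>\<^bsub>M\<^esub> x"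
    if "y \<in> F" "a \<in> carrier A" "b \<in> carrier A" for y a b
    using that x F_sub by (simp add: smult_r_distr smult_assoc1)
  have FF': "F \<subseteq> F'"
  proof
    fix y assume "y \<in> F"
    then show "y \<in> F'" using F'I[of y \<zero>] F_sub x by simp
  qed
  have xF': "x \<in> F'"
    using F'I[of "\<zero>\<^bsub>M\<^esub>" \<one>] zero_F x by simp
  have p_F: "p y = (y, \<zero>)" if "y \<in> F" for y
    using p[OF that, of \<zero>] that F_sub x by simp
  \<comment> \<open>Index \<open>n\<close> is the new coordinate along \<open>x\<close>; the old
    forms are composed with the projection onto \<open>F\<close>.\<close>
  define \<phi>' where "\<phi>' k m = (if k = n then snd (p m) else \<phi> k (fst (p m)))" for k m
  define e' where "e' = e(n := x)"
  have "submodule F' A M"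
  proof (rule submoduleI)
    show "F' \<subseteq> carrier M"
      using F_sub x by (auto simp: F'_def)
    show "\<zero>\<^bsub>M\<^esub> \<in> F'"
      using zero_F FF' by blast
    show add': "m \<oplus>\<^bsub>M\<^esub> m' \<in> F'" if "m \<in> F'" "m' \<in> F'" for m m'
      using F'E[OF that(1)] F'E[OF that(2)] by (auto simp: add intro!: F'I F_closed(5))
    show smult': "b \<odot>\<^bsub>M\<^esub> m \<in> F'" if "b \<in> carrier A" "m \<in> F'" for b m
      using F'E[OF that(2)] that(1) by (auto simp: smult intro!: F'I F_closed(4))
    show "\<ominus>\<^bsub>M\<^esub> m \<in> F'" if "m \<in> F'" for m
      using smult'[of "\<ominus> \<one>" m] that \<open>F' \<subseteq> carrier M\<close> by (auto simp: smult_l_minus subset_iff)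
  qed
  moreover have "u \<in> F'"
    using uF FF' by blast
  moreover have "linear_form A M F' (\<phi>' k)" if "k < Suc n" for k
    unfolding linear_form_def
  proof (intro conjI ballI funcsetI)
    have k: "k = n \<or> k < n" using that by auto
    fix m assume "m \<in> F'"
    then obtain y a where m: "m = y \<oplus>\<^bsub>M\<^esub> a \<odot>\<^bsub>M\<^esub> x" and [simp]: "y \<in> F" "a \<in> carrier A"
      using F'E by blast
    show "\<phi>' k m \<in> carrier A"
      using k by (auto simp: \<phi>'_def m p \<phi>)
    show "\<phi>' k (m \<oplus>\<^bsub>M\<^esub> m') = \<phi>' k m \<oplus> \<phi>' k m'" if "m' \<in> F'" for m'
      using F'E[OF that] k by (auto simp: \<phi>'_def m add p \<phi> F_closed(5))
    show "\<phi>' k (b \<odot>\<^bsub>M\<^esub> m) = b \<otimes> \<phi>' k m" if "b \<in> carrier A" for b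
      using that k by (auto simp: \<phi>'_def m smult p \<phi> F_closed(4))
  qed
  moreover have "e' k \<in> carrier M" "\<phi>' k u = \<zero>" if "k < Suc n" for k
    using that e x \<phi>u uF by (auto simp: e'_def \<phi>'_def p_F)
  moreover have "m \<ominus>\<^bsub>M\<^esub> (\<Oplus>\<^bsub>M\<^esub>k\<in>{..<Suc n}. \<phi>' k m \<odot>\<^bsub>M\<^esub> e' k) \<in> line" if "m \<in> F'" for m
  proof -
    obtain y a where m: "m = y \<oplus>\<^bsub>M\<^esub> a \<odot>\<^bsub>M\<^esub> x" and [simp]: "y \<in> F" "a \<in> carrier A"
      using F'E[OF \<open>m \<in> F'\<close>] by blast
    let ?s = "\<Oplus>\<^bsub>M\<^esub>k\<in>{..<n}. \<phi> k y \<odot>\<^bsub>M\<^esub> e k"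
    have s: "?s \<in> carrier M"
      using \<phi> e by (auto intro!: M.finsum_closed)
    have "(\<Oplus>\<^bsub>M\<^esub>k\<in>{..<n}. \<phi>' k m \<odot>\<^bsub>M\<^esub> e' k) = ?s"
      using \<phi> e by (intro M.finsum_cong') (auto simp: \<phi>'_def e'_def m p)
    moreover have "(\<Oplus>\<^bsub>M\<^esub>k\<in>{..<Suc n}. \<phi>' k m \<odot>\<^bsub>M\<^esub> e' k) =
        \<phi>' n m \<odot>\<^bsub>M\<^esub> e' n \<oplus>\<^bsub>M\<^esub> (\<Oplus>\<^bsub>M\<^esub>k\<in>{..<n}. \<phi>' k m \<odot>\<^bsub>M\<^esub> e' k)"
      unfolding lessThan_Suc using \<phi> e x
      by (intro M.finsum_insert) (auto simp: \<phi>'_def e'_def m p)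
    ultimately have "(\<Oplus>\<^bsub>M\<^esub>k\<in>{..<Suc n}. \<phi>' k m \<odot>\<^bsub>M\<^esub> e' k) = a \<odot>\<^bsub>M\<^esub> x \<oplus>\<^bsub>M\<^esub> ?s"
      by (simp add: \<phi>'_def e'_def m p)
    \<comment> \<open>The term \<open>a x\<close> cancels, so the remainder of \<open>m\<close> is
      the old remainder of its component \<open>y\<close>.\<close>
    then have "m \<ominus>\<^bsub>M\<^esub> (\<Oplus>\<^bsub>M\<^esub>k\<in>{..<Suc n}. \<phi>' k m \<odot>\<^bsub>M\<^esub> e' k) = y \<ominus>\<^bsub>M\<^esub> ?s"
      using s x F_sub by (simp add: m M.minus_eq M.minus_add M.a_assoc M.r_neg1 M.r_neg2)
    then show ?thesis
      using rep by simp
  qed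
  ultimately have "adapted F' (Suc n) \<phi>' e'"
    unfolding adapted_def by blast
  then show ?thesis
    using FF' xF' by blast
qed

lemma exists_adapted:
  assumes "finite Y" "Y \<subseteq> carrier M"
  shows "\<exists>F n \<phi> e. adapted F n \<phi> e \<and> Y \<subseteq> F"
  using assms
proof (induction Y)
  case empty
  then show ?case using adapted_line by blast
next
  case (insert x Y)
  then obtain F n \<phi> e where F: "adapted F n \<phi> e" "Y \<subseteq> F" and x: "x \<in> carrier M"
    by auto
  show ?case
  proof (cases "\<exists>c\<in>carrier A. c \<noteq> \<zero> \<and> c \<odot>\<^bsub>M\<^esub> x \<in> F")
    case True
    then obtain c where c: "c \<in> carrier A" "c \<noteq> \<zero>" "c \<odot>\<^bsub>M\<^esub> x \<in> F" by blast
    have "Y \<subseteq> {m \<in> carrier M. c \<odot>\<^bsub>M\<^esub> m \<in> F}"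
      using F c insert.prems submoduleE(4)[of F c] by (auto simp: adapted_def)
    then show ?thesis
      using adapted_divide[OF F(1) c(1,2)] c(3) x by blast
  next
    case False
    then show ?thesis
      using adapted_extend[OF F(1) x] F(2) by blast
  qed
qed

text \<open>The remainder \<open>m - s m\<close> of an adapted system is a multiple of
  \<open>u\<close>. Its coefficient, unique by \<open>u_free\<close>, is the missing coordinate
  \<open>\<psi>\<close> and becomes number \<open>n\<close>. It is linear because \<open>s\<close>
  is, and it is 1 at \<open>u\<close> because the other forms were kept zero there, that is,
  \<open>s u\<close> vanishes.\<close>

lemma exists_coordinates:
  assumes "finite Y" "Y \<subseteq> carrier M"
  shows "\<exists>F n \<phi> e. has_coordinates A M u F n \<phi> e \<and> Y \<subseteq> F"
proof -
  obtain F n \<phi> e where F: "adapted F n \<phi> e" and Y: "Y \<subseteq> F"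
    using exists_adapted[OF assms] by blast
  have sub: "submodule F A M" and lin: "\<And>k. k < n \<Longrightarrow> linear_form A M F (\<phi> k)"
    and e: "\<And>k. k < n \<Longrightarrow> e k \<in> carrier M" and uF: "u \<in> F"
    and \<phi>u: "\<And>k. k < n \<Longrightarrow> \<phi> k u = \<zero>"
    and rep: "\<And>m. m \<in> F \<Longrightarrow> m \<ominus>\<^bsub>M\<^esub> (\<Oplus>\<^bsub>M\<^esub>k\<in>{..<n}. \<phi> k m \<odot>\<^bsub>M\<^esub> e k) \<in> line"
    using F by (auto simp: adapted_def)
  note F_closed = submoduleE[OF sub]
  note \<phi> = linear_formD[OF lin]
  have F_sub: "y \<in> F \<Longrightarrow> y \<in> carrier M" for y
    using F_closed(1) by blast
  define s where "s m = (\<Oplus>\<^bsub>M\<^esub>k\<in>{..<n}. \<phi> k m \<odot>\<^bsub>M\<^esub> e k)" for m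
  have s_closed: "s m \<in> carrier M" if "m \<in> F" for m
    unfolding s_def using that \<phi> e by (auto intro!: M.finsum_closed)
  have s_add: "s (m \<oplus>\<^bsub>M\<^esub> m') = s m \<oplus>\<^bsub>M\<^esub> s m'" if "m \<in> F" "m' \<in> F" for m m'
  proof -
    have "s (m \<oplus>\<^bsub>M\<^esub> m') = (\<Oplus>\<^bsub>M\<^esub>k\<in>{..<n}. \<phi> k m \<odot>\<^bsub>M\<^esub> e k \<oplus>\<^bsub>M\<^esub> \<phi> k m' \<odot>\<^bsub>M\<^esub> e k)"
      unfolding s_def using that \<phi> e by (intro M.finsum_cong') (auto simp: smult_l_distr)
    then show ?thesis
      unfolding s_def using that \<phi> e by (subst (asm) M.finsum_addf) auto
  qed
  have s_smult: "s (a \<odot>\<^bsub>M\<^esub> m) = a \<odot>\<^bsub>M\<^esub> s m" if "m \<in> F" "a \<in> carrier A" for m a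
    unfolding s_def using that \<phi> e
    by (subst finsum_smult_ldistr) (auto intro!: M.finsum_cong' simp: smult_assoc1)
  have s_u: "s u = \<zero>\<^bsub>M\<^esub>"
    unfolding s_def using e \<phi>u by (intro M.add.finprod_one_eqI[simplified]) auto
  have r_unique: "a = b" if "a \<odot>\<^bsub>M\<^esub> u = b \<odot>\<^bsub>M\<^esub> u" "a \<in> carrier A" "b \<in> carrier A" for a b
  proof -
    have "(a \<ominus> b) \<odot>\<^bsub>M\<^esub> u = \<zero>\<^bsub>M\<^esub>"
      using that by (simp add: A.minus_eq smult_l_distr smult_l_minus M.r_neg)
    then show ?thesis
      using u_free[of "a \<ominus> b"] that A.minus_eq_zero_iff by blast
  qed
  have "\<forall>m\<in>F. \<exists>r\<in>carrier A. m = s m \<oplus>\<^bsub>M\<^esub> r \<odot>\<^bsub>M\<^esub> u"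
  proof
    fix m assume m: "m \<in> F"
    then obtain r where r: "r \<in> carrier A" "m \<ominus>\<^bsub>M\<^esub> s m = r \<odot>\<^bsub>M\<^esub> u"
      using rep unfolding line_def s_def by blast
    have "m = s m \<oplus>\<^bsub>M\<^esub> (m \<ominus>\<^bsub>M\<^esub> s m)"
      using m F_sub s_closed by (simp add: M.minus_eq M.a_lcomm M.r_neg)
    then show "\<exists>r\<in>carrier A. m = s m \<oplus>\<^bsub>M\<^esub> r \<odot>\<^bsub>M\<^esub> u"
      using r by auto
  qed
  then obtain \<psi> where \<psi>: "\<And>m. m \<in> F \<Longrightarrow> \<psi> m \<in> carrier A"
    and \<psi>_eq: "\<And>m. m \<in> F \<Longrightarrow> m = s m \<oplus>\<^bsub>M\<^esub> \<psi> m \<odot>\<^bsub>M\<^esub> u"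
    by metis
  \<comment> \<open>With this characterization, linearity of \<open>\<psi>\<close> amounts to adding
    or scaling the defining equations.\<close>
  have \<psi>I: "\<psi> m = r" if "m = s m \<oplus>\<^bsub>M\<^esub> r \<odot>\<^bsub>M\<^esub> u" "m \<in> F" "r \<in> carrier A" for m r
  proof -
    have "s m \<oplus>\<^bsub>M\<^esub> \<psi> m \<odot>\<^bsub>M\<^esub> u = s m \<oplus>\<^bsub>M\<^esub> r \<odot>\<^bsub>M\<^esub> u"
      using \<psi>_eq[OF that(2)] that(1) by metis
    then have "\<psi> m \<odot>\<^bsub>M\<^esub> u = r \<odot>\<^bsub>M\<^esub> u"
      using s_closed[OF that(2)] \<psi>[OF that(2)] that(3) M.add.l_cancel smult_closed[OF _ u_closed] by blast
    then show ?thesis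
      using r_unique that \<psi> by blast
  qed
  have "linear_form A M F \<psi>"
    unfolding linear_form_def
  proof (intro conjI ballI funcsetI)
    fix m assume m: "m \<in> F"
    note m_closed = m F_sub[OF m] s_closed[OF m] \<psi>[OF m]
    show "\<psi> m \<in> carrier A" by (fact m_closed)
    show "\<psi> (m \<oplus>\<^bsub>M\<^esub> m') = \<psi> m \<oplus> \<psi> m'" if m': "m' \<in> F" for m'
    proof (rule \<psi>I)
      have "m \<oplus>\<^bsub>M\<^esub> m' = (s m \<oplus>\<^bsub>M\<^esub> \<psi> m \<odot>\<^bsub>M\<^esub> u) \<oplus>\<^bsub>M\<^esub> (s m' \<oplus>\<^bsub>M\<^esub> \<psi> m' \<odot>\<^bsub>M\<^esub> u)"
        using \<psi>_eq[OF m] \<psi>_eq[OF m'] by simp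
      also have "\<dots> = s (m \<oplus>\<^bsub>M\<^esub> m') \<oplus>\<^bsub>M\<^esub> (\<psi> m \<oplus> \<psi> m') \<odot>\<^bsub>M\<^esub> u"
        using m_closed m' s_closed[OF m'] \<psi>[OF m'] by (simp add: s_add smult_l_distr M.a_ac)
      finally show "m \<oplus>\<^bsub>M\<^esub> m' = s (m \<oplus>\<^bsub>M\<^esub> m') \<oplus>\<^bsub>M\<^esub> (\<psi> m \<oplus> \<psi> m') \<odot>\<^bsub>M\<^esub> u" .
    qed (use m m' F_closed(5) \<psi> in auto)
    show "\<psi> (a \<odot>\<^bsub>M\<^esub> m) = a \<otimes> \<psi> m" if a: "a \<in> carrier A" for a
    proof (rule \<psi>I)
      have "a \<odot>\<^bsub>M\<^esub> m = a \<odot>\<^bsub>M\<^esub> (s m \<oplus>\<^bsub>M\<^esub> \<psi> m \<odot>\<^bsub>M\<^esub> u)"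
        using \<psi>_eq[OF m] by simp
      also have "\<dots> = s (a \<odot>\<^bsub>M\<^esub> m) \<oplus>\<^bsub>M\<^esub> (a \<otimes> \<psi> m) \<odot>\<^bsub>M\<^esub> u"
        using m_closed a by (simp add: s_smult smult_r_distr smult_assoc1)
      finally show "a \<odot>\<^bsub>M\<^esub> m = s (a \<odot>\<^bsub>M\<^esub> m) \<oplus>\<^bsub>M\<^esub> (a \<otimes> \<psi> m) \<odot>\<^bsub>M\<^esub> u" .
    qed (use m a F_closed(4) \<psi> in auto)
  qed
  moreover have "\<psi> u = \<one>"
    using uF s_u by (intro \<psi>I) simp_all
  moreover have "(\<Oplus>\<^bsub>M\<^esub>k\<in>{..n}. (\<phi>(n := \<psi>)) k m \<odot>\<^bsub>M\<^esub> (e(n := u)) k) = m" if m: "m \<in> F" for m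
  proof -
    have "(\<Oplus>\<^bsub>M\<^esub>k\<in>{..n}. (\<phi>(n := \<psi>)) k m \<odot>\<^bsub>M\<^esub> (e(n := u)) k) =
        \<psi> m \<odot>\<^bsub>M\<^esub> u \<oplus>\<^bsub>M\<^esub> (\<Oplus>\<^bsub>M\<^esub>k\<in>{..<n}. (\<phi>(n := \<psi>)) k m \<odot>\<^bsub>M\<^esub> (e(n := u)) k)"
      unfolding lessThan_Suc_atMost[symmetric] lessThan_Suc using m \<phi> \<psi> e
      by (subst M.finsum_insert) auto
    also have "(\<Oplus>\<^bsub>M\<^esub>k\<in>{..<n}. (\<phi>(n := \<psi>)) k m \<odot>\<^bsub>M\<^esub> (e(n := u)) k) = s m"
      unfolding s_def using m \<phi> e by (intro M.finsum_cong') auto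
    also have "\<psi> m \<odot>\<^bsub>M\<^esub> u \<oplus>\<^bsub>M\<^esub> s m = s m \<oplus>\<^bsub>M\<^esub> \<psi> m \<odot>\<^bsub>M\<^esub> u"
      using m \<psi> s_closed by (simp add: M.a_comm)
    finally show ?thesis
      using \<psi>_eq[OF m] by simp
  qed
  ultimately have "has_coordinates A M u F n (\<phi>(n := \<psi>)) (e(n := u))"
    using sub uF lin e unfolding has_coordinates_def by auto
  then show ?thesis
    using Y by blast
qed

end

section \<open>Tensor products over a submodule of the first factor\<close>

lemma (in module_pair) pure_tensor_hom_left:
  assumes "y \<in> carrier N"
  shows "abelian_group_hom M T (\<lambda>x. pure_tensor x y)"
  using assms
  by (intro abelian_group_homI' M.M.abelian_group_axioms T.abelian_group_axioms)
    (simp_all add: pure_tensor_add_left)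

locale sub_pair = module_pair +
  fixes F
  assumes submodule_F: "submodule F R M"
begin

abbreviation MF where "MF \<equiv> M\<lparr>carrier := F\<rparr>"

lemma F_subset: "x \<in> F \<Longrightarrow> x \<in> carrier M"
  using M.submoduleE(1)[OF submodule_F] by blast

sublocale F: module_pair R MF N
  by (intro module_pair.intro N.module_axioms submodule.submodule_is_module submodule_F M.module_axioms)

lemma incl_module_hom: "id \<in> module_hom R MF M"
  by (auto simp: module_hom_def F_subset)

sublocale incl: tensor_hom R MF N M N id id
  by (intro tensor_hom.intro tensor_hom_axioms.intro incl_module_hom id_module_hom
      F.module_pair_axioms module_pair_axioms)

lemma frag_extend_id: "frag_extend (\<lambda>(x, y). frag_of (id x, id y)) p = p"
proof -
  have eq: "(\<lambda>(x, y). frag_of (id x, id y)) = frag_of"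
    by auto
  show ?thesis
    unfolding eq by (rule frag_expansion[symmetric])
qed

lemma incl_coset: "Poly_Mapping.keys p \<subseteq> F \<times> carrier N \<Longrightarrow> incl.gh (F.coset p) = coset p"
  using incl.gh_coset[of p] unfolding frag_extend_id by simp

end

text \<open>A relation in \<open>M \<otimes> N\<close> involves only finitely many elements of \<open>M\<close>, so it already holds in
  \<open>F \<otimes> N\<close> for every large enough submodule \<open>F\<close>.\<close>

lemma (in module_pair) relators_finite_support:
  assumes "p \<in> relators"
  shows "\<exists>Y. finite Y \<and> Y \<subseteq> carrier M \<and> (\<forall>F. submodule F R M \<longrightarrow> Y \<subseteq> F \<longrightarrow>
    p \<in> generate (free_Abelian_group (F \<times> carrier N)) (tensor_relations R (M\<lparr>carrier := F\<rparr>) N))"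
proof -
  have rel: "\<exists>Y. finite Y \<and> Y \<subseteq> carrier M \<and> (\<forall>F. Y \<subseteq> F \<longrightarrow> p \<in> tensor_relations R (M\<lparr>carrier := F\<rparr>) N)"
    if "p \<in> tensor_relations R M N" for p
    using that[unfolded tensor_relations_def]
  proof (elim UnE CollectE exE conjE)
    fix x x' y assume "p = frag_of (x \<oplus>\<^bsub>M\<^esub> x', y) - frag_of (x, y) - frag_of (x', y)"
      "x \<in> carrier M" "x' \<in> carrier M" "y \<in> carrier N"
    then show ?thesis
      by (intro exI[of _ "{x, x'}"]) (auto simp: tensor_relations_def)
  next
    fix x y y' assume "p = frag_of (x, y \<oplus>\<^bsub>N\<^esub> y') - frag_of (x, y) - frag_of (x, y')"
      "x \<in> carrier M" "y \<in> carrier N" "y' \<in> carrier N"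
    then show ?thesis
      by (intro exI[of _ "{x}"]) (auto simp: tensor_relations_def)
  next
    fix r x y assume "p = frag_of (r \<odot>\<^bsub>M\<^esub> x, y) - frag_of (x, r \<odot>\<^bsub>N\<^esub> y)"
      "r \<in> carrier R" "x \<in> carrier M" "y \<in> carrier N"
    then show ?thesis
      by (intro exI[of _ "{x}"]) (auto simp: tensor_relations_def)
  qed
  let ?G = "\<lambda>F. free_Abelian_group (F \<times> carrier N)"
  let ?R = "\<lambda>F. tensor_relations R (M\<lparr>carrier := F\<rparr>) N"
  show ?thesis
    using assms
  proof (induction rule: generate.induct)
    case one
    show ?case
    proof (intro exI[of _ "{}"] conjI allI impI)
      fix F
      show "\<one>\<^bsub>frags\<^esub> \<in> generate (?G F) (?R F)"
        using generate.one[of "?G F" "?R F"] by (simp only: one_free_Abelian_group)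
    qed simp_all
  next
    case (incl p)
    then obtain Y where Y: "finite Y" "Y \<subseteq> carrier M" "\<And>F. Y \<subseteq> F \<Longrightarrow> p \<in> ?R F"
      using rel by metis
    show ?case
      by (intro exI[of _ Y] conjI allI impI generate.incl Y)
  next
    case (inv p)
    then obtain Y where Y: "finite Y" "Y \<subseteq> carrier M" "\<And>F. Y \<subseteq> F \<Longrightarrow> p \<in> ?R F"
      using rel by metis
    have "inv\<^bsub>frags\<^esub> p \<in> generate (?G F) (?R F)" if "submodule F R M" "Y \<subseteq> F" for F
    proof -
      interpret sub_pair R M N F
        by (intro sub_pair.intro module_pair_axioms sub_pair_axioms.intro that)
      \<comment> \<open>The inverse is negation in both free groups, but only for elements of the
        respective carrier; \<open>p\<close> belongs to both because it is a relation for
        \<open>F\<close> as well as for \<open>M\<close>.\<close>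
      have "inv\<^bsub>F.frags\<^esub> p = inv\<^bsub>frags\<^esub> p"
        using subsetD[OF tensor_relations_closed inv] subsetD[OF F.tensor_relations_closed Y(3)[OF that(2)]]
        by simp
      then show ?thesis
        using generate.inv[OF Y(3)[OF that(2)], of "?G F"] by simp
    qed
    then show ?case
      using Y(1,2) by (intro exI[of _ Y] conjI allI impI)
  next
    case (eng p q)
    from eng.IH obtain Y Z where Y: "finite Y" "Y \<subseteq> carrier M"
        "\<And>F. submodule F R M \<Longrightarrow> Y \<subseteq> F \<Longrightarrow> p \<in> generate (?G F) (?R F)"
      and Z: "finite Z" "Z \<subseteq> carrier M"
        "\<And>F. submodule F R M \<Longrightarrow> Z \<subseteq> F \<Longrightarrow> q \<in> generate (?G F) (?R F)"
      by metis
    have "p + q \<in> generate (?G F) (?R F)" if "submodule F R M" "Y \<union> Z \<subseteq> F" for F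
      using generate.eng[OF Y(3)[of F] Z(3)[of F]] that
      by (simp only: mult_free_Abelian_group le_sup_iff)
    then show ?case
      using Y(1,2) Z(1,2) by (intro exI[of _ "Y \<union> Z"]) simp
  qed
qed

section \<open>Contraction of tensors by coordinate forms\<close>

locale coordinate_pair = sub_pair +
  fixes u n \<phi> e
  assumes coords: "has_coordinates R M u F n \<phi> e"
begin

lemma uF: "u \<in> F" and linear: "k \<le> n \<Longrightarrow> linear_form R M F (\<phi> k)"
  and e_closed: "k \<le> n \<Longrightarrow> e k \<in> carrier M" and coord_u: "\<phi> n u = \<one>"
  and expand: "m \<in> F \<Longrightarrow> (\<Oplus>\<^bsub>M\<^esub>k\<in>{..n}. \<phi> k m \<odot>\<^bsub>M\<^esub> e k) = m"
  using coords by (auto simp: has_coordinates_def)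

lemmas coord = linear_formD[OF linear]

text \<open>This is \<open>\<phi> k\<close> tensored with \<open>N\<close>, read as a map F
  \<otimes> N \<rightarrow> N. The value zero beyond \<open>n\<close> makes the existence
  unconditional in \<open>k\<close>, so that the homomorphism property of
  \<open>contraction k\<close> can be a \<open>sublocale\<close> for all \<open>k\<close>.\<close>

lemma exists_contraction:
  "\<exists>\<theta>. abelian_group_hom F.T N \<theta> \<and>
    (\<forall>m\<in>F. \<forall>y\<in>carrier N. \<theta> (F.pure_tensor m y) = (if k \<le> n then \<phi> k m \<odot>\<^bsub>N\<^esub> y else \<zero>\<^bsub>N\<^esub>))"
  by (rule F.tensor_universal[of N "\<lambda>m y. if k \<le> n then \<phi> k m \<odot>\<^bsub>N\<^esub> y else \<zero>\<^bsub>N\<^esub>"])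
    (auto simp: N.abelian_group_axioms coord N.smult_l_distr N.smult_r_distr N.smult_assoc1[symmetric] M.m_comm)

definition contraction where
  "contraction k = (SOME \<theta>. abelian_group_hom F.T N \<theta> \<and>
    (\<forall>m\<in>F. \<forall>y\<in>carrier N. \<theta> (F.pure_tensor m y) = (if k \<le> n then \<phi> k m \<odot>\<^bsub>N\<^esub> y else \<zero>\<^bsub>N\<^esub>)))"

sublocale contraction: abelian_group_hom F.T N "contraction k" for k
  using someI_ex[OF exists_contraction[of k]] unfolding contraction_def by blast

lemma contraction_pure:
  "k \<le> n \<Longrightarrow> m \<in> F \<Longrightarrow> y \<in> carrier N \<Longrightarrow> contraction k (F.pure_tensor m y) = \<phi> k m \<odot>\<^bsub>N\<^esub> y"
  using someI_ex[OF exists_contraction[of k]] unfolding contraction_def by simp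

text \<open>The factorization through A^(n+1), tensored with \<open>N\<close>: the image of a tensor
  in M \<otimes> N is recovered from its \<open>n + 1\<close> contractions. For m \<otimes> y this
  is the expansion of \<open>m\<close> with the scalars moved to the right factor.\<close>

lemma incl_expansion:
  assumes "\<xi> \<in> carrier F.T"
  shows "incl.gh \<xi> = (\<Oplus>\<^bsub>T\<^esub>k\<in>{..n}. pure_tensor (e k) (contraction k \<xi>))"
proof (rule F.tensor_hom_eqI[OF incl.gh.abelian_group_hom_axioms _ assms])
  note closed = pure_tensor_closed[OF e_closed contraction.hom_closed]
  show "abelian_group_hom F.T T (\<lambda>\<xi>. \<Oplus>\<^bsub>T\<^esub>k\<in>{..n}. pure_tensor (e k) (contraction k \<xi>))"
  proof (rule abelian_group_homI')
    fix \<xi> \<eta> assume \<xi>: "\<xi> \<in> carrier F.T" and \<eta>: "\<eta> \<in> carrier F.T"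
    show "(\<Oplus>\<^bsub>T\<^esub>k\<in>{..n}. pure_tensor (e k) (contraction k \<xi>)) \<in> carrier T"
      using closed \<xi> by (auto intro!: T.finsum_closed)
    have "(\<Oplus>\<^bsub>T\<^esub>k\<in>{..n}. pure_tensor (e k) (contraction k (\<xi> \<oplus>\<^bsub>F.T\<^esub> \<eta>))) =
        (\<Oplus>\<^bsub>T\<^esub>k\<in>{..n}. pure_tensor (e k) (contraction k \<xi>) \<oplus>\<^bsub>T\<^esub> pure_tensor (e k) (contraction k \<eta>))"
      using closed \<xi> \<eta> e_closed
      by (intro T.finsum_cong') (auto simp: pure_tensor_add_right simp del: coset_closed)
    also have "\<dots> = (\<Oplus>\<^bsub>T\<^esub>k\<in>{..n}. pure_tensor (e k) (contraction k \<xi>)) \<oplus>\<^bsub>T\<^esub>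
        (\<Oplus>\<^bsub>T\<^esub>k\<in>{..n}. pure_tensor (e k) (contraction k \<eta>))"
      using closed \<xi> \<eta> by (intro T.finsum_addf) auto
    finally show "(\<Oplus>\<^bsub>T\<^esub>k\<in>{..n}. pure_tensor (e k) (contraction k (\<xi> \<oplus>\<^bsub>F.T\<^esub> \<eta>))) =
        (\<Oplus>\<^bsub>T\<^esub>k\<in>{..n}. pure_tensor (e k) (contraction k \<xi>)) \<oplus>\<^bsub>T\<^esub>
        (\<Oplus>\<^bsub>T\<^esub>k\<in>{..n}. pure_tensor (e k) (contraction k \<eta>))" .
  qed (fact F.T.abelian_group_axioms T.abelian_group_axioms)+
  fix m y assume "m \<in> carrier MF" and y: "y \<in> carrier N"
  then have m: "m \<in> F" by simp
  interpret py: abelian_group_hom M T "\<lambda>x. pure_tensor x y"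
    by (rule pure_tensor_hom_left[OF y])
  have "incl.gh (F.pure_tensor m y) = pure_tensor (\<Oplus>\<^bsub>M\<^esub>k\<in>{..n}. \<phi> k m \<odot>\<^bsub>M\<^esub> e k) y"
    using incl.gh_pure[of m y] m y by (simp add: expand)
  also have "\<dots> = (\<Oplus>\<^bsub>T\<^esub>k\<in>{..n}. pure_tensor (\<phi> k m \<odot>\<^bsub>M\<^esub> e k) y)"
    using m e_closed coord by (intro py.hom_finsum) auto
  also have "\<dots> = (\<Oplus>\<^bsub>T\<^esub>k\<in>{..n}. pure_tensor (e k) (contraction k (F.pure_tensor m y)))"
  proof (rule T.finsum_cong')
    show "(\<lambda>k. pure_tensor (e k) (contraction k (F.pure_tensor m y))) \<in> {..n} \<rightarrow> carrier T"
      using closed F.pure_tensor_closed[of m y] m y by auto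
    fix k assume "k \<in> {..n}"
    then show "pure_tensor (\<phi> k m \<odot>\<^bsub>M\<^esub> e k) y = pure_tensor (e k) (contraction k (F.pure_tensor m y))"
      using m y by (simp add: contraction_pure pure_tensor_smult coord e_closed)
  qed simp
  finally show "incl.gh (F.pure_tensor m y) =
      (\<Oplus>\<^bsub>T\<^esub>k\<in>{..n}. pure_tensor (e k) (contraction k (F.pure_tensor m y)))" .
qed

end

lemma (in module_pair) coset_zero_finite_support:
  assumes "Poly_Mapping.keys p \<subseteq> carrier M \<times> carrier N" "coset p = \<zero>\<^bsub>T\<^esub>"
  obtains Y where "finite Y" "Y \<subseteq> carrier M"
    "\<And>F. \<lbrakk>submodule F R M; Y \<subseteq> F\<rbrakk> \<Longrightarrow> Poly_Mapping.keys p \<subseteq> F \<times> carrier N \<and>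
      tensor_coset R (M\<lparr>carrier := F\<rparr>) N p = \<zero>\<^bsub>tensor_product R (M\<lparr>carrier := F\<rparr>) N\<^esub>"
proof -
  have "p \<in> relators"
    using assms coset_eq_zero_iff by blast
  from relators_finite_support[OF this] obtain Y where Y: "finite Y" "Y \<subseteq> carrier M"
    "\<And>F. \<lbrakk>submodule F R M; Y \<subseteq> F\<rbrakk> \<Longrightarrow>
      p \<in> generate (free_Abelian_group (F \<times> carrier N)) (tensor_relations R (M\<lparr>carrier := F\<rparr>) N)"
    by metis
  show ?thesis
  proof (rule that[OF Y(1,2)])
    fix F assume F: "submodule F R M" "Y \<subseteq> F"
    interpret sub_pair R M N F
      by (intro sub_pair.intro module_pair_axioms sub_pair_axioms.intro F)
    have p: "p \<in> F.relators"
      using Y(3)[OF F] by simp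
    then have "Poly_Mapping.keys p \<subseteq> F \<times> carrier N"
      using subsetD[OF F.relators.subset p] by simp
    then show "Poly_Mapping.keys p \<subseteq> F \<times> carrier N \<and> F.coset p = \<zero>\<^bsub>F.T\<^esub>"
      using F.coset_eq_zero_iff[of p] p by simp
  qed
qed

locale coordinate_hom = c1: coordinate_pair R M N1 F u n \<phi> e + c2: coordinate_pair R M N2 F u n \<phi> e
  for R :: "('r, 'x) ring_scheme" (structure) and M :: "('r, 'm, 'y) module_scheme"
    and N1 :: "('r, 'n1, 'z1) module_scheme" and N2 :: "('r, 'n2, 'z2) module_scheme"
    and F u n \<phi> e +
  fixes g
  assumes g: "g \<in> module_hom R N1 N2"
begin

sublocale g: abelian_group_hom N1 N2 g
  by (rule module_hom_abelian_group_hom[OF c1.N.module_axioms c2.N.module_axioms g])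

sublocale tg: tensor_hom R M N1 M N2 id g
  by (intro tensor_hom.intro tensor_hom_axioms.intro id_module_hom g
      c1.module_pair_axioms c2.module_pair_axioms)

sublocale Fg: tensor_hom R "M\<lparr>carrier := F\<rparr>" N1 "M\<lparr>carrier := F\<rparr>" N2 id g
  by (intro tensor_hom.intro tensor_hom_axioms.intro id_module_hom g
      c1.F.module_pair_axioms c2.F.module_pair_axioms)

text \<open>The forms act on the left factor and \<open>g\<close> on the right one; by linearity of
  \<open>g\<close> both sides take m \<otimes> y to \<phi>_k(m) g(y).\<close>

lemma contraction_natural:
  assumes "k \<le> n" "\<xi> \<in> carrier c1.F.T"
  shows "c2.contraction k (Fg.gh \<xi>) = g (c1.contraction k \<xi>)"
  using assms(2)
proof (rule c1.F.tensor_hom_eqI[rotated 2])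
  show "abelian_group_hom c1.F.T N2 (\<lambda>\<xi>. c2.contraction k (Fg.gh \<xi>))"
    by (intro abelian_group_homI' c1.F.T.abelian_group_axioms c2.N.abelian_group_axioms) simp_all
  show "abelian_group_hom c1.F.T N2 (\<lambda>\<xi>. g (c1.contraction k \<xi>))"
    by (intro abelian_group_homI' c1.F.T.abelian_group_axioms c2.N.abelian_group_axioms) simp_all
  fix x y assume "x \<in> carrier (M\<lparr>carrier := F\<rparr>)" and y: "y \<in> carrier N1"
  then have x: "x \<in> F" by simp
  show "c2.contraction k (Fg.gh (c1.F.pure_tensor x y)) = g (c1.contraction k (c1.F.pure_tensor x y))"
    using Fg.gh_pure[of x y] x y assms(1)
    by (simp add: c1.contraction_pure c2.contraction_pure module_homD[OF g] c1.coord)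
qed

end

section \<open>From coordinates around finite sets to faithful flatness\<close>

locale coordinate_module = module A M for A :: "('r, 'x) ring_scheme" (structure)
    and M :: "('r, 'm, 'y) module_scheme" +
  fixes u
  assumes u_closed: "u \<in> carrier M"
    and exists_coords: "\<lbrakk>finite Y; Y \<subseteq> carrier M\<rbrakk> \<Longrightarrow> \<exists>F n \<phi> e. has_coordinates A M u F n \<phi> e \<and> Y \<subseteq> F"
begin

lemma coordinate_pairI:
  assumes "module A N" "has_coordinates A M u F n \<phi> e"
  shows "coordinate_pair A M N F u n \<phi> e"
  using assms
  by (intro coordinate_pair.intro sub_pair.intro module_pair.intro sub_pair_axioms.intro
      coordinate_pair_axioms.intro module_axioms) (auto simp: has_coordinates_def)

lemma fst_keys_closed:
  assumes "Poly_Mapping.keys p \<subseteq> carrier M \<times> carrier N"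
  shows "finite (fst ` Poly_Mapping.keys p)" "fst ` Poly_Mapping.keys p \<subseteq> carrier M"
  using assms by auto

lemma keys_subset_Times:
  assumes "Poly_Mapping.keys p \<subseteq> carrier M \<times> carrier N" "fst ` Poly_Mapping.keys p \<subseteq> F"
  shows "Poly_Mapping.keys p \<subseteq> F \<times> carrier N"
  using assms by force

text \<open>The last coordinate form splits \<open>y \<mapsto> u \<otimes> y\<close> on a submodule that is large enough.\<close>

lemma pure_tensor_unit_inj:
  assumes N: "module A N" and y: "y \<in> carrier N"
    and zero: "tensor_coset A M N (frag_of (u, y)) = \<zero>\<^bsub>tensor_product A M N\<^esub>"
  shows "y = \<zero>\<^bsub>N\<^esub>"
proof -
  interpret MN: module_pair A M N
    by (intro module_pair.intro module_axioms N)
  have key: "Poly_Mapping.keys (frag_of (u, y)) \<subseteq> carrier M \<times> carrier N"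
    using u_closed y by simp
  obtain Y where Y: "finite Y" "Y \<subseteq> carrier M"
    "\<And>F. \<lbrakk>submodule F A M; Y \<subseteq> F\<rbrakk> \<Longrightarrow>
      tensor_coset A (M\<lparr>carrier := F\<rparr>) N (frag_of (u, y)) = \<zero>\<^bsub>tensor_product A (M\<lparr>carrier := F\<rparr>) N\<^esub>"
    using MN.coset_zero_finite_support[OF key zero] by metis
  obtain F n \<phi> e where F: "has_coordinates A M u F n \<phi> e" "Y \<subseteq> F"
    using exists_coords[OF Y(1,2)] by blast
  interpret c: coordinate_pair A M N F u n \<phi> e
    by (rule coordinate_pairI[OF N F(1)])
  have "y = c.contraction n (c.F.pure_tensor u y)"
    using y by (simp add: c.contraction_pure c.uF c.coord_u MN.N.smult_one)
  also have "\<dots> = \<zero>\<^bsub>N\<^esub>"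
    using Y(3)[OF c.submodule_F F(2)] by simp
  finally show ?thesis .
qed

context
  fixes N1 :: "('r, 'n1) module" and N2 :: "('r, 'n2) module" and N3 :: "('r, 'n3) module" and g h
  assumes N1: "module A N1" and N2: "module A N2" and N3: "module A N3"
    and g: "g \<in> module_hom A N1 N2" and h: "h \<in> module_hom A N2 N3"
begin

interpretation N1: module A N1 by (rule N1)
interpretation N2: module A N2 by (rule N2)
interpretation N3: module A N3 by (rule N3)
interpretation P1: module_pair A M N1 by (intro module_pair.intro module_axioms N1)
interpretation P2: module_pair A M N2 by (intro module_pair.intro module_axioms N2)
interpretation P3: module_pair A M N3 by (intro module_pair.intro module_axioms N3)
interpretation tg: tensor_hom A M N1 M N2 id g
  by (intro tensor_hom.intro tensor_hom_axioms.intro id_module_hom g P1.module_pair_axioms P2.module_pair_axioms)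
interpretation th: tensor_hom A M N2 M N3 id h
  by (intro tensor_hom.intro tensor_hom_axioms.intro id_module_hom h P2.module_pair_axioms P3.module_pair_axioms)
interpretation g: abelian_group_hom N1 N2 g
  by (rule module_hom_abelian_group_hom[OF N1 N2 g])
interpretation h: abelian_group_hom N2 N3 h
  by (rule module_hom_abelian_group_hom[OF N2 N3 h])

lemma tg_pure: "x \<in> carrier M \<Longrightarrow> y \<in> carrier N1 \<Longrightarrow> tg.gh (P1.pure_tensor x y) = P2.pure_tensor x (g y)"
  by (rule trans[OF tg.gh_pure]) (simp_all only: id_apply)

lemma th_pure: "x \<in> carrier M \<Longrightarrow> y \<in> carrier N2 \<Longrightarrow> th.gh (P2.pure_tensor x y) = P3.pure_tensor x (h y)"
  by (rule trans[OF th.gh_pure]) (simp_all only: id_apply)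

text \<open>For the kernel inclusion, a tensor killed in M \<otimes> N3 is already killed over a
  suitable \<open>F\<close>. By naturality its contractions are then in the kernel of
  \<open>h\<close>, hence in the image of \<open>g\<close>; preimages of them, recombined with the
  vectors \<open>e k\<close>, form a tensor in M \<otimes> N1 that maps to the given one by
  \<open>incl_expansion\<close>.\<close>

lemma exact_tensor:
  assumes "exact_at N1 g N2 h N3"
  shows "exact_at P1.T tg.gh P2.T th.gh P3.T"
  unfolding exact_at_def
proof (intro equalityI subsetI)
  have hg: "h (g x) = \<zero>\<^bsub>N3\<^esub>" if "x \<in> carrier N1" for x
    using assms that unfolding exact_at_def a_kernel_def' by auto
  fix \<xi> assume "\<xi> \<in> tg.gh ` carrier P1.T"
  then obtain \<eta> where \<eta>: "\<eta> \<in> carrier P1.T" "\<xi> = tg.gh \<eta>"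
    by blast
  have "th.gh (tg.gh \<eta>) = \<zero>\<^bsub>P3.T\<^esub>"
    \<comment> \<open>left to unification, \<open>P\<close> contains \<open>\<lambda>x. id x\<close>, and the homomorphism rules no longer match\<close>
  proof (rule P1.tensor_induct[where P = "\<lambda>\<eta>. th.gh (tg.gh \<eta>) = \<zero>\<^bsub>P3.T\<^esub>", OF \<eta>(1)])
    show "th.gh (tg.gh (P1.pure_tensor x y)) = \<zero>\<^bsub>P3.T\<^esub>" if "x \<in> carrier M" "y \<in> carrier N1" for x y
      unfolding tg_pure[OF that] th_pure[OF that(1) g.hom_closed[OF that(2)]]
      using that by (simp only: hg P3.pure_tensor_zero_right)
  qed (simp_all add: P1.T.minus_eq)
  then show "\<xi> \<in> a_kernel P2.T P3.T th.gh"
    unfolding \<eta>(2) a_kernel_def' using tg.gh.hom_closed[OF \<eta>(1)] by blast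
next
  have ker: "\<exists>x\<in>carrier N1. g x = y" if "y \<in> carrier N2" "h y = \<zero>\<^bsub>N3\<^esub>" for y
  proof -
    have "y \<in> g ` carrier N1"
      using assms that unfolding exact_at_def a_kernel_def' by blast
    then show ?thesis by blast
  qed
  fix \<xi> assume "\<xi> \<in> a_kernel P2.T P3.T th.gh"
  then have \<xi>: "\<xi> \<in> carrier P2.T" "th.gh \<xi> = \<zero>\<^bsub>P3.T\<^esub>"
    unfolding a_kernel_def' by blast+
  obtain p where p: "\<xi> = P2.coset p" "Poly_Mapping.keys p \<subseteq> carrier M \<times> carrier N2"
    using \<xi>(1) unfolding P2.carrier_tensor_product image_iff Bex_def carrier_free_Abelian_group_iff by blast
  let ?q = "frag_extend (\<lambda>(x, y). frag_of (id x, h y)) p"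
  have "P3.coset ?q = \<zero>\<^bsub>P3.T\<^esub>"
    using th.gh_coset[OF p(2)] \<xi>(2) p(1) by simp
  then obtain Y where Y: "finite Y" "Y \<subseteq> carrier M"
    "\<And>F. \<lbrakk>submodule F A M; Y \<subseteq> F\<rbrakk> \<Longrightarrow>
      tensor_coset A (M\<lparr>carrier := F\<rparr>) N3 ?q = \<zero>\<^bsub>tensor_product A (M\<lparr>carrier := F\<rparr>) N3\<^esub>"
    using P3.coset_zero_finite_support[OF th.frag_map_closed[OF p(2)]] by metis
  \<comment> \<open>\<open>F\<close> has to contain the elements that witness the relation and also
    the left components of \<open>p\<close>, so that \<open>p\<close> represents an element of F
    \<otimes> N2.\<close>
  obtain F n \<phi> e where F: "has_coordinates A M u F n \<phi> e" "Y \<union> fst ` Poly_Mapping.keys p \<subseteq> F"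
    using exists_coords[of "Y \<union> fst ` Poly_Mapping.keys p"] Y(1,2) fst_keys_closed[OF p(2)] by auto
  interpret c: coordinate_hom A M N2 N3 F u n \<phi> e h
    by (intro coordinate_hom.intro coordinate_pairI coordinate_hom_axioms.intro N2 N3 F h)
  have pF: "Poly_Mapping.keys p \<subseteq> F \<times> carrier N2"
    using keys_subset_Times[OF p(2)] F(2) by simp
  define \<eta> where "\<eta> = c.c1.F.coset p"
  have \<eta>: "\<eta> \<in> carrier c.c1.F.T"
    using pF by (simp add: \<eta>_def)
  have "c.Fg.gh \<eta> = \<zero>\<^bsub>c.c2.F.T\<^esub>"
    unfolding \<eta>_def using pF Y(3)[OF c.c1.submodule_F] F(2) c.Fg.gh_coset[of p] by simp
  then have "h (c.c1.contraction k \<eta>) = \<zero>\<^bsub>N3\<^esub>" if "k \<le> n" for k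
    using c.contraction_natural[OF that \<eta>] by simp
  then have "\<forall>k\<in>{..n}. \<exists>x\<in>carrier N1. g x = c.c1.contraction k \<eta>"
    using ker \<eta> by simp
  then obtain x where x: "\<And>k. k \<le> n \<Longrightarrow> x k \<in> carrier N1" "\<And>k. k \<le> n \<Longrightarrow> g (x k) = c.c1.contraction k \<eta>"
    by (metis atMost_iff)
  define \<zeta> where "\<zeta> = (\<Oplus>\<^bsub>P1.T\<^esub>k\<in>{..n}. P1.pure_tensor (e k) (x k))"
  have \<zeta>: "\<zeta> \<in> carrier P1.T"
    unfolding \<zeta>_def using P1.pure_tensor_closed[OF c.c1.e_closed x(1)] by (auto intro!: P1.T.finsum_closed)
  have "\<xi> = c.c1.incl.gh \<eta>"
    using c.c1.incl_coset[OF pF] p(1) by (simp add: \<eta>_def)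
  also have "\<dots> = (\<Oplus>\<^bsub>P2.T\<^esub>k\<in>{..n}. P2.pure_tensor (e k) (c.c1.contraction k \<eta>))"
    by (rule c.c1.incl_expansion[OF \<eta>])
  also have "\<dots> = (\<Oplus>\<^bsub>P2.T\<^esub>k\<in>{..n}. tg.gh (P1.pure_tensor (e k) (x k)))"
    using tg_pure[OF c.c1.e_closed x(1)] x(2) P2.pure_tensor_closed[OF c.c1.e_closed]
      g.hom_closed[OF x(1)]
    by (intro P2.T.finsum_cong') auto
  also have "\<dots> = tg.gh \<zeta>"
    unfolding \<zeta>_def using P1.pure_tensor_closed[OF c.c1.e_closed x(1)]
    by (intro tg.gh.hom_finsum[symmetric]) auto
  finally show "\<xi> \<in> tg.gh ` carrier P1.T"
    using \<zeta> by blast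
qed

text \<open>Exactness is tested on the tensors u \<otimes> y. That h g vanishes follows from
  injectivity of y \<mapsto> u \<otimes> y. If h(y) = 0, then u \<otimes> y comes from M \<otimes>
  N1; this equation holds over some \<open>F\<close>, and contracting it with the form that is 1 at
  \<open>u\<close> exhibits \<open>y\<close> as a value of \<open>g\<close>.\<close>

lemma exact_of_exact_tensor:
  assumes exact: "exact_at P1.T tg.gh P2.T th.gh P3.T"
  shows "exact_at N1 g N2 h N3"
  unfolding exact_at_def
proof (intro equalityI subsetI)
  fix y assume "y \<in> g ` carrier N1"
  then obtain x where x: "x \<in> carrier N1" "y = g x"
    by blast
  have "tg.gh (P1.pure_tensor u x) \<in> a_kernel P2.T P3.T th.gh"
    using exact x(1) u_closed unfolding exact_at_def by blast
  then have "P3.pure_tensor u (h (g x)) = \<zero>\<^bsub>P3.T\<^esub>"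
    unfolding tg_pure[OF u_closed x(1)] a_kernel_def' mem_Collect_eq
    using th_pure[OF u_closed g.hom_closed[OF x(1)]] by (simp only:)
  then have "h (g x) = \<zero>\<^bsub>N3\<^esub>"
    using pure_tensor_unit_inj[OF N3] x(1) by simp
  then show "y \<in> a_kernel N2 N3 h"
    unfolding x(2) a_kernel_def' using g.hom_closed[OF x(1)] by blast
next
  fix y assume "y \<in> a_kernel N2 N3 h"
  then have y: "y \<in> carrier N2" "h y = \<zero>\<^bsub>N3\<^esub>"
    unfolding a_kernel_def' by blast+
  have "th.gh (P2.pure_tensor u y) = \<zero>\<^bsub>P3.T\<^esub>"
    unfolding th_pure[OF u_closed y(1)] y(2) by (rule P3.pure_tensor_zero_right[OF u_closed])
  then have "P2.pure_tensor u y \<in> tg.gh ` carrier P1.T"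
    using exact P2.pure_tensor_closed[OF u_closed y(1)] unfolding exact_at_def a_kernel_def' by blast
  then obtain p where p: "P2.pure_tensor u y = tg.gh (P1.coset p)" "Poly_Mapping.keys p \<subseteq> carrier M \<times> carrier N1"
    unfolding P1.carrier_tensor_product image_iff Bex_def carrier_free_Abelian_group_iff by blast
  let ?q = "frag_extend (\<lambda>(x, y). frag_of (id x, g y)) p"
  have q: "Poly_Mapping.keys ?q \<subseteq> carrier M \<times> carrier N2"
    by (rule tg.frag_map_closed[OF p(2)])
  have uy: "Poly_Mapping.keys (frag_of (u, y)) \<subseteq> carrier M \<times> carrier N2"
    using u_closed y by simp
  \<comment> \<open>The equation is restated as the vanishing of a single coset, the form in which
    finiteness of support applies.\<close>
  have "P2.coset (frag_of (u, y) - ?q) = \<zero>\<^bsub>P2.T\<^esub>"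
    using P2.coset_diff[OF uy q] tg.gh_coset[OF p(2)] p(1) P2.coset_closed[OF q]
    by (simp add: P2.T.minus_eq P2.T.r_neg)
  then obtain Y where Y: "finite Y" "Y \<subseteq> carrier M"
    "\<And>F. \<lbrakk>submodule F A M; Y \<subseteq> F\<rbrakk> \<Longrightarrow>
      tensor_coset A (M\<lparr>carrier := F\<rparr>) N2 (frag_of (u, y) - ?q) = \<zero>\<^bsub>tensor_product A (M\<lparr>carrier := F\<rparr>) N2\<^esub>"
    using P2.coset_zero_finite_support[OF keys_diff_subset[OF uy q]] by metis
  obtain F n \<phi> e where F: "has_coordinates A M u F n \<phi> e" "Y \<union> fst ` Poly_Mapping.keys p \<subseteq> F"
    using exists_coords[of "Y \<union> fst ` Poly_Mapping.keys p"] Y(1,2) fst_keys_closed[OF p(2)] by auto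
  interpret c: coordinate_hom A M N1 N2 F u n \<phi> e g
    by (intro coordinate_hom.intro coordinate_pairI coordinate_hom_axioms.intro N1 N2 F g)
  have pF: "Poly_Mapping.keys p \<subseteq> F \<times> carrier N1"
    using keys_subset_Times[OF p(2)] F(2) by simp
  have qF: "Poly_Mapping.keys ?q \<subseteq> F \<times> carrier N2"
    using c.Fg.frag_map_closed[of p] pF by simp
  have uyF: "Poly_Mapping.keys (frag_of (u, y)) \<subseteq> F \<times> carrier N2"
    using c.c1.uF y by simp
  have "c.c2.F.pure_tensor u y \<ominus>\<^bsub>c.c2.F.T\<^esub> c.c2.F.coset ?q = \<zero>\<^bsub>c.c2.F.T\<^esub>"
    using c.c2.F.coset_diff[of "frag_of (u, y)" ?q] uyF qF Y(3)[OF c.c1.submodule_F] F(2) by simp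
  then have eq: "c.c2.F.pure_tensor u y = c.Fg.gh (c.c1.F.coset p)"
    using c.c2.F.T.minus_eq_zero_iff[of "c.c2.F.pure_tensor u y" "c.c2.F.coset ?q"]
      c.c2.F.coset_closed[of ?q] c.c2.F.coset_closed[of "frag_of (u, y)"] uyF qF pF c.Fg.gh_coset[of p]
    by simp
  \<comment> \<open>Form number \<open>n\<close> is the one with value 1 at
    \<open>u\<close>.\<close>
  have "y = c.c2.contraction n (c.c2.F.pure_tensor u y)"
    using y by (simp add: c.c2.contraction_pure c.c2.uF c.c2.coord_u N2.smult_one)
  also have "\<dots> = g (c.c1.contraction n (c.c1.F.coset p))"
    unfolding eq using pF by (intro c.contraction_natural) simp_all
  finally show "y \<in> g ` carrier N1"
    using c.c1.contraction.hom_closed[of "c.c1.F.coset p" n] c.c1.F.coset_closed[of p] pF by auto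
qed

end

theorem faithfully_flat: "faithfully_flat t1 t2 t3 A M"
  unfolding faithfully_flat_def
  using exact_tensor exact_of_exact_tensor module_axioms by blast

end

sublocale divisible_cokernel \<subseteq> coordinate_module
  by (intro coordinate_module.intro coordinate_module_axioms.intro module_axioms u_closed exists_coordinates)

section \<open>Idealization and quotients\<close>

lemma idealization_simps [simp]:
  "carrier (idealization S K) = carrier S \<times> carrier K"
  "\<zero>\<^bsub>idealization S K\<^esub> = (\<zero>\<^bsub>S\<^esub>, \<zero>\<^bsub>K\<^esub>)" "\<one>\<^bsub>idealization S K\<^esub> = (\<one>\<^bsub>S\<^esub>, \<zero>\<^bsub>K\<^esub>)"
  "(s, k) \<oplus>\<^bsub>idealization S K\<^esub> (t, l) = (s \<oplus>\<^bsub>S\<^esub> t, k \<oplus>\<^bsub>K\<^esub> l)"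
  "(s, k) \<otimes>\<^bsub>idealization S K\<^esub> (t, l) = (s \<otimes>\<^bsub>S\<^esub> t, s \<odot>\<^bsub>K\<^esub> l \<oplus>\<^bsub>K\<^esub> t \<odot>\<^bsub>K\<^esub> k)"
  by (simp_all add: idealization_def)

lemma (in module) cring_idealization: "cring (idealization R M)"
proof (rule cringI)
  show "abelian_group (idealization R M)"
  proof (rule abelian_groupI)
    fix x assume "x \<in> carrier (idealization R M)"
    then show "\<exists>y\<in>carrier (idealization R M). y \<oplus>\<^bsub>idealization R M\<^esub> x = \<zero>\<^bsub>idealization R M\<^esub>"
      by (intro bexI[of _ "(\<ominus> fst x, \<ominus>\<^bsub>M\<^esub> snd x)"]) (auto simp: R.l_neg M.l_neg)
  qed (auto simp: R.a_ac M.a_ac)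
  show "comm_monoid (idealization R M)"
  proof (rule comm_monoidI; clarsimp)
    fix s k t l assume cl: "s \<in> carrier R" "k \<in> carrier M" "t \<in> carrier R" "l \<in> carrier M"
    show "s \<otimes> t = t \<otimes> s \<and> s \<odot>\<^bsub>M\<^esub> l \<oplus>\<^bsub>M\<^esub> t \<odot>\<^bsub>M\<^esub> k = t \<odot>\<^bsub>M\<^esub> k \<oplus>\<^bsub>M\<^esub> s \<odot>\<^bsub>M\<^esub> l"
      using cl by (simp add: R.m_comm M.a_comm)
    fix u m assume "u \<in> carrier R" "m \<in> carrier M"
    then show "s \<otimes> t \<otimes> u = s \<otimes> (t \<otimes> u) \<and>
        (s \<otimes> t) \<odot>\<^bsub>M\<^esub> m \<oplus>\<^bsub>M\<^esub> u \<odot>\<^bsub>M\<^esub> (s \<odot>\<^bsub>M\<^esub> l \<oplus>\<^bsub>M\<^esub> t \<odot>\<^bsub>M\<^esub> k) =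
        s \<odot>\<^bsub>M\<^esub> (t \<odot>\<^bsub>M\<^esub> m \<oplus>\<^bsub>M\<^esub> u \<odot>\<^bsub>M\<^esub> l) \<oplus>\<^bsub>M\<^esub> (t \<otimes> u) \<odot>\<^bsub>M\<^esub> k"
      using cl by (simp add: R.m_assoc R.m_comm[of u] smult_r_distr smult_assoc1[symmetric] M.a_assoc)
  qed
  fix x y z assume "x \<in> carrier (idealization R M)" "y \<in> carrier (idealization R M)"
    "z \<in> carrier (idealization R M)"
  then obtain s k t l u m where xyz: "x = (s, k)" "y = (t, l)" "z = (u, m)"
    and cl: "s \<in> carrier R" "k \<in> carrier M" "t \<in> carrier R" "l \<in> carrier M" "u \<in> carrier R" "m \<in> carrier M"
    by auto
  have "((s \<oplus> t) \<odot>\<^bsub>M\<^esub> m) \<oplus>\<^bsub>M\<^esub> u \<odot>\<^bsub>M\<^esub> (k \<oplus>\<^bsub>M\<^esub> l) =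
      (s \<odot>\<^bsub>M\<^esub> m \<oplus>\<^bsub>M\<^esub> u \<odot>\<^bsub>M\<^esub> k) \<oplus>\<^bsub>M\<^esub> (t \<odot>\<^bsub>M\<^esub> m \<oplus>\<^bsub>M\<^esub> u \<odot>\<^bsub>M\<^esub> l)"
    using cl by (simp add: smult_l_distr smult_r_distr M.a_assoc M.a_lcomm)
  then show "(x \<oplus>\<^bsub>idealization R M\<^esub> y) \<otimes>\<^bsub>idealization R M\<^esub> z =
      x \<otimes>\<^bsub>idealization R M\<^esub> z \<oplus>\<^bsub>idealization R M\<^esub> y \<otimes>\<^bsub>idealization R M\<^esub> z"
    unfolding xyz idealization_simps R.l_distr[OF cl(1,3,5)] by (simp only:)
qed

lemma (in cring) mem_cgenideal_iff:
  assumes "c \<in> carrier R"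
  shows "b \<in> PIdl c \<longleftrightarrow> (\<exists>z\<in>carrier R. b = c \<otimes> z)"
  unfolding cgenideal_def mem_Collect_eq using m_comm[OF assms] by metis

text \<open>The first isomorphism theorem for A \<rightarrow> B / f(c)B: \<open>onto\<close> is
  surjectivity, and \<open>one_one\<close> identifies the kernel with cA. The theorem yields the map
  given by \<open>the_elem\<close> of an image, while \<open>induced_quotient_map\<close> is a
  union; they agree on every coset, whose image is a singleton.\<close>

lemma induced_quotient_iso:
  assumes "ring_hom_cring A B f" and c: "c \<in> carrier A"
    and onto: "\<And>y. y \<in> carrier B \<Longrightarrow> \<exists>a\<in>carrier A. \<exists>z\<in>carrier B. y = f a \<oplus>\<^bsub>B\<^esub> f c \<otimes>\<^bsub>B\<^esub> z"
    and one_one: "\<And>a z. \<lbrakk>a \<in> carrier A; z \<in> carrier B; f a = f c \<otimes>\<^bsub>B\<^esub> z\<rbrakk> \<Longrightarrow> \<exists>a'\<in>carrier A. a = c \<otimes>\<^bsub>A\<^esub> a'"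
  shows "induced_quotient_map B (PIdl\<^bsub>B\<^esub> (f c)) f \<in> ring_iso (A Quot (PIdl\<^bsub>A\<^esub> c)) (B Quot (PIdl\<^bsub>B\<^esub> (f c)))"
proof -
  interpret f: ring_hom_cring A B f by fact
  let ?J = "PIdl\<^bsub>B\<^esub> (f c)" and ?I = "PIdl\<^bsub>A\<^esub> c"
  interpret J: ideal ?J B
    by (rule f.S.cgenideal_ideal[OF f.hom_closed[OF c]])
  interpret I: ideal ?I A
    by (rule f.R.cgenideal_ideal[OF c])
  let ?h = "\<lambda>a. ?J +>\<^bsub>B\<^esub> f a"
  have J_iff: "b \<in> ?J \<longleftrightarrow> (\<exists>z\<in>carrier B. b = f c \<otimes>\<^bsub>B\<^esub> z)" for b
    by (rule f.S.mem_cgenideal_iff[OF f.hom_closed[OF c]])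
  have I_iff: "a \<in> ?I \<longleftrightarrow> (\<exists>z\<in>carrier A. a = c \<otimes>\<^bsub>A\<^esub> z)" for a
    by (rule f.R.mem_cgenideal_iff[OF c])
  interpret h: ring_hom_ring A "B Quot ?J" ?h
  proof -
    have "(+>\<^bsub>B\<^esub>) ?J \<circ> f \<in> ring_hom A (B Quot ?J)"
      by (rule ring_hom_trans[OF f.homh J.rcos_ring_hom])
    then show "ring_hom_ring A (B Quot ?J) ?h"
      by (intro ring_hom_ringI2 J.quotient_is_ring f.R.ring_axioms) (simp add: comp_def)
  qed
  have h_zero: "?h a = \<zero>\<^bsub>B Quot ?J\<^esub> \<longleftrightarrow> f a \<in> ?J" if "a \<in> carrier A" for a
  proof -
    have "\<zero>\<^bsub>B Quot ?J\<^esub> = ?J"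
      by (simp add: FactRing_def)
    then show ?thesis
      using J.a_rcos_const J.rcos_const_imp_mem[OF f.hom_closed[OF that]] by metis
  qed
  have ker: "a_kernel A (B Quot ?J) ?h = ?I"
  proof (intro equalityI subsetI)
    fix a assume "a \<in> a_kernel A (B Quot ?J) ?h"
    then have a: "a \<in> carrier A" "f a \<in> ?J"
      using h_zero unfolding a_kernel_def' by blast+
    then show "a \<in> ?I"
      using one_one[OF a(1)] unfolding I_iff J_iff by blast
  next
    fix a assume a: "a \<in> ?I"
    then have "f a \<in> ?J"
      using c unfolding I_iff J_iff by auto
    then show "a \<in> a_kernel A (B Quot ?J) ?h"
      using h_zero[of a] I.Icarr[OF a] unfolding a_kernel_def' by blast
  qed
  have onto_h: "?h ` carrier A = carrier (B Quot ?J)"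
  proof (intro equalityI subsetI)
    fix U assume "U \<in> carrier (B Quot ?J)"
    then obtain y where y: "y \<in> carrier B" "U = ?J +>\<^bsub>B\<^esub> y"
      unfolding FactRing_def A_RCOSETS_def' partial_object.simps by blast
    from onto[OF y(1)] obtain a z where az: "a \<in> carrier A" "z \<in> carrier B" "y = f a \<oplus>\<^bsub>B\<^esub> f c \<otimes>\<^bsub>B\<^esub> z"
      by blast
    have "y \<in> ?J +>\<^bsub>B\<^esub> f a"
      unfolding a_r_coset_def' using az f.S.a_comm[of "f a" "f c \<otimes>\<^bsub>B\<^esub> z"] c J_iff[of "f c \<otimes>\<^bsub>B\<^esub> z"]
      by blast
    then have "U = ?h a"
      using az(1) y J.a_repr_independence' by simp
    then show "U \<in> ?h ` carrier A"
      using az(1) by blast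
  qed (use h.hom_closed in blast)
  have "(\<lambda>U. the_elem (?h ` U)) \<in> ring_iso (A Quot ?I) (B Quot ?J)"
    using h.FactRing_iso_set[OF onto_h] by (simp only: ker)
  moreover have "induced_quotient_map B ?J f U = the_elem (?h ` U)" if "U \<in> carrier (A Quot ?I)" for U
  proof -
    obtain a where a: "a \<in> carrier A" "U = ?I +>\<^bsub>A\<^esub> a"
      using \<open>U \<in> carrier (A Quot ?I)\<close> unfolding FactRing_def A_RCOSETS_def' partial_object.simps by blast
    have "a \<in> U"
      unfolding a(2) by (rule I.a_rcos_self[OF a(1)])
    moreover have "?h b = ?h a" if "b \<in> U" for b
      using h.rcos_imp_homeq[of a b] that a by (simp only: ker)
    ultimately have "?h ` U = {?h a}"
      by blast
    then show ?thesis
      by (auto simp: induced_quotient_map_def)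
  qed
  \<comment> \<open>The two maps are compared on the carrier only, so carrying over the homomorphism
    laws uses that the quotient is closed under its operations.\<close>
  moreover have "ring (A Quot ?I)"
    by (rule I.quotient_is_ring)
  ultimately show ?thesis
    unfolding ring_iso_def ring_hom_def
    by (auto simp: Pi_iff ring.ring_simprules cong: bij_betw_cong)
qed

section \<open>Twisting derivations\<close>

text \<open>Two models are intended: the localizations of \<open>S\<close> and \<open>K\<close> at a
  given \<open>C\<close>, and the quotient field of \<open>S\<close> with its tensor product with
  \<open>K\<close>, where \<open>C\<close> will consist of the nonzero constants of
  \<open>D\<close>. In both, \<open>C\<close> consists of constants and suffices for all
  denominators.\<close>

locale twisting = K: module S K + L: module B L + i: ring_hom_cring S B i + j: abelian_group_hom K L j +
    C: submonoid C S
  for S :: "('s, 'x) ring_scheme" (structure) and K :: "('s, 'k, 'y) module_scheme"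
    and B :: "('b, 'x2) ring_scheme" and L :: "('b, 'l, 'y2) module_scheme"
    and i j C +
  fixes R :: "'s set" and D :: "'b \<Rightarrow> 'l"
  assumes i_inj: "inj_on i (carrier S)" and j_inj: "inj_on j (carrier K)"
    and j_smult: "\<lbrakk>s \<in> carrier S; k \<in> carrier K\<rbrakk> \<Longrightarrow> j (s \<odot>\<^bsub>K\<^esub> k) = i s \<odot>\<^bsub>L\<^esub> j k"
    and C_unit: "c \<in> C \<Longrightarrow> \<exists>b\<in>carrier B. i c \<otimes>\<^bsub>B\<^esub> b = \<one>\<^bsub>B\<^esub>"
    and B_fraction: "b \<in> carrier B \<Longrightarrow> \<exists>c\<in>C. \<exists>s\<in>carrier S. i c \<otimes>\<^bsub>B\<^esub> b = i s"
    and L_fraction: "\<xi> \<in> carrier L \<Longrightarrow> \<exists>c\<in>C. \<exists>k\<in>carrier K. i c \<odot>\<^bsub>L\<^esub> \<xi> = j k"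
    and derivation: "derivation B L D"
    and D_C: "c \<in> C \<Longrightarrow> D (i c) = \<zero>\<^bsub>L\<^esub>"
    and R_eq: "R = {s \<in> carrier S. D (i s) \<in> j ` carrier K}"
    and subring_R: "subring R S"
    and span: "module_span B L (D ` carrier B) = carrier L"
    and dense: "c \<in> C \<Longrightarrow> i ` carrier S \<subseteq> a_kernel B L D <+>\<^bsub>B\<^esub> i ` (PIdl c)"
begin

lemma C_closed [simp]: "c \<in> C \<Longrightarrow> c \<in> carrier S"
  using C.subset by blast

lemma D_closed [simp]: "b \<in> carrier B \<Longrightarrow> D b \<in> carrier L"
  and D_add: "\<lbrakk>b \<in> carrier B; b' \<in> carrier B\<rbrakk> \<Longrightarrow> D (b \<oplus>\<^bsub>B\<^esub> b') = D b \<oplus>\<^bsub>L\<^esub> D b'"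
  and D_mult: "\<lbrakk>b \<in> carrier B; b' \<in> carrier B\<rbrakk> \<Longrightarrow>
    D (b \<otimes>\<^bsub>B\<^esub> b') = b \<odot>\<^bsub>L\<^esub> D b' \<oplus>\<^bsub>L\<^esub> b' \<odot>\<^bsub>L\<^esub> D b"
  using derivation by (auto simp: derivation_def)

sublocale D: abelian_group_hom B L D
  by (intro abelian_group_homI' L.R.abelian_group_axioms L.M.abelian_group_axioms D_closed D_add)

lemma D_mult_const:
  assumes "b \<in> carrier B" "b' \<in> carrier B" "D b = \<zero>\<^bsub>L\<^esub>"
  shows "D (b \<otimes>\<^bsub>B\<^esub> b') = b \<odot>\<^bsub>L\<^esub> D b'"
  using assms by (simp add: D_mult)

lemma D_mult_C:
  assumes "c \<in> C" "b \<in> carrier B"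
  shows "D (i c \<otimes>\<^bsub>B\<^esub> b) = i c \<odot>\<^bsub>L\<^esub> D b"
  using assms by (simp add: D_mult_const D_C)

lemma L_cancel:
  assumes "c \<in> C" "\<xi> \<in> carrier L" "\<eta> \<in> carrier L" "i c \<odot>\<^bsub>L\<^esub> \<xi> = i c \<odot>\<^bsub>L\<^esub> \<eta>"
  shows "\<xi> = \<eta>"
proof -
  obtain b where b: "b \<in> carrier B" "i c \<otimes>\<^bsub>B\<^esub> b = \<one>\<^bsub>B\<^esub>"
    using C_unit[OF assms(1)] by blast
  have "b \<odot>\<^bsub>L\<^esub> (i c \<odot>\<^bsub>L\<^esub> \<zeta>) = \<zeta>" if "\<zeta> \<in> carrier L" for \<zeta>
    using b that assms(1) L.R.m_comm[of "i c" b] by (simp add: L.smult_assoc1[symmetric])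
  then show ?thesis
    using assms by metis
qed

text \<open>The constant provided by \<open>dense\<close> is an element of \<open>B\<close>, but it
  equals \<open>i (s - c z)\<close> and so comes from \<open>S\<close>.\<close>

lemma split_const:
  assumes s: "s \<in> carrier S" and c: "c \<in> C"
  obtains w z where "w \<in> carrier S" "z \<in> carrier S" "s = w \<oplus> c \<otimes> z" "D (i w) = \<zero>\<^bsub>L\<^esub>"
proof -
  have "i s \<in> a_kernel B L D <+>\<^bsub>B\<^esub> i ` (PIdl c)"
    using dense[OF c] s by blast
  then obtain b z where b: "b \<in> carrier B" "D b = \<zero>\<^bsub>L\<^esub>" and z: "z \<in> carrier S"
    and eq: "i s = b \<oplus>\<^bsub>B\<^esub> i (z \<otimes> c)"
    unfolding set_add_def' a_kernel_def' cgenideal_def by blast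
  have "i (s \<ominus> c \<otimes> z) = i s \<ominus>\<^bsub>B\<^esub> i (z \<otimes> c)"
    using s z c by (simp add: K.R.minus_eq L.R.minus_eq K.R.m_comm)
  also have "\<dots> = b"
    unfolding eq using b z c by (simp add: L.R.minus_eq L.R.a_assoc L.R.r_neg)
  finally have "D (i (s \<ominus> c \<otimes> z)) = \<zero>\<^bsub>L\<^esub>"
    using b by simp
  moreover have "s = (s \<ominus> c \<otimes> z) \<oplus> c \<otimes> z"
    using s z c by (simp add: K.R.minus_eq K.R.a_assoc K.R.l_neg)
  ultimately show ?thesis
    using s z c by (intro that[of "s \<ominus> c \<otimes> z" z]) auto
qed

text \<open>Differentiate \<open>s = w + c z\<close>, where \<open>w\<close> and \<open>c\<close>
  are constants. Values of \<open>D\<close> on \<open>S\<close> are thus divisible by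
  \<open>C\<close>, with quotients that are again values on \<open>S\<close>.\<close>

lemma D_split:
  assumes s: "s \<in> carrier S" and c: "c \<in> C"
  obtains z where "z \<in> carrier S" "D (i s) = i c \<odot>\<^bsub>L\<^esub> D (i z)"
  using split_const[OF s c] c by (metis (no_types, lifting) C_closed D.hom_add D_closed D_mult_C
      K.R.m_closed L.M.l_zero L.smult_closed i.hom_add i.hom_closed i.hom_mult)

text \<open>By linear closure it suffices to approximate the values of \<open>D\<close>; the set below will turn out to be
  all of \<open>L\<close>, so that \<open>K \<subseteq> D(S) + c K\<close>.\<close>

definition approx :: "'l set"
  where "approx = {\<xi> \<in> carrier L. \<forall>c\<in>C. \<exists>x\<in>carrier S. \<exists>k\<in>carrier K. \<xi> = D (i x) \<oplus>\<^bsub>L\<^esub> i c \<odot>\<^bsub>L\<^esub> j k}"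

text \<open>Write \<open>b\<close> as \<open>a / e\<close>. The denominator is removed by
  approximating \<open>\<xi>\<close> modulo \<open>e c\<close> and dividing the leading term
  \<open>D x\<close> by \<open>e\<close>, which gives \<open>D z\<close>. The numerator is replaced
  by a constant \<open>u\<close>, because \<open>u D(z)\<close> is the derivative of
  \<open>u z\<close> whereas \<open>a D(z)\<close> need not be a derivative.\<close>

lemma approx_smult:
  assumes b: "b \<in> carrier B" and \<xi>: "\<xi> \<in> approx"
  shows "b \<odot>\<^bsub>L\<^esub> \<xi> \<in> approx"
proof -
  have \<xi>L: "\<xi> \<in> carrier L" and \<xi>_ex: "\<And>c. c \<in> C \<Longrightarrow> \<exists>x\<in>carrier S. \<exists>k\<in>carrier K. \<xi> = D (i x) \<oplus>\<^bsub>L\<^esub> i c \<odot>\<^bsub>L\<^esub> j k"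
    using \<xi> by (auto simp: approx_def)
  obtain e a where e: "e \<in> C" and a: "a \<in> carrier S" and ea: "i e \<otimes>\<^bsub>B\<^esub> b = i a"
    using B_fraction[OF b] by blast
  have "\<exists>x\<in>carrier S. \<exists>k\<in>carrier K. b \<odot>\<^bsub>L\<^esub> \<xi> = D (i x) \<oplus>\<^bsub>L\<^esub> i c \<odot>\<^bsub>L\<^esub> j k" if c: "c \<in> C" for c
  proof -
    \<comment> \<open>Precision \<open>e c\<close>, since the division by \<open>e\<close> uses up
      the factor \<open>e\<close>.\<close>
    obtain x k where x: "x \<in> carrier S" and k: "k \<in> carrier K"
      and \<xi>_eq: "\<xi> = D (i x) \<oplus>\<^bsub>L\<^esub> i (e \<otimes> c) \<odot>\<^bsub>L\<^esub> j k"
      using \<xi>_ex[of "e \<otimes> c"] e c by (auto simp: C.m_closed)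
    obtain z where z: "z \<in> carrier S" and Dx: "D (i x) = i e \<odot>\<^bsub>L\<^esub> D (i z)"
      using D_split[OF x e] by blast
    obtain d l where d: "d \<in> C" and l: "l \<in> carrier K" and dl: "i d \<odot>\<^bsub>L\<^esub> D (i z) = j l"
      using L_fraction[of "D (i z)"] z by auto
    \<comment> \<open>The modulus is \<open>c d\<close> and not \<open>c\<close>, because
      \<open>D z\<close> may have the denominator \<open>d\<close>: the error
      \<open>c v (d D(z))\<close> is then \<open>c\<close> times an element of
      \<open>K\<close>.\<close>
    obtain u v where uv: "u \<in> carrier S" "v \<in> carrier S" and a_eq: "a = u \<oplus> (c \<otimes> d) \<otimes> v"
      and Du: "D (i u) = \<zero>\<^bsub>L\<^esub>"
      using split_const[OF a C.m_closed[OF c d]] by blast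
    have cl: "i c \<in> carrier B" "i d \<in> carrier B" "i e \<in> carrier B" "i a \<in> carrier B" "i u \<in> carrier B"
      "i v \<in> carrier B" "i z \<in> carrier B" "j k \<in> carrier L" "j l \<in> carrier L" "D (i z) \<in> carrier L"
      using c d e a uv z k l by simp_all
    have "\<xi> = i e \<odot>\<^bsub>L\<^esub> (D (i z) \<oplus>\<^bsub>L\<^esub> i c \<odot>\<^bsub>L\<^esub> j k)"
      unfolding \<xi>_eq Dx using cl c e by (simp add: L.smult_r_distr L.smult_assoc1)
    then have "b \<odot>\<^bsub>L\<^esub> \<xi> = i a \<odot>\<^bsub>L\<^esub> (D (i z) \<oplus>\<^bsub>L\<^esub> i c \<odot>\<^bsub>L\<^esub> j k)"
      using cl b by (simp add: L.smult_assoc1[symmetric] L.R.m_comm[of b] ea[symmetric])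
    also have "\<dots> = i a \<odot>\<^bsub>L\<^esub> D (i z) \<oplus>\<^bsub>L\<^esub> i c \<odot>\<^bsub>L\<^esub> (i a \<odot>\<^bsub>L\<^esub> j k)"
      using cl by (simp add: L.smult_r_distr L.smult_assoc1[symmetric] L.R.m_comm)
    also have "i a \<odot>\<^bsub>L\<^esub> D (i z) = i u \<odot>\<^bsub>L\<^esub> D (i z) \<oplus>\<^bsub>L\<^esub> i c \<odot>\<^bsub>L\<^esub> (i v \<odot>\<^bsub>L\<^esub> (i d \<odot>\<^bsub>L\<^esub> D (i z)))"
      using cl c d uv by (simp add: a_eq L.smult_l_distr L.smult_assoc1[symmetric] L.R.m_ac)
    also have "\<dots> = D (i (u \<otimes> z)) \<oplus>\<^bsub>L\<^esub> i c \<odot>\<^bsub>L\<^esub> (i v \<odot>\<^bsub>L\<^esub> j l)"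
      using cl uv z by (simp add: D_mult_const Du dl)
    also have "\<dots> \<oplus>\<^bsub>L\<^esub> i c \<odot>\<^bsub>L\<^esub> (i a \<odot>\<^bsub>L\<^esub> j k) =
        D (i (u \<otimes> z)) \<oplus>\<^bsub>L\<^esub> i c \<odot>\<^bsub>L\<^esub> j (v \<odot>\<^bsub>K\<^esub> l \<oplus>\<^bsub>K\<^esub> a \<odot>\<^bsub>K\<^esub> k)"
      using cl uv z a k l by (simp add: j_smult L.M.a_assoc L.smult_r_distr)
    finally show ?thesis
      using uv z a k l by (intro bexI[of _ "u \<otimes> z"] bexI[of _ "v \<odot>\<^bsub>K\<^esub> l \<oplus>\<^bsub>K\<^esub> a \<odot>\<^bsub>K\<^esub> k"]) auto
  qed
  then show ?thesis
    using b \<xi>L by (simp add: approx_def)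
qed

lemma submodule_approx: "submodule approx B L"
proof (rule L.submoduleI)
  show "approx \<subseteq> carrier L"
    by (auto simp: approx_def)
  have zero: "\<zero>\<^bsub>L\<^esub> = D (i \<zero>) \<oplus>\<^bsub>L\<^esub> i c \<odot>\<^bsub>L\<^esub> j \<zero>\<^bsub>K\<^esub>" if "c \<in> C" for c
    using that by simp
  then show "\<zero>\<^bsub>L\<^esub> \<in> approx"
    unfolding approx_def by blast
  show "\<xi> \<oplus>\<^bsub>L\<^esub> \<eta> \<in> approx" if \<xi>: "\<xi> \<in> approx" and \<eta>: "\<eta> \<in> approx" for \<xi> \<eta>
  proof -
    have "\<exists>x\<in>carrier S. \<exists>k\<in>carrier K. \<xi> \<oplus>\<^bsub>L\<^esub> \<eta> = D (i x) \<oplus>\<^bsub>L\<^esub> i c \<odot>\<^bsub>L\<^esub> j k" if c: "c \<in> C" for c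
    proof -
      obtain x k y l where x: "x \<in> carrier S" "k \<in> carrier K" "y \<in> carrier S" "l \<in> carrier K"
        and eq: "\<xi> = D (i x) \<oplus>\<^bsub>L\<^esub> i c \<odot>\<^bsub>L\<^esub> j k" "\<eta> = D (i y) \<oplus>\<^bsub>L\<^esub> i c \<odot>\<^bsub>L\<^esub> j l"
        using \<xi> \<eta> c unfolding approx_def by blast
      have "\<xi> \<oplus>\<^bsub>L\<^esub> \<eta> = D (i (x \<oplus> y)) \<oplus>\<^bsub>L\<^esub> i c \<odot>\<^bsub>L\<^esub> j (k \<oplus>\<^bsub>K\<^esub> l)"
        unfolding eq using x c by (simp add: L.smult_r_distr L.M.a_ac)
      then show ?thesis
        using x by blast
    qed
    then show ?thesis
      using \<xi> \<eta> by (simp add: approx_def)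
  qed
  show smult: "b \<odot>\<^bsub>L\<^esub> \<xi> \<in> approx" if "b \<in> carrier B" "\<xi> \<in> approx" for b \<xi>
    by (rule approx_smult[OF that])
  show "\<ominus>\<^bsub>L\<^esub> \<xi> \<in> approx" if "\<xi> \<in> approx" for \<xi>
    using smult[of "\<ominus>\<^bsub>B\<^esub> \<one>\<^bsub>B\<^esub>" \<xi>] that \<open>approx \<subseteq> carrier L\<close> by (auto simp: L.smult_l_minus subset_iff)
qed

text \<open>Passing to \<open>B\<close> creates no new values of \<open>D\<close>: if
  \<open>d b = s\<close> and \<open>D s = d D(z)\<close>, cancelling \<open>d\<close> gives
  \<open>D b = D z\<close>. A value on \<open>S\<close> is its own approximation, with error
  zero.\<close>

lemma D_in_approx:
  assumes b: "b \<in> carrier B"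
  shows "D b \<in> approx"
proof -
  obtain d s where d: "d \<in> C" and s: "s \<in> carrier S" and ds: "i d \<otimes>\<^bsub>B\<^esub> b = i s"
    using B_fraction[OF b] by blast
  obtain z where z: "z \<in> carrier S" and Ds: "D (i s) = i d \<odot>\<^bsub>L\<^esub> D (i z)"
    using D_split[OF s d] by blast
  have "i d \<odot>\<^bsub>L\<^esub> D b = i d \<odot>\<^bsub>L\<^esub> D (i z)"
    using D_mult_C[OF d b] Ds ds by simp
  then have "D b = D (i z)"
    using L_cancel[OF d] b z by simp
  then have "D b = D (i z) \<oplus>\<^bsub>L\<^esub> i c \<odot>\<^bsub>L\<^esub> j \<zero>\<^bsub>K\<^esub>" if "c \<in> C" for c
    using that z by simp
  then have "\<forall>c\<in>C. \<exists>x\<in>carrier S. \<exists>k\<in>carrier K. D b = D (i x) \<oplus>\<^bsub>L\<^esub> i c \<odot>\<^bsub>L\<^esub> j k"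
    using z K.M.zero_closed by (intro ballI bexI[of _ z] bexI[of _ "\<zero>\<^bsub>K\<^esub>"])
  then show ?thesis
    unfolding approx_def mem_Collect_eq using D_closed[OF b] by (rule conjI[rotated])
qed

lemma carrier_approx: "carrier L = approx"
proof -
  have "module_span B L (D ` carrier B) \<subseteq> approx"
    unfolding module_span_def using D_in_approx submodule_approx by (intro hull_minimal) auto
  then show ?thesis
    using span by (auto simp: approx_def)
qed

section \<open>The graph of \<open>D\<close> as a ring homomorphism, and the analytic
  isomorphism\<close>

abbreviation f :: "'s \<Rightarrow> 's \<times> 'k"
  where "f \<equiv> graph_map K i j D"

definition d :: "'s \<Rightarrow> 'k"
  where "d r = (THE k. k \<in> carrier K \<and> j k = D (i r))"

lemma f_eq: "f r = (r, d r)"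
  by (simp add: graph_map_def d_def)

lemma d_eqI:
  assumes "k \<in> carrier K" "j k = D (i r)"
  shows "d r = k"
  unfolding d_def using assms inj_onD[OF j_inj] by (intro the_equality) auto

lemma R_closed: "r \<in> R \<Longrightarrow> r \<in> carrier S"
  using R_eq by blast

lemma RI: "\<lbrakk>s \<in> carrier S; k \<in> carrier K; j k = D (i s)\<rbrakk> \<Longrightarrow> s \<in> R"
  unfolding R_eq by (auto intro: image_eqI[of _ j k])

lemma
  assumes "r \<in> R"
  shows d_closed: "d r \<in> carrier K" and j_d: "j (d r) = D (i r)"
proof -
  obtain k where "k \<in> carrier K" "j k = D (i r)"
    using assms unfolding R_eq by force
  then show "d r \<in> carrier K" "j (d r) = D (i r)"
    using d_eqI by auto
qed

lemma d_const:
  assumes "s \<in> carrier S" "D (i s) = \<zero>\<^bsub>L\<^esub>"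
  shows "s \<in> R" "d s = \<zero>\<^bsub>K\<^esub>"
  using assms by (auto intro: RI[of _ "\<zero>\<^bsub>K\<^esub>"] d_eqI)

lemma C_subset: "c \<in> C \<Longrightarrow> c \<in> R" and d_C: "c \<in> C \<Longrightarrow> d c = \<zero>\<^bsub>K\<^esub>"
  using d_const D_C by simp_all

lemma d_add:
  assumes "r \<in> R" "s \<in> R"
  shows "d (r \<oplus> s) = d r \<oplus>\<^bsub>K\<^esub> d s"
  using assms by (intro d_eqI) (auto simp: j_d d_closed R_closed)

lemma d_mult:
  assumes "r \<in> R" "s \<in> R"
  shows "d (r \<otimes> s) = r \<odot>\<^bsub>K\<^esub> d s \<oplus>\<^bsub>K\<^esub> s \<odot>\<^bsub>K\<^esub> d r"
  using assms by (intro d_eqI) (auto simp: j_d d_closed R_closed j_smult D_mult)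

abbreviation A where "A \<equiv> S\<lparr>carrier := R\<rparr>"
abbreviation E where "E \<equiv> idealization S K"

lemma A_simps: "carrier A = R" "a \<otimes>\<^bsub>A\<^esub> b = a \<otimes> b" "\<zero>\<^bsub>A\<^esub> = \<zero>"
  by simp_all

lemma ring_hom_cring_f: "ring_hom_cring A E f"
proof (intro ring_hom_cring.intro ring_hom_cring_axioms.intro)
  show "cring A"
    using K.R.subcring_iff[of R] K.R.subcringI'[OF subring_R] R_closed by blast
  show "cring E"
    by (rule K.cring_idealization)
  show "f \<in> ring_hom A E"
    using K.R.one_closed
    by (intro ring_hom_memI) (auto simp: f_eq R_closed d_closed d_add d_mult d_C C.one_closed)
qed

lemma f_C_mult:
  assumes "c \<in> C" "s \<in> carrier S" "k \<in> carrier K"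
  shows "f c \<otimes>\<^bsub>E\<^esub> (s, k) = (c \<otimes> s, c \<odot>\<^bsub>K\<^esub> k)"
  using assms by (simp add: f_eq d_C)

text \<open>For a target \<open>(s, k)\<close>, first match the second component: \<open>k\<close>
  is \<open>D x\<close> up to \<open>c K\<close>. Adding a constant \<open>w\<close> leaves the
  derivative alone and can be used to bring \<open>x\<close> to \<open>s\<close> modulo
  \<open>c S\<close>. The sum \<open>x + w\<close> lies in \<open>R\<close> because its derivative,
  \<open>k - c l\<close>, lies in \<open>K\<close>.\<close>

lemma f_onto_mod:
  assumes y: "y \<in> carrier E" and c: "c \<in> C"
  shows "\<exists>r\<in>R. \<exists>z\<in>carrier E. y = f r \<oplus>\<^bsub>E\<^esub> f c \<otimes>\<^bsub>E\<^esub> z"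
proof -
  obtain s k where y_eq: "y = (s, k)" and s: "s \<in> carrier S" and k: "k \<in> carrier K"
    using y by auto
  have "j k \<in> approx"
    using j.hom_closed[OF k] by (simp only: carrier_approx)
  then obtain x l where x: "x \<in> carrier S" and l: "l \<in> carrier K" and jk: "j k = D (i x) \<oplus>\<^bsub>L\<^esub> i c \<odot>\<^bsub>L\<^esub> j l"
    using c unfolding approx_def by blast
  \<comment> \<open>The difference \<open>s - x\<close>, not \<open>s\<close>, is split, so that the
    correction of the first component is a constant.\<close>
  obtain w z where w: "w \<in> carrier S" and z: "z \<in> carrier S" and s_eq: "s \<ominus> x = w \<oplus> c \<otimes> z"
    and Dw: "D (i w) = \<zero>\<^bsub>L\<^esub>"
    using split_const[OF K.R.minus_closed[OF s x] c] by blast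
  have "j (k \<ominus>\<^bsub>K\<^esub> c \<odot>\<^bsub>K\<^esub> l) = D (i x)"
    using x k l c by (simp add: K.M.minus_eq jk j_smult L.M.a_assoc L.M.r_neg)
  then have Dr: "j (k \<ominus>\<^bsub>K\<^esub> c \<odot>\<^bsub>K\<^esub> l) = D (i (x \<oplus> w))"
    using x w Dw by simp
  have r: "x \<oplus> w \<in> R" and dr: "d (x \<oplus> w) = k \<ominus>\<^bsub>K\<^esub> c \<odot>\<^bsub>K\<^esub> l"
    by (rule RI[OF _ _ Dr], use x w k l c in simp_all) (rule d_eqI[OF _ Dr], use k l c in simp)
  have "s = x \<oplus> (s \<ominus> x)"
    using s x by (simp add: K.R.minus_eq K.R.a_lcomm K.R.r_neg)
  then have "s = x \<oplus> w \<oplus> c \<otimes> z"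
    unfolding s_eq using x w z c by (simp add: K.R.a_assoc)
  moreover have "k = (k \<ominus>\<^bsub>K\<^esub> c \<odot>\<^bsub>K\<^esub> l) \<oplus>\<^bsub>K\<^esub> c \<odot>\<^bsub>K\<^esub> l"
    using k l c by (simp add: K.M.minus_eq K.M.a_assoc K.M.l_neg)
  ultimately have "y = f (x \<oplus> w) \<oplus>\<^bsub>E\<^esub> f c \<otimes>\<^bsub>E\<^esub> (z, l)"
    using f_C_mult[OF c z l] by (simp add: y_eq f_eq dr)
  then show ?thesis
    using r z l by (intro bexI[of _ "x \<oplus> w"] bexI[of _ "(z, l)"]) auto
qed

text \<open>Since D(c s) = c D(s) and \<open>c\<close> acts invertibly on \<open>L\<close>, the
  second component of \<open>y\<close> must be the derivative of the first, so \<open>y\<close> lies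
  on the graph. This serves both the injectivity modulo \<open>c\<close> and the torsion-freeness of
  the cokernel.\<close>

lemma f_divide:
  assumes c: "c \<in> C" and r: "r \<in> R" and y: "y \<in> carrier E" and eq: "f r = f c \<otimes>\<^bsub>E\<^esub> y"
  shows "\<exists>s\<in>R. y = f s \<and> r = c \<otimes> s"
proof -
  obtain s k where y_eq: "y = (s, k)" and s: "s \<in> carrier S" and k: "k \<in> carrier K"
    using y by auto
  have "f r = (c \<otimes> s, c \<odot>\<^bsub>K\<^esub> k)"
    using eq f_C_mult[OF c s k] by (simp only: y_eq)
  then have r_eq: "r = c \<otimes> s" and dr: "d r = c \<odot>\<^bsub>K\<^esub> k"
    unfolding f_eq by blast+
  have "i c \<odot>\<^bsub>L\<^esub> j k = j (d r)"
    using c k by (simp add: dr j_smult)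
  also have "\<dots> = D (i c \<otimes>\<^bsub>B\<^esub> i s)"
    unfolding j_d[OF r] unfolding r_eq using c s by simp
  also have "\<dots> = i c \<odot>\<^bsub>L\<^esub> D (i s)"
    using c s by (simp add: D_mult_C)
  finally have jk: "j k = D (i s)"
    using L_cancel[OF c] k s by simp
  have "s \<in> R" "y = f s"
    using RI[OF s k jk] d_eqI[OF k jk] by (simp_all add: f_eq y_eq)
  then show ?thesis
    using r_eq by blast
qed

text \<open>Elements of \<open>C\<close> act invertibly on \<open>B\<close> and \<open>L\<close>,
  into which \<open>S\<close> and \<open>K\<close> embed, and \<open>f c\<close> is
  \<open>(c, 0)\<close>.\<close>

lemma f_C_nonzerodivisor: "f ` C \<subseteq> nonzerodivisors E"
proof (rule image_subsetI)
  fix c assume c: "c \<in> C"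
  have S0: "s = \<zero>" if "s \<in> carrier S" "c \<otimes> s = \<zero>" for s
  proof -
    obtain b where b: "b \<in> carrier B" "i c \<otimes>\<^bsub>B\<^esub> b = \<one>\<^bsub>B\<^esub>"
      using C_unit[OF c] by blast
    have "i s = b \<otimes>\<^bsub>B\<^esub> i (c \<otimes> s)"
      using b c that(1) L.R.m_comm[of "i c" b] by (simp add: L.R.m_assoc[symmetric])
    then have "i s = i \<zero>"
      using b that by simp
    then show ?thesis
      using inj_onD[OF i_inj] that by auto
  qed
  have K0: "k = \<zero>\<^bsub>K\<^esub>" if "k \<in> carrier K" "c \<odot>\<^bsub>K\<^esub> k = \<zero>\<^bsub>K\<^esub>" for k
  proof -
    have "i c \<odot>\<^bsub>L\<^esub> j k = i c \<odot>\<^bsub>L\<^esub> j \<zero>\<^bsub>K\<^esub>"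
      using c that(1) by (simp add: j_smult[symmetric] that(2))
    then have "j k = j \<zero>\<^bsub>K\<^esub>"
      using L_cancel[OF c] that(1) by simp
    then show ?thesis
      using inj_onD[OF j_inj] that(1) K.M.zero_closed by blast
  qed
  show "f c \<in> nonzerodivisors E"
    using c S0 K0 unfolding nonzerodivisors_def by (auto simp: f_eq d_C)
qed

lemma analytic_iso: "analytic_iso_along A E C f"
  unfolding analytic_iso_along_def
proof (intro conjI)
  show "ring_hom_cring A E f" "f ` C \<subseteq> nonzerodivisors E"
    by (rule ring_hom_cring_f, rule f_C_nonzerodivisor)
  show "submonoid C A"
    using C_subset C.m_closed C.one_closed by (auto simp: submonoid_def)
  show "\<forall>c\<in>C. induced_quotient_map E (PIdl\<^bsub>E\<^esub> (f c)) f
      \<in> ring_iso (A Quot (PIdl\<^bsub>A\<^esub> c)) (E Quot (PIdl\<^bsub>E\<^esub> (f c)))"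
  proof (intro ballI induced_quotient_iso ring_hom_cring_f)
    fix c assume c: "c \<in> C"
    show "c \<in> carrier A"
      using C_subset c by simp
    show "\<exists>r\<in>carrier A. \<exists>z\<in>carrier E. y = f r \<oplus>\<^bsub>E\<^esub> f c \<otimes>\<^bsub>E\<^esub> z" if "y \<in> carrier E" for y
      using f_onto_mod[OF that c] by simp
    show "\<exists>a'\<in>carrier A. a = c \<otimes>\<^bsub>A\<^esub> a'"
      if "a \<in> carrier A" "z \<in> carrier E" "f a = f c \<otimes>\<^bsub>E\<^esub> z" for a z
      using f_divide[OF c _ that(2,3)] that(1) by auto
  qed
qed

text \<open>\<open>divisible_cokernel\<close> is applied with the unit of \<open>E\<close> as
  \<open>u\<close>. Divisibility and torsion-freeness along \<open>C\<close> are known; they extend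
  to every nonzero \<open>a\<close> of \<open>R\<close> by replacing \<open>a\<close> with a
  multiple \<open>t a\<close> in \<open>C\<close>, where \<open>t\<close> is taken from
  \<open>R\<close> so that \<open>f t\<close> makes sense as a factor.\<close>

lemma faithfully_flat_hom:
  assumes "domain S" and multiple: "\<And>s. \<lbrakk>s \<in> carrier S; s \<noteq> \<zero>\<rbrakk> \<Longrightarrow> \<exists>t\<in>carrier S. t \<otimes> s \<in> C"
  shows "faithfully_flat_hom t1 t2 t3 A E f"
proof -
  interpret S: domain S by fact
  interpret f: ring_hom_cring A E f by (rule ring_hom_cring_f)
  have multiple_R: "\<exists>t\<in>R. t \<otimes> s \<in> C" if s: "s \<in> carrier S" "s \<noteq> \<zero>" for s
  proof -
    obtain t where t: "t \<in> carrier S" "t \<otimes> s \<in> C"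
      using multiple[OF s] by blast
    \<comment> \<open>\<open>t\<close> itself may lie outside \<open>R\<close>; multiplying it by a
      constant \<open>c\<close> that clears the denominator of \<open>D t\<close> moves it into
      \<open>R\<close> and keeps \<open>t s\<close> in \<open>C\<close>.\<close>
    obtain c k where c: "c \<in> C" and k: "k \<in> carrier K" and ck: "i c \<odot>\<^bsub>L\<^esub> D (i t) = j k"
      using L_fraction[of "D (i t)"] t by auto
    have "c \<otimes> t \<in> R"
      using c k t ck D_mult_C[OF c, of "i t"] by (intro RI[of _ k]) auto
    moreover have "(c \<otimes> t) \<otimes> s \<in> C"
      using C.m_closed[OF c t(2)] c t(1) s by (simp add: K.R.m_assoc)
    ultimately show ?thesis by blast
  qed
  interpret E: module A "restrict_scalars f E"
    by (rule module_restrict_scalars[OF ring_hom_cring_f])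
  interpret divisible_cokernel A "restrict_scalars f E" "\<one>\<^bsub>E\<^esub>"
  proof (intro divisible_cokernel.intro divisible_cokernel_axioms.intro E.module_axioms
      S.subring_is_domain subring_R)
    show "\<one>\<^bsub>E\<^esub> \<in> carrier (restrict_scalars f E)"
      using f.S.one_closed by (simp only: restrict_scalars_simps)
    show "a = \<zero>\<^bsub>A\<^esub>" if "a \<in> carrier A" "a \<odot>\<^bsub>restrict_scalars f E\<^esub> \<one>\<^bsub>E\<^esub> = \<zero>\<^bsub>restrict_scalars f E\<^esub>" for a
      using that by (simp add: f_eq R_closed)
    fix a y assume a: "a \<in> carrier A" "a \<noteq> \<zero>\<^bsub>A\<^esub>" and "y \<in> carrier (restrict_scalars f E)"
    then have y: "y \<in> carrier E" and aR: "a \<in> R"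
      by simp_all
    obtain t where t: "t \<in> R" "t \<otimes> a \<in> C"
      using multiple_R[of a] a R_closed by auto
    have f_ta: "f (t \<otimes> a) = f t \<otimes>\<^bsub>E\<^esub> f a"
      using f.hom_mult[of t a] t(1) aR unfolding A_simps by blast
    have ft: "f t \<in> carrier E" and fa: "f a \<in> carrier E"
      using f.hom_closed t(1) aR by simp_all
    \<comment> \<open>Division by \<open>t a\<close> yields division by \<open>a\<close>: the factor
      \<open>f t\<close> goes into the quotient.\<close>
    show "\<exists>r\<in>carrier A. \<exists>m'\<in>carrier (restrict_scalars f E).
        y = r \<odot>\<^bsub>restrict_scalars f E\<^esub> \<one>\<^bsub>E\<^esub> \<oplus>\<^bsub>restrict_scalars f E\<^esub> a \<odot>\<^bsub>restrict_scalars f E\<^esub> m'"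
    proof -
      obtain r z where r: "r \<in> R" and z: "z \<in> carrier E" and y_eq: "y = f r \<oplus>\<^bsub>E\<^esub> f (t \<otimes> a) \<otimes>\<^bsub>E\<^esub> z"
        using f_onto_mod[OF y t(2)] by blast
      have fr: "f r \<in> carrier E"
        using f.hom_closed r by simp
      have "y = f r \<otimes>\<^bsub>E\<^esub> \<one>\<^bsub>E\<^esub> \<oplus>\<^bsub>E\<^esub> f a \<otimes>\<^bsub>E\<^esub> (f t \<otimes>\<^bsub>E\<^esub> z)"
        unfolding y_eq f_ta f.S.r_one[OF fr] f.S.m_comm[OF ft fa] f.S.m_assoc[OF fa ft z] ..
      then show ?thesis
        using r f.S.m_closed[OF ft z] unfolding restrict_scalars_simps A_simps by blast
    qed
    show "\<exists>r'\<in>carrier A. y = r' \<odot>\<^bsub>restrict_scalars f E\<^esub> \<one>\<^bsub>E\<^esub>"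
      if "r \<in> carrier A" "a \<odot>\<^bsub>restrict_scalars f E\<^esub> y = r \<odot>\<^bsub>restrict_scalars f E\<^esub> \<one>\<^bsub>E\<^esub>" for r
    proof -
      have r: "r \<in> R"
        using that(1) by simp
      have fr: "f r \<in> carrier E"
        using f.hom_closed r by simp
      have "f (t \<otimes> r) = f t \<otimes>\<^bsub>E\<^esub> f r"
        using f.hom_mult[of t r] t(1) r unfolding A_simps by blast
      also have "f r = f a \<otimes>\<^bsub>E\<^esub> y"
        using that(2) f.S.r_one[OF fr] unfolding restrict_scalars_simps by simp
      also have "f t \<otimes>\<^bsub>E\<^esub> (f a \<otimes>\<^bsub>E\<^esub> y) = f (t \<otimes> a) \<otimes>\<^bsub>E\<^esub> y"
        unfolding f_ta f.S.m_assoc[OF ft fa y] ..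
      finally obtain s where s: "s \<in> R" "y = f s"
        using f_divide[OF t(2) _ y, of "t \<otimes> r"] t(1) r subringE(6)[OF subring_R] by blast
      have "y = f s \<otimes>\<^bsub>E\<^esub> \<one>\<^bsub>E\<^esub>"
        using f.S.r_one[OF y] s(2) by simp
      then show ?thesis
        using s(1) unfolding restrict_scalars_simps A_simps by blast
    qed
  qed
  show ?thesis
    unfolding faithfully_flat_hom_def using ring_hom_cring_f faithfully_flat by blast
qed

end

section \<open>The two kinds of twists\<close>

context scalar_extension
begin

abbreviation ext_map :: "'n \<Rightarrow> ('b \<times> 'n \<Rightarrow>\<^sub>0 int) set"
  where "ext_map \<equiv> extend_scalars_map A B f N"

lemma extend_scalars_map_eq: "ext_map n = pure_tensor \<one>\<^bsub>B\<^esub> n"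
  by (simp add: extend_scalars_map_def)

lemma extend_scalars_map_hom: "abelian_group_hom N BN ext_map"
proof -
  interpret BN: module B BN by (rule module_extend_scalars)
  show ?thesis
    using pure_tensor_closed[of "\<one>\<^bsub>B\<^esub>"] pure_tensor_add_right[of "\<one>\<^bsub>B\<^esub>"]
    by (intro abelian_group_homI' N.abelian_group_axioms BN.abelian_group_axioms)
      (simp_all add: extend_scalars_map_eq extend_scalars_simps(1,2))
qed

lemma extend_scalars_map_smult:
  assumes "a \<in> carrier A" "n \<in> carrier N"
  shows "ext_map (a \<odot>\<^bsub>N\<^esub> n) = f a \<odot>\<^bsub>BN\<^esub> ext_map n"
  using assms pure_tensor_smult[of a "\<one>\<^bsub>B\<^esub>" n]
  by (simp add: extend_scalars_map_eq smult_pure)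

end

context localization
begin

lemma scalar_extension_loc_ring: "scalar_extension S B i K"
  by (intro scalar_extension.intro ring_hom_cring_loc_ring_map module_axioms)

interpretation ext: scalar_extension S B i K
  by (rule scalar_extension_loc_ring)

text \<open>The map b \<otimes> k \<mapsto> b j(k) into the module of fractions turns the canonical
  map of \<open>K\<close> into \<open>j\<close>, which is injective for torsion-free
  \<open>K\<close>.\<close>

lemma extend_scalars_loc_inj:
  assumes "torsion_free_along C K"
  shows "inj_on ext.ext_map (carrier K)"
proof -
  obtain h where h: "\<And>b k. \<lbrakk>b \<in> carrier B; k \<in> carrier K\<rbrakk> \<Longrightarrow> h (ext.pure_tensor b k) = b \<odot>\<^bsub>L\<^esub> j k"
  proof (rule ext.tensor_universal[of L "\<lambda>b k. b \<odot>\<^bsub>L\<^esub> j k"])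
    show "abelian_group L" by (rule abelian_group_loc_module)
    show "(r \<odot>\<^bsub>restrict_scalars i B\<^esub> b) \<odot>\<^bsub>L\<^esub> j k = b \<odot>\<^bsub>L\<^esub> j (r \<odot>\<^bsub>K\<^esub> k)"
      if "r \<in> carrier S" "b \<in> carrier (restrict_scalars i B)" "k \<in> carrier K" for r b k
      using that ext.f.hom_closed[OF that(1)] self.L.R.m_comm[of "i r" b]
      by (simp add: loc_module_map_smult L.smult_assoc1[symmetric] loc_module_map_closed)
  qed (auto simp: loc_module_map_closed loc_module_map_add L.smult_l_distr L.smult_r_distr)
  show ?thesis
  proof (rule inj_onI)
    fix k l assume kl: "k \<in> carrier K" "l \<in> carrier K" "ext.ext_map k = ext.ext_map l"
    then have "\<one>\<^bsub>B\<^esub> \<odot>\<^bsub>L\<^esub> j k = \<one>\<^bsub>B\<^esub> \<odot>\<^bsub>L\<^esub> j l"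
      unfolding ext.extend_scalars_map_eq using h[of "\<one>\<^bsub>B\<^esub>"] self.L.R.one_closed by metis
    then show "k = l"
      using inj_onD[OF loc_module_map_inj[OF assms]] kl(1,2) by (simp add: loc_module_map_closed)
  qed
qed

text \<open>A denominator of \<open>b\<close> clears b \<otimes> k, and the product of two
  denominators clears a difference.\<close>

lemma extend_scalars_loc_fraction:
  assumes "\<xi> \<in> carrier ext.BN"
  shows "\<exists>c\<in>C. \<exists>k\<in>carrier K. i c \<odot>\<^bsub>ext.BN\<^esub> \<xi> = ext.ext_map k"
proof -
  interpret BN: module B ext.BN by (rule ext.module_extend_scalars)
  interpret j: abelian_group_hom K ext.BN ext.ext_map by (rule ext.extend_scalars_map_hom)
  \<comment> \<open>\<open>BN\<close> and \<open>T\<close> are different records with the same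
    carrier, zero and addition, hence with the same subtraction; the induction speaks of
    \<open>T\<close>, the module laws of \<open>BN\<close>.\<close>
  have BN_diff: "\<xi> \<ominus>\<^bsub>ext.BN\<^esub> \<eta> = \<xi> \<ominus>\<^bsub>ext.T\<^esub> \<eta>" for \<xi> \<eta>
    by (simp add: a_minus_def a_inv_def m_inv_def ext.extend_scalars_simps)
  have "\<xi> \<in> carrier ext.T"
    using assms by (simp only: ext.extend_scalars_simps)
  then show ?thesis
  proof (rule ext.tensor_induct[where P = "\<lambda>\<xi>. \<exists>c\<in>C. \<exists>k\<in>carrier K. i c \<odot>\<^bsub>ext.BN\<^esub> \<xi> = ext.ext_map k"])
    have "i \<one> \<odot>\<^bsub>ext.BN\<^esub> \<zero>\<^bsub>ext.BN\<^esub> = ext.ext_map \<zero>\<^bsub>K\<^esub>"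
      by simp
    then show "\<exists>c\<in>C. \<exists>k\<in>carrier K. i c \<odot>\<^bsub>ext.BN\<^esub> \<zero>\<^bsub>ext.T\<^esub> = ext.ext_map k"
      unfolding ext.extend_scalars_simps(3) using C.one_closed M.zero_closed by blast
  next
    fix b k assume "b \<in> carrier (restrict_scalars i B)" and k: "k \<in> carrier K"
    then have b: "b \<in> carrier B" by simp
    obtain c s where c: "c \<in> C" and s: "s \<in> carrier S" and cb: "i c \<otimes>\<^bsub>B\<^esub> b = i s"
      using loc_ring_fraction[OF b] by blast
    have "i c \<odot>\<^bsub>ext.BN\<^esub> ext.pure_tensor b k = ext.pure_tensor (i s) k"
      using ext.smult_pure[OF ext.f.hom_closed[OF C_closed[OF c]] b k] by (simp only: cb)
    also have "\<dots> = i s \<odot>\<^bsub>ext.BN\<^esub> ext.ext_map k"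
      unfolding ext.extend_scalars_map_eq
      using ext.smult_pure[of "i s" "\<one>\<^bsub>B\<^esub>" k] ext.f.hom_closed[OF s] k self.L.R.one_closed self.L.R.r_one[of "i s"] by metis
    also have "\<dots> = ext.ext_map (s \<odot>\<^bsub>K\<^esub> k)"
      by (rule ext.extend_scalars_map_smult[OF s k, symmetric])
    finally show "\<exists>c\<in>C. \<exists>k'\<in>carrier K. i c \<odot>\<^bsub>ext.BN\<^esub> ext.pure_tensor b k = ext.ext_map k'"
      using c smult_closed[OF s k] by blast
  next
    fix \<xi> \<eta> assume "\<xi> \<in> carrier ext.T" "\<eta> \<in> carrier ext.T"
      and "\<exists>c\<in>C. \<exists>k\<in>carrier K. i c \<odot>\<^bsub>ext.BN\<^esub> \<xi> = ext.ext_map k"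
      and "\<exists>c\<in>C. \<exists>k\<in>carrier K. i c \<odot>\<^bsub>ext.BN\<^esub> \<eta> = ext.ext_map k"
    then obtain c k d l where c: "c \<in> C" "k \<in> carrier K" "i c \<odot>\<^bsub>ext.BN\<^esub> \<xi> = ext.ext_map k"
      and d: "d \<in> C" "l \<in> carrier K" "i d \<odot>\<^bsub>ext.BN\<^esub> \<eta> = ext.ext_map l"
      and cl: "\<xi> \<in> carrier ext.BN" "\<eta> \<in> carrier ext.BN"
      unfolding ext.extend_scalars_simps(1) by blast
    have icd: "i c \<in> carrier B" "i d \<in> carrier B"
      using c(1) d(1) by simp_all
    have "i (c \<otimes> d) \<odot>\<^bsub>ext.BN\<^esub> (\<xi> \<ominus>\<^bsub>ext.BN\<^esub> \<eta>) =
        i d \<odot>\<^bsub>ext.BN\<^esub> (i c \<odot>\<^bsub>ext.BN\<^esub> \<xi>) \<ominus>\<^bsub>ext.BN\<^esub> i c \<odot>\<^bsub>ext.BN\<^esub> (i d \<odot>\<^bsub>ext.BN\<^esub> \<eta>)"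
      using c(1) d(1) icd cl self.L.R.m_comm[OF icd]
      by (simp add: BN.M.minus_eq BN.smult_r_distr BN.smult_r_minus BN.smult_assoc1[symmetric])
    also have "\<dots> = ext.ext_map (d \<odot>\<^bsub>K\<^esub> k \<ominus>\<^bsub>K\<^esub> c \<odot>\<^bsub>K\<^esub> l)"
      unfolding c(3) d(3) using c(1,2) d(1,2)
      by (simp add: M.minus_eq BN.M.minus_eq ext.extend_scalars_map_smult)
    finally have eq: "i (c \<otimes> d) \<odot>\<^bsub>ext.BN\<^esub> (\<xi> \<ominus>\<^bsub>ext.T\<^esub> \<eta>) = ext.ext_map (d \<odot>\<^bsub>K\<^esub> k \<ominus>\<^bsub>K\<^esub> c \<odot>\<^bsub>K\<^esub> l)"
      unfolding BN_diff .
    moreover have "d \<odot>\<^bsub>K\<^esub> k \<ominus>\<^bsub>K\<^esub> c \<odot>\<^bsub>K\<^esub> l \<in> carrier K"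
      using c(1,2) d(1,2) by simp
    ultimately show "\<exists>c\<in>C. \<exists>k\<in>carrier K. i c \<odot>\<^bsub>ext.BN\<^esub> (\<xi> \<ominus>\<^bsub>ext.T\<^esub> \<eta>) = ext.ext_map k"
      using C.m_closed[OF c(1) d(1)] by blast
  qed
qed

lemma twistingI:
  assumes "C \<subseteq> nonzerodivisors S" "torsion_free_along C K" "subring R S" "twists_along S C K R D"
  shows "twisting S K B L i j C R D"
proof (intro twisting.intro twisting_axioms.intro)
  show "abelian_group_hom K L j"
    by (intro abelian_group_homI' M.abelian_group_axioms abelian_group_loc_module
        loc_module_map_closed loc_module_map_add)
qed (use assms in \<open>simp_all add: module_axioms module_loc_module ring_hom_cring_loc_ring_map C.submonoid_axioms
    loc_ring_map_inj loc_module_map_inj loc_module_map_smult loc_ring_unit loc_ring_fraction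
    loc_module_fraction twists_along_def Let_def\<close>)

end

section \<open>Strong twists as twists along the nonzero constants\<close>

locale strong_twisting = S: domain S + K: module S K + L: module B L + i: ring_hom_cring S B i +
    j: abelian_group_hom K L j
  for S :: "('s, 'x) ring_scheme" (structure) and K :: "('s, 'k, 'y) module_scheme"
    and B :: "('b, 'x2) ring_scheme" and L :: "('b, 'l, 'y2) module_scheme" and i j +
  fixes R :: "'s set" and D :: "'b \<Rightarrow> 'l"
  assumes i_inj: "inj_on i (carrier S)" and j_inj: "inj_on j (carrier K)"
    and j_smult: "\<lbrakk>s \<in> carrier S; k \<in> carrier K\<rbrakk> \<Longrightarrow> j (s \<odot>\<^bsub>K\<^esub> k) = i s \<odot>\<^bsub>L\<^esub> j k"
    and unit: "c \<in> carrier S - {\<zero>} \<Longrightarrow> \<exists>b\<in>carrier B. i c \<otimes>\<^bsub>B\<^esub> b = \<one>\<^bsub>B\<^esub>"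
    and B_fraction: "b \<in> carrier B \<Longrightarrow> \<exists>c\<in>carrier S - {\<zero>}. \<exists>s\<in>carrier S. i c \<otimes>\<^bsub>B\<^esub> b = i s"
    and L_fraction: "\<xi> \<in> carrier L \<Longrightarrow> \<exists>c\<in>carrier S - {\<zero>}. \<exists>k\<in>carrier K. i c \<odot>\<^bsub>L\<^esub> \<xi> = j k"
    and derivation: "derivation B L D"
    and R_eq: "R = {s \<in> carrier S. D (i s) \<in> j ` carrier K}"
    and subring_R: "subring R S"
    and span: "module_span B L (D ` carrier B) = carrier L"
    and dense: "s \<in> carrier S - {\<zero>} \<Longrightarrow> i ` carrier S \<subseteq> a_kernel B L D <+>\<^bsub>B\<^esub> i ` (PIdl s)"
begin

text \<open>This is the set along which a strongly twisted subring is twisted. Unlike the set of all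
  nonzero elements, it consists of elements over which \<open>D\<close> is linear, as
  \<open>twisting\<close> demands.\<close>

definition constants :: "'s set"
  where "constants = {c \<in> carrier S. c \<noteq> \<zero> \<and> D (i c) = \<zero>\<^bsub>L\<^esub>}"

lemma D_mult: "\<lbrakk>b \<in> carrier B; b' \<in> carrier B\<rbrakk> \<Longrightarrow>
    D (b \<otimes>\<^bsub>B\<^esub> b') = b \<odot>\<^bsub>L\<^esub> D b' \<oplus>\<^bsub>L\<^esub> b' \<odot>\<^bsub>L\<^esub> D b"
  and D_closed: "b \<in> carrier B \<Longrightarrow> D b \<in> carrier L"
  using derivation by (auto simp: derivation_def)

lemma one_constants: "\<one> \<in> constants"
proof -
  have "D \<one>\<^bsub>B\<^esub> = D \<one>\<^bsub>B\<^esub> \<oplus>\<^bsub>L\<^esub> D \<one>\<^bsub>B\<^esub>"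
    using D_mult[of "\<one>\<^bsub>B\<^esub>" "\<one>\<^bsub>B\<^esub>"] D_closed[of "\<one>\<^bsub>B\<^esub>"] by simp
  then have "D \<one>\<^bsub>B\<^esub> = \<zero>\<^bsub>L\<^esub>"
    using D_closed[of "\<one>\<^bsub>B\<^esub>"] L.M.add.l_cancel_one' by (metis L.R.one_closed)
  then have "D (i \<one>) = \<zero>\<^bsub>L\<^esub>"
    by (simp only: i.hom_one)
  then show ?thesis
    unfolding constants_def using S.one_closed S.one_not_zero by blast
qed

lemma submonoid_constants: "submonoid constants S"
proof (rule submonoid.intro)
  show "x \<otimes> y \<in> constants" if "x \<in> constants" "y \<in> constants" for x y
  proof -
    have cl: "x \<in> carrier S" "y \<in> carrier S" and nz: "x \<noteq> \<zero>" "y \<noteq> \<zero>"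
      and D0: "D (i x) = \<zero>\<^bsub>L\<^esub>" "D (i y) = \<zero>\<^bsub>L\<^esub>"
      using that unfolding constants_def by blast+
    have "D (i (x \<otimes> y)) = \<zero>\<^bsub>L\<^esub>"
      using cl by (simp add: D_mult D0)
    then show ?thesis
      unfolding constants_def using cl nz S.integral_iff[OF cl] S.m_closed[OF cl] by blast
  qed
  show "constants \<subseteq> carrier S"
    unfolding constants_def by blast
qed (rule one_constants)

text \<open>Density along \<open>s\<^sup>2\<close> writes \<open>s\<close> as a constant plus an element of \<open>s\<^sup>2 S\<close>, so that the constant is a
  multiple of \<open>s\<close>; it vanishes only if \<open>s\<close> is a unit.\<close>

lemma multiple_in_constants:
  assumes s: "s \<in> carrier S" "s \<noteq> \<zero>"
  shows "\<exists>t\<in>carrier S. t \<otimes> s \<in> constants"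
proof -
  have ss: "s \<otimes> s \<in> carrier S" "s \<otimes> s \<noteq> \<zero>"
    using s by (simp_all add: S.integral_iff)
  have "i s \<in> a_kernel B L D <+>\<^bsub>B\<^esub> i ` (PIdl (s \<otimes> s))"
    using dense[of "s \<otimes> s"] ss s(1) by blast
  then obtain b z where b: "b \<in> carrier B" "D b = \<zero>\<^bsub>L\<^esub>" and z: "z \<in> carrier S"
    and eq: "i s = b \<oplus>\<^bsub>B\<^esub> i (z \<otimes> (s \<otimes> s))"
    unfolding set_add_def' a_kernel_def' cgenideal_def by blast
  define t where "t = \<one> \<ominus> z \<otimes> s"
  have t: "t \<in> carrier S"
    using s z by (simp add: t_def)
  have ts: "t \<otimes> s = s \<ominus> z \<otimes> (s \<otimes> s)"
    using s z by (simp add: t_def S.minus_eq S.l_distr S.l_minus S.m_assoc)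
  have zss: "i (z \<otimes> (s \<otimes> s)) \<in> carrier B"
    using s(1) z by (intro i.hom_closed) simp
  have "i (t \<otimes> s) = i s \<ominus>\<^bsub>B\<^esub> i (z \<otimes> (s \<otimes> s))"
    unfolding ts S.minus_eq L.R.minus_eq using s(1) z by simp
  also have "\<dots> = b"
    unfolding eq using b(1) zss by (simp add: L.R.minus_eq L.R.a_assoc L.R.r_neg)
  finally have D_ts: "D (i (t \<otimes> s)) = \<zero>\<^bsub>L\<^esub>"
    using b(2) by simp
  show ?thesis
  proof (cases "t = \<zero>")
    case True
    then have "z \<otimes> s = \<one>"
      using s z S.minus_eq_zero_iff[of \<one> "z \<otimes> s"] by (simp add: t_def)
    then show ?thesis
      using one_constants z by (intro bexI[of _ z]) simp_all
  next
    case False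
    then have "t \<otimes> s \<in> constants"
      unfolding constants_def using D_ts s t False S.integral_iff[OF t s(1)] S.m_closed[OF t s(1)] by blast
    then show ?thesis
      using t by blast
  qed
qed

text \<open>What has to be shown is that constants suffice as denominators: a fraction with
  denominator \<open>c\<close> is expanded by a factor \<open>t\<close> for which \<open>t c\<close>
  is a nonzero constant.\<close>

sublocale twisting S K B L i j constants R D
proof (intro twisting.intro twisting_axioms.intro)
  have constantsD: "c \<in> carrier S - {\<zero>}" if "c \<in> constants" for c
    using that unfolding constants_def by blast
  show "\<exists>b\<in>carrier B. i c \<otimes>\<^bsub>B\<^esub> b = \<one>\<^bsub>B\<^esub>" if "c \<in> constants" for c
    using unit constantsD[OF that] by blast
  show "D (i c) = \<zero>\<^bsub>L\<^esub>" if "c \<in> constants" for c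
    using that unfolding constants_def by blast
  show "i ` carrier S \<subseteq> a_kernel B L D <+>\<^bsub>B\<^esub> i ` (PIdl c)" if "c \<in> constants" for c
    by (rule dense[OF constantsD[OF that]])
  show "\<exists>c\<in>constants. \<exists>s\<in>carrier S. i c \<otimes>\<^bsub>B\<^esub> b = i s" if b: "b \<in> carrier B" for b
  proof -
    obtain c s where c: "c \<in> carrier S" "c \<noteq> \<zero>" and s: "s \<in> carrier S" and cb: "i c \<otimes>\<^bsub>B\<^esub> b = i s"
      using B_fraction[OF b] by blast
    obtain t where t: "t \<in> carrier S" "t \<otimes> c \<in> constants"
      using multiple_in_constants[OF c] by blast
    have "i (t \<otimes> c) \<otimes>\<^bsub>B\<^esub> b = i (t \<otimes> s)"
      using b c(1) s t(1) by (simp add: L.R.m_assoc cb)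
    then show ?thesis
      using t s S.m_closed by blast
  qed
  show "\<exists>c\<in>constants. \<exists>k\<in>carrier K. i c \<odot>\<^bsub>L\<^esub> \<xi> = j k" if \<xi>: "\<xi> \<in> carrier L" for \<xi>
  proof -
    obtain c k where c: "c \<in> carrier S" "c \<noteq> \<zero>" and k: "k \<in> carrier K"
      and c\<xi>: "i c \<odot>\<^bsub>L\<^esub> \<xi> = j k"
      using L_fraction[OF \<xi>] by blast
    obtain t where t: "t \<in> carrier S" "t \<otimes> c \<in> constants"
      using multiple_in_constants[OF c] by blast
    have "i (t \<otimes> c) \<odot>\<^bsub>L\<^esub> \<xi> = j (t \<odot>\<^bsub>K\<^esub> k)"
      using \<xi> c(1) k t(1) by (simp add: L.smult_assoc1 c\<xi> j_smult)
    then show ?thesis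
      using t k K.smult_closed by blast
  qed
  show "j (s \<odot>\<^bsub>K\<^esub> k) = i s \<odot>\<^bsub>L\<^esub> j k" if "s \<in> carrier S" "k \<in> carrier K" for s k
    by (rule j_smult[OF that])
qed (fact K.module_axioms L.module_axioms i.ring_hom_cring_axioms j.abelian_group_hom_axioms
    submonoid_constants i_inj j_inj derivation R_eq subring_R span)+

end

context localization
begin

interpretation ext: scalar_extension S B i K
  by (rule scalar_extension_loc_ring)

lemma strong_twistingI:
  assumes S: "domain S" and C: "C = carrier S - {\<zero>}" and tf: "torsion_free_along C K"
    and R: "subring R S" and strong: "strongly_twists S K R D"
  shows "strong_twisting S K B ext.BN i ext.ext_map R D"
proof -
  have nzd: "C \<subseteq> nonzerodivisors S"
    unfolding C nonzerodivisors_def using domain.integral[OF S] by blast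
  note unfolded = strong[unfolded strongly_twists_def Let_def quotient_field_def quotient_field_map_def C[symmetric]]
  show ?thesis
  proof (intro strong_twisting.intro strong_twisting_axioms.intro; (unfold C[symmetric])?)
    show "domain S" "module S K" "module B ext.BN" "ring_hom_cring S B i" "subring R S"
      by (fact S module_axioms ext.module_extend_scalars ring_hom_cring_loc_ring_map R)+
    show "abelian_group_hom K ext.BN ext.ext_map"
      by (rule ext.extend_scalars_map_hom)
    show "inj_on i (carrier S)"
      by (rule loc_ring_map_inj[OF nzd])
    show "inj_on ext.ext_map (carrier K)"
      by (rule extend_scalars_loc_inj[OF tf])
    show "ext.ext_map (s \<odot>\<^bsub>K\<^esub> k) = i s \<odot>\<^bsub>ext.BN\<^esub> ext.ext_map k" if "s \<in> carrier S" "k \<in> carrier K" for s k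
      by (rule ext.extend_scalars_map_smult[OF that])
    show "\<exists>b\<in>carrier B. i c \<otimes>\<^bsub>B\<^esub> b = \<one>\<^bsub>B\<^esub>" if "c \<in> C" for c
      by (rule loc_ring_unit[OF that])
    show "\<exists>c\<in>C. \<exists>s\<in>carrier S. i c \<otimes>\<^bsub>B\<^esub> b = i s" if "b \<in> carrier B" for b
      by (rule loc_ring_fraction[OF that])
    show "\<exists>c\<in>C. \<exists>k\<in>carrier K. i c \<odot>\<^bsub>ext.BN\<^esub> \<xi> = ext.ext_map k" if "\<xi> \<in> carrier ext.BN" for \<xi>
      by (rule extend_scalars_loc_fraction[OF that])
    show "derivation B ext.BN D" "R = {s \<in> carrier S. D (i s) \<in> ext.ext_map ` carrier K}"
      "module_span B ext.BN (D ` carrier B) = carrier ext.BN"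
      by (rule unfolded[THEN conjunct1], rule unfolded[THEN conjunct2, THEN conjunct1],
          rule unfolded[THEN conjunct2, THEN conjunct2, THEN conjunct1])
    have "\<forall>s\<in>C. i ` carrier S \<subseteq> a_kernel B ext.BN D <+>\<^bsub>B\<^esub> i ` (PIdl s)"
      using unfolded by (elim conjE)
    then show "i ` carrier S \<subseteq> a_kernel B ext.BN D <+>\<^bsub>B\<^esub> i ` (PIdl s)" if "s \<in> C" for s
      by (rule bspec[OF _ that])
  qed
qed

end

theorem theorem4p6:
  fixes S :: "('s, 'x) ring_scheme"
    and K :: "('s, 'k, 'y) module_scheme"
    and C R :: "'s set"
    and D :: "('s \<times> 's) set \<Rightarrow> ('k \<times> 's) set"
  assumes "cring S"
    and "submonoid C S" and "C \<subseteq> nonzerodivisors S"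
    and "module S K" and "torsion_free_along C K"
    and "subring R S"
    and "twists_along S C K R D"
  shows "analytic_iso_along (S\<lparr>carrier := R\<rparr>) (idealization S K) C (twist_map S C K D) \<and>
    (domain S \<longrightarrow> torsion_free_along (carrier S - {\<zero>\<^bsub>S\<^esub>}) K \<longrightarrow>
      (\<forall>D'. strongly_twists S K R D' \<longrightarrow>
        faithfully_flat_hom TYPE('n1) TYPE('n2) TYPE('n3)
          (S\<lparr>carrier := R\<rparr>) (idealization S K) (strong_twist_map S K D')))"
proof (intro conjI impI allI)
  interpret localization S C K
    by (intro localization.intro assms)
  interpret twisting S K B L i j C R D
    by (rule twistingI[OF assms(3,5,6,7)])
  show "analytic_iso_along (S\<lparr>carrier := R\<rparr>) (idealization S K) C (twist_map S C K D)"
    using analytic_iso by (simp add: twist_map_def)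
next
  fix D' assume "domain S" "torsion_free_along (carrier S - {\<zero>\<^bsub>S\<^esub>}) K" "strongly_twists S K R D'"
  note D' = this
  \<comment> \<open>Localizing at this set gives the quotient field; the twist obtained from
    \<open>D'\<close> is along the smaller set of its nonzero constants.\<close>
  let ?C = "carrier S - {\<zero>\<^bsub>S\<^esub>}"
  interpret S: domain S by (rule D'(1))
  have "submonoid ?C S"
    by (auto simp: submonoid_def S.integral_iff)
  then have "localization S ?C K"
    by (intro localization.intro assms)
  from localization.strong_twistingI[OF this D'(1) refl D'(2) assms(6) D'(3)]
  interpret D': strong_twisting S K "loc_ring S ?C" "extend_scalars S (loc_ring S ?C) (loc_ring_map S ?C) K"
      "loc_ring_map S ?C" "extend_scalars_map S (loc_ring S ?C) (loc_ring_map S ?C) K" R D' .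
  show "faithfully_flat_hom TYPE('n1) TYPE('n2) TYPE('n3)
      (S\<lparr>carrier := R\<rparr>) (idealization S K) (strong_twist_map S K D')"
    unfolding strong_twist_map_def Let_def quotient_field_def quotient_field_map_def
    by (rule D'.faithfully_flat_hom[OF D'(1) D'.multiple_in_constants])
qed

end
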